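(* Suppose $b$ is an arrow in the quiver $Q$. Then the $A$-module $bA$ has two rhombus filtrations, each with two quotients.
   Context: Tiling. Let $\mathrm p:\mathbb R^3\to\mathbb R^2$ be linear with $\mathrm p(\mathbf e_1)=(-\frac{\sqrt3}{2},-\frac12)$, $\mathrm p(\mathbf e_2)=(\frac{\sqrt3}{2},-\frac12)$, $\mathrm p(\mathbf e_3)=(0,1)$. For $\{i,j,k\}=\{1,2,3\}$ let $R_k=\{\lambda \mathrm p(\mathbf e_i)+\mu \mathrm p(\mathbf e_j):0\le\lambda,\mu\le1\}$. Let $\mathbf M=\begin{pmatrix}0&1&0\\0&0&1\\1&-1&-1\end{pmatrix}$ with columns $\mathbf c_1,\mathbf c_2,\mathbf c_3$. A pair $(z,k)$, $z\in\mathbb Z^3$, represents the rhombus $\mathrm p(z)+R_k$. Put $\mathcal P_0=\{(0,1),(0,2),(0,3)\}$ and $\mathcal P_{i+1}=\bigcup_{(z,k)\in\mathcal P_i}\mathcal R(z,k)$, where $\mathcal R(z,1)=\{(\mathbf Mz,3),(\mathbf Mz+\mathbf c_2,1),(\mathbf Mz+\mathbf c_3,2)\}$, $\mathcal R(z,2)=\{(\mathbf Mz,1)\}$, $\mathcal R(z,3)=\{(\mathbf Mz,2)\}$. Then $\mathcal P_i\subset\mathcal P_{i+1}$ and $\bigcup_i\mathcal P_i$ is a tiling of the plane by rhombi (the Rauzy tiling). Algebra $A$. Let $Q$ be the quiver whose vertices are the vertices of the Rauzy tiling, with each edge replaced by two arrows in opposite directions; $\bar b$ is the arrow opposite to $b$.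 Let $k$ be a field. Paths are composed left to right and modules are right modules. The Rauzy algebra is $A=kQ/I$, where $I$ is generated by: (1) a path of length two along two distinct edges that are not both edges of one rhombus is zero; (2) the two paths of length two joining opposite vertices of a rhombus (along its boundary) are equal; (3) for each vertex $z$, $s_1(z)D_1(z)=s_2(z)D_2(z)=s_3(z)D_3(z)$, where $D_a(z)=L_a^+(z)-L_a^-(z)$, $L_a^{\pm}(z)=g\bar g$ if there is an arrow $g:z\to z\pm\mathrm p(\mathbf e_a)$ and $L_a^\pm(z)=0$ otherwise, and $s_a(z)\in\{\pm1\}$ is a fixed choice of signs such that whenever $z,x$ are joined by an edge parallel to $\mathrm p(\mathbf e_a)$, $s_a(x)=-s_a(z)$ and $s_c(x)=s_c(z)$ for $c\ne a$ (such signs are determined by their values at one vertex). $S_z$ is the simple module at $z$. Rhombus modules. For a rhombus of the tiling with opposite vertices $z,y$ and remaining vertices $u,v$, the rhombus module $R^y_z$ is the (unique up to isomorphism) $A$-module with top $S_y$, socle $S_z$ and $\mathrm{rad}/\mathrm{soc}\cong S_u\oplus S_v$; explicitly $R^y_z=pA$ with $p$ the path of length two from $z$ to $y$ around the rhombus. A module $M$ has a rhombus filtration (with $r$ quotients) if there are submodules $0=M_0\subset M_1\subset\dots\subset M_r=M$ with each $M_j/M_{j-1}$ a rhombus module. *)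

theory Defs
  imports "HOL-Analysis.Analysis" "HOL-Library.Poly_Mapping" "HOL-Algebra.QuotRing"
begin

section \<open>The Rauzy tiling\<close>

definition plane_basis :: "3 \<Rightarrow> real^2" where
  "plane_basis a =
     (if a = 1 then vector [- sqrt 3 / 2, - 1 / 2]
      else if a = 2 then vector [sqrt 3 / 2, - 1 / 2]
      else vector [0, 1])"

definition plane_proj :: "real^3 \<Rightarrow> real^2" where
  "plane_proj v = (\<Sum>a\<in>UNIV. (v $ a) *\<^sub>R plane_basis a)"

definition lattice_proj :: "int^3 \<Rightarrow> real^2" where
  "lattice_proj z = plane_proj (\<chi> a. real_of_int (z $ a))"

definition rauzy_matrix :: "int^3^3" where
  "rauzy_matrix = vector [vector [0, 1, 0], vector [0, 0, 1], vector [1, -1, -1]]"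

type_synonym tile = "(int^3) \<times> 3"

definition subst_tile :: "tile \<Rightarrow> tile set" where
  "subst_tile = (\<lambda>(z, k).
     let w = rauzy_matrix *v z in
       if k = 1 then {(w, 3), (w + column 2 rauzy_matrix, 1), (w + column 3 rauzy_matrix, 2)}
       else if k = 2 then {(w, 1)}
       else {(w, 2)})"

primrec patch :: "nat \<Rightarrow> tile set" where
  "patch 0 = {(0, 1), (0, 2), (0, 3)}"
| "patch (Suc i) = (\<Union>t\<in>patch i. subst_tile t)"

definition rauzy_tiling :: "tile set" where
  "rauzy_tiling = (\<Union>i. patch i)"

text \<open>
  The four sides, as pairs of endpoints, of the rhombus \<open>p(z) + R\<^sub>k\<close>, where \<open>R\<^sub>k\<close> is spanned by
  \<open>p(e\<^sub>i)\<close> and \<open>p(e\<^sub>j)\<close>. As \<open>i\<close> and \<open>j\<close> may be exchanged, both pairs of parallel sides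
  are listed.
\<close>

definition sides :: "tile \<Rightarrow> (real^2) set set" where
  "sides = (\<lambda>(z, k).
     {E. \<exists>i j. {i, j, k} = UNIV \<and>
         (E = {lattice_proj z, lattice_proj (z + axis i 1)} \<or>
          E = {lattice_proj (z + axis j 1), lattice_proj (z + axis i 1 + axis j 1)})})"

definition edges :: "(real^2) set set" where
  "edges = (\<Union>t\<in>rauzy_tiling. sides t)"

definition vertices :: "(real^2) set" where
  "vertices = \<Union>edges"


section \<open>The path algebra\<close>

text \<open>
  An arrow from \<open>x\<close> to \<open>y\<close> is given by its endpoints, with \<open>{x, y}\<close> an edge, and a path by the
  nonempty list of the vertices that it visits, the starting vertex first. The lists of length one
  are the idempotents. An element of the path algebra is a finitely supported function on paths.
\<close>

type_synonym qpath = "(real^2) list"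

definition paths :: "qpath set" where
  "paths = {u. u \<noteq> [] \<and> set u \<subseteq> vertices \<and> successively (\<lambda>x y. {x, y} \<in> edges) u}"

abbreviation path_elt :: "qpath \<Rightarrow> qpath \<Rightarrow>\<^sub>0 'k::field" where
  "path_elt u \<equiv> Poly_Mapping.single u 1"

definition path_mult :: "(qpath \<Rightarrow>\<^sub>0 'k::field) \<Rightarrow> (qpath \<Rightarrow>\<^sub>0 'k) \<Rightarrow> (qpath \<Rightarrow>\<^sub>0 'k)" where
  "path_mult f g =
     (\<Sum>u\<in>Poly_Mapping.keys f. \<Sum>w\<in>Poly_Mapping.keys g.
        if last u = hd w
        then Poly_Mapping.single (u @ tl w) (Poly_Mapping.lookup f u * Poly_Mapping.lookup g w)
        else 0)"

text \<open>
  There are infinitely many vertices, so the path algebra and its quotients have no identity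
  element, and the field \<open>one\<close> of their records is meaningless. This is also why two-sided ideals
  are introduced here: the locale \<open>ideal\<close> presupposes a unital ring.
\<close>

definition path_algebra :: "(qpath \<Rightarrow>\<^sub>0 'k::field) ring" where
  "path_algebra =
     \<lparr>carrier = {f. Poly_Mapping.keys f \<subseteq> paths}, mult = path_mult, one = undefined,
      zero = 0, add = (+)\<rparr>"

definition two_sided_ideal :: "'a set \<Rightarrow> ('a, 'm) ring_scheme \<Rightarrow> bool" where
  "two_sided_ideal J R \<longleftrightarrow>
     additive_subgroup J R \<and>
     (\<forall>a\<in>J. \<forall>r\<in>carrier R. r \<otimes>\<^bsub>R\<^esub> a \<in> J \<and> a \<otimes>\<^bsub>R\<^esub> r \<in> J)"

definition generated_ideal :: "('a, 'm) ring_scheme \<Rightarrow> 'a set \<Rightarrow> 'a set" where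
  "generated_ideal R S = \<Inter>{J. two_sided_ideal J R \<and> S \<subseteq> J}"


section \<open>The Rauzy algebra\<close>

definition sign_choice :: "(3 \<Rightarrow> real^2 \<Rightarrow> int) \<Rightarrow> bool" where
  "sign_choice s \<longleftrightarrow>
     (\<forall>a. \<forall>z\<in>vertices. s a z \<in> {1, -1}) \<and>
     (\<forall>a z x. {z, x} \<in> edges \<and> x = z + plane_basis a \<longrightarrow>
        s a x = - s a z \<and> (\<forall>c. c \<noteq> a \<longrightarrow> s c x = s c z))"

definition loop_at :: "real^2 \<Rightarrow> real^2 \<Rightarrow> qpath \<Rightarrow>\<^sub>0 'k::field" where
  "loop_at z x = (if {z, x} \<in> edges then path_elt [z, x, z] else 0)"

definition axis_difference :: "3 \<Rightarrow> real^2 \<Rightarrow> qpath \<Rightarrow>\<^sub>0 'k::field" where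
  "axis_difference a z = loop_at z (z + plane_basis a) - loop_at z (z - plane_basis a)"

definition signed_difference ::
    "(3 \<Rightarrow> real^2 \<Rightarrow> int) \<Rightarrow> 3 \<Rightarrow> real^2 \<Rightarrow> qpath \<Rightarrow>\<^sub>0 'k::field" where
  "signed_difference s a z =
     Poly_Mapping.map ((*) (of_int (s a z))) (axis_difference a z)"

definition relations1 :: "(qpath \<Rightarrow>\<^sub>0 'k::field) set" where
  "relations1 =
     {path_elt [x, y, w] | x y w.
        {x, y} \<in> edges \<and> {y, w} \<in> edges \<and> {x, y} \<noteq> {y, w} \<and>
        \<not> (\<exists>t\<in>rauzy_tiling. {x, y} \<in> sides t \<and> {y, w} \<in> sides t)}"

definition around_tile :: "tile \<Rightarrow> real^2 \<Rightarrow> real^2 \<Rightarrow> real^2 \<Rightarrow> bool" where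
  "around_tile t x u y \<longleftrightarrow> {x, u} \<in> sides t \<and> {u, y} \<in> sides t \<and> x \<noteq> y"

definition relations2 :: "(qpath \<Rightarrow>\<^sub>0 'k::field) set" where
  "relations2 =
     {path_elt [x, u, y] - path_elt [x, v, y] | x u v y.
        \<exists>t\<in>rauzy_tiling. around_tile t x u y \<and> around_tile t x v y}"

definition relations3 :: "(3 \<Rightarrow> real^2 \<Rightarrow> int) \<Rightarrow> (qpath \<Rightarrow>\<^sub>0 'k::field) set" where
  "relations3 s =
     {signed_difference s a z - signed_difference s c z | a c z. z \<in> vertices}"

definition rauzy_ideal :: "(3 \<Rightarrow> real^2 \<Rightarrow> int) \<Rightarrow> (qpath \<Rightarrow>\<^sub>0 'k::field) set" where
  "rauzy_ideal s = generated_ideal path_algebra (relations1 \<union> relations2 \<union> relations3 s)"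

definition rauzy_algebra :: "(3 \<Rightarrow> real^2 \<Rightarrow> int) \<Rightarrow> (qpath \<Rightarrow>\<^sub>0 'k::field) set ring" where
  "rauzy_algebra s = path_algebra Quot rauzy_ideal s"

definition path_class ::
    "(3 \<Rightarrow> real^2 \<Rightarrow> int) \<Rightarrow> qpath \<Rightarrow> (qpath \<Rightarrow>\<^sub>0 'k::field) set" where
  "path_class s u = rauzy_ideal s +>\<^bsub>path_algebra\<^esub> path_elt u"


section \<open>Right modules and rhombus filtrations\<close>

text \<open>
  The additive group of a module is written as a multiplicative monoid record, so that subgroups,
  quotients and isomorphisms of groups apply. Scalars need no separate field: on the modules below
  (right ideals of the Rauzy algebra and their subquotients), multiplication by a scalar \<open>c\<close> sends
  \<open>m\<close> to a finite sum of terms \<open>m (c e\<^sub>x)\<close>, where \<open>e\<^sub>x\<close> is the idempotent at the vertex \<open>x\<close>, so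
  that submodules and module homomorphisms are automatically linear.
\<close>

record ('a, 'm) rmodule = "'m monoid" +
  act :: "'m \<Rightarrow> 'a \<Rightarrow> 'm"

definition right_ideal_module :: "('a, 'r) ring_scheme \<Rightarrow> 'a set \<Rightarrow> ('a, 'a) rmodule" where
  "right_ideal_module R N =
     \<lparr>carrier = N, mult = add R, one = \<zero>\<^bsub>R\<^esub>, act = mult R\<rparr>"

definition cyclic_right_ideal :: "('a, 'r) ring_scheme \<Rightarrow> 'a \<Rightarrow> ('a, 'a) rmodule" where
  "cyclic_right_ideal R a = right_ideal_module R (a <#\<^bsub>R\<^esub> carrier R)"

definition right_submodule :: "('a, 'r) ring_scheme \<Rightarrow> 'm set \<Rightarrow> ('a, 'm) rmodule \<Rightarrow> bool" where
  "right_submodule R N M \<longleftrightarrow> subgroup N M \<and> (\<forall>n\<in>N. \<forall>a\<in>carrier R. act M n a \<in> N)"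

definition quotient_module :: "('a, 'm) rmodule \<Rightarrow> 'm set \<Rightarrow> ('a, 'm set) rmodule" where
  "quotient_module M N =
     \<lparr>carrier = carrier (M Mod N), mult = mult (M Mod N), one = one (M Mod N),
      act = (\<lambda>X a. \<Union>x\<in>X. N #>\<^bsub>M\<^esub> act M x a)\<rparr>"

definition module_iso ::
    "('a, 'r) ring_scheme \<Rightarrow> ('a, 'm) rmodule \<Rightarrow> ('a, 'n) rmodule \<Rightarrow> bool" where
  "module_iso R M N \<longleftrightarrow>
     (\<exists>h\<in>iso M N. \<forall>m\<in>carrier M. \<forall>a\<in>carrier R. h (act M m a) = act N (h m) a)"

text \<open>
  The rhombus module at opposite vertices \<open>z\<close>, \<open>y\<close> of a rhombus is the right ideal generated by
  the path \<open>z \<rightarrow> u \<rightarrow> y\<close> along two of its sides, up to isomorphism.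
\<close>

definition rhombus_module ::
    "(3 \<Rightarrow> real^2 \<Rightarrow> int) \<Rightarrow> ((qpath \<Rightarrow>\<^sub>0 'k::field) set, 'm) rmodule \<Rightarrow> bool" where
  "rhombus_module s M \<longleftrightarrow>
     (\<exists>t\<in>rauzy_tiling. \<exists>z u y. around_tile t z u y \<and>
        module_iso (rauzy_algebra s) M
          (cyclic_right_ideal (rauzy_algebra s) (path_class s [z, u, y])))"

text \<open>
  A filtration is the list \<open>[M\<^sub>0, \<dots>, M\<^sub>r]\<close> of its terms, so that two filtrations are equal as
  lists exactly if they have the same terms.
\<close>

definition rhombus_filtration ::
    "(3 \<Rightarrow> real^2 \<Rightarrow> int) \<Rightarrow> ((qpath \<Rightarrow>\<^sub>0 'k::field) set, 'm) rmodule \<Rightarrow> nat \<Rightarrow> 'm set list \<Rightarrow> bool"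
  where
  "rhombus_filtration s M r F \<longleftrightarrow>
     length F = Suc r \<and> F ! 0 = {\<one>\<^bsub>M\<^esub>} \<and> F ! r = carrier M \<and>
     (\<forall>j\<le>r. right_submodule (rauzy_algebra s) (F ! j) M) \<and>
     (\<forall>j<r. F ! j \<subset> F ! Suc j \<and>
        rhombus_module s (quotient_module (M\<lparr>carrier := F ! Suc j\<rparr>) (F ! j)))"

end

theory Submission
  imports Defs
begin

text \<open>
  The Rauzy tiling is a discrete plane: with \<open>v\<close> the contracted left eigenvector of the matrix, it
  consists of the tiles \<open>(z, k)\<close> with \<open>0 \<le> \<langle>v, z\<rangle> < v\<^sub>k\<close>. Hence every edge has exactly one tile on each
  side. Let \<open>x y w1 v1\<close> and \<open>x y w2 v2\<close> be the tiles at the edge of \<open>b = x \<rightarrow> y\<close>. Then left multiplication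
  by \<open>v2 \<rightarrow> x\<close> maps \<open>bA\<close> onto the rhombus module of the path \<open>v2 \<rightarrow> x \<rightarrow> y\<close>, and its kernel is the
  rhombus module of the path \<open>x \<rightarrow> y \<rightarrow> w1\<close>; exchanging the two tiles gives the second filtration.
  That the kernel is no larger needs closed paths around a tile to be nonzero in \<open>A\<close>; they are
  detected by a cyclic trace form, supported on the closed paths of length four, that vanishes on
  the ideal of relations.
\<close>

section \<open>The Rauzy tiling as a discrete plane\<close>

text \<open>The tiling is given as a union of patches, but the algebra only depends on local data:
  which tiles meet at an edge or a vertex. The discrete plane supplies them. The hard half is that
  each of its tiles occurs in some patch. The matrix has determinant 1, and its eigenvalues other
  than \<open>contraction\<close> have modulus above 1. Passing to parents therefore contracts
  differences of base points in these directions, while the heights of tiles stay in [0, 1); only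
  finitely many differences arise, and these can be checked by computation. The values of the trace
  are forced by the relations. A path around a tile of type k counts as the sign s_k. Relation (2)
  carries this over to the paths x -> u -> x -> q -> x with u and q on a common tile. Relation (3),
  completed by a loop at u, expresses x -> u -> x -> u -> x through the tiles at the edge, in one
  way for each of the two other axes. Both ways agree because there is exactly one tile on each side
  of the edge.\<close>

lemma contraction_root_exists: "\<exists>r::real. 5436/10000 < r \<and> r < 5437/10000 \<and> r^3 + r^2 + r = 1"
proof -
  let ?f = "\<lambda>r::real. r^3 + r^2 + r"
  have "\<exists>r\<ge>5436/10000. r \<le> 5437/10000 \<and> ?f r = 1"
    by (rule IVT') (auto simp: power_divide intro!: continuous_intros)
  then obtain r :: real where r: "5436/10000 \<le> r" "r \<le> 5437/10000" "?f r = 1" by blast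
  have "?f (5436/10000) \<noteq> 1" "?f (5437/10000) \<noteq> 1" by (simp_all add: power_divide)
  then have "r \<noteq> 5436/10000" "r \<noteq> 5437/10000" using r(3) by metis+
  with r show ?thesis by (intro exI[of _ r]) auto
qed

text \<open>The reciprocal of the tribonacci constant, a root of the characteristic polynomial t^3 +
  t^2 + t - 1 of the matrix. The bounds to four decimals are sharp enough for all height comparisons
  that are computed below.\<close>

definition contraction :: real where
  "contraction = (SOME r. 5436/10000 < r \<and> r < 5437/10000 \<and> r^3 + r^2 + r = 1)"

lemma contraction_bounds: "5436/10000 < contraction" "contraction < 5437/10000"
  and contraction_root: "contraction^3 + contraction^2 + contraction = 1"
  using someI_ex[OF contraction_root_exists] unfolding contraction_def by auto

text \<open>The left eigenvector of the matrix for the eigenvalue \<open>contraction\<close>.\<close>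

definition weight :: "3 \<Rightarrow> real" where
  "weight a = (if a = 1 then 1 else if a = 2 then contraction + contraction^2 else contraction)"

definition height :: "int^3 \<Rightarrow> real" where
  "height z = (\<Sum>a\<in>UNIV. of_int (z $ a) * weight a)"

definition discrete_plane :: "tile set" where
  "discrete_plane = {(z, k). 0 \<le> height z \<and> height z < weight k}"

lemma weight_simps: "weight 1 = 1" "weight 2 = contraction + contraction^2" "weight 3 = contraction"
  by (simp_all add: weight_def)

lemma weight_bounds: "8391/10000 < weight 2" "weight 2 < 8394/10000"
  "5436/10000 < weight 3" "weight 3 < 5437/10000"
proof -
  have a: "(5436/10000)^2 < contraction^2" "contraction^2 < (5437/10000)^2"
    using contraction_bounds by (auto intro!: power_strict_mono)
  then show "8391/10000 < weight 2" "weight 2 < 8394/10000"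
    using contraction_bounds by (auto simp: weight_simps power2_eq_square)
qed (use contraction_bounds in \<open>auto simp: weight_simps\<close>)

lemma weight_pos: "0 < weight a" and weight_le_1: "weight a \<le> 1"
  using weight_bounds weight_simps(1) exhaust_3[of a] by auto

text \<open>These are the eigenvector equations, and at the same time the lengths of the pieces into
  which the substitution cuts the height intervals.\<close>

lemma weight_mult:
  "contraction * weight 1 = weight 3"
  "contraction * weight 2 = weight 1 - weight 3"
  "contraction * weight 3 = weight 2 - weight 3"
  using contraction_root by (auto simp: weight_simps algebra_simps power2_eq_square power3_eq_cube)

section \<open>Heights of lattice vectors under the substitution\<close>

lemma height_add: "height (z + w) = height z + height w"
  and height_diff: "height (z - w) = height z - height w"
  and height_minus: "height (- z) = - height z"
  and height_0: "height 0 = 0"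
  by (auto simp: height_def sum_3 algebra_simps)

lemma height_axis: "height (axis a 1) = weight a"
  using exhaust_3[of a] by (auto simp: height_def sum_3 axis_def)

lemma height_3: "height z = z$1 + z$2 * weight 2 + z$3 * weight 3"
  by (simp add: height_def sum_3 weight_simps)

lemma matrix_mult: "(rauzy_matrix *v z) = vector [z$2, z$3, z$1 - z$2 - z$3]"
  by (simp add: rauzy_matrix_def matrix_vector_mult_def vec_eq_iff forall_3 sum_3)

lemma column_2: "column 2 rauzy_matrix = vector [1, 0, -1]"
  and column_3: "column 3 rauzy_matrix = vector [0, 1, -1]"
  by (auto simp: rauzy_matrix_def column_def vec_eq_iff forall_3)

lemma height_matrix: "height (rauzy_matrix *v z) = contraction * height z"
proof -
  have "contraction * height z =
      z$1 * (contraction * weight 1) + z$2 * (contraction * weight 2) + z$3 * (contraction * weight 3)"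
    by (simp add: height_def sum_3 algebra_simps)
  also have "\<dots> = height (rauzy_matrix *v z)"
    unfolding weight_mult by (simp add: height_3 matrix_mult algebra_simps weight_simps(1))
  finally show ?thesis ..
qed

lemma height_column: "height (column 2 rauzy_matrix) = 1 - weight 3"
  "height (column 3 rauzy_matrix) = weight 2 - weight 3"
  by (auto simp: column_2 column_3 height_3)

text \<open>The matrix shrinks the interval [0, weight k) to [0, contraction * weight k). For k = 1
  this is the interval of type 3, and adding a column lifts it to the upper end of the interval of
  type 1 or 2.\<close>

lemma subst_tile_discrete_plane:
  assumes "t \<in> discrete_plane"
  shows "subst_tile t \<subseteq> discrete_plane"
proof -
  obtain z k where t: "t = (z, k)" by fastforce
  have h: "0 \<le> height z" "height z < weight k" using assms t by (auto simp: discrete_plane_def)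
  have c: "0 < contraction" using contraction_bounds by linarith
  have *: "0 \<le> contraction * height z" "contraction * height z < contraction * weight k"
    using h c by auto
  have w: "0 < weight 3" "weight 3 < weight 2" "weight 2 < 1" "weight 1 = 1"
    using weight_bounds weight_simps by auto
  from exhaust_3[of k] show ?thesis
  proof (elim disjE)
    assume k: "k = 1"
    show ?thesis using *(1) *(2)[unfolded k weight_mult] w
      by (auto simp: t k subst_tile_def discrete_plane_def height_add height_matrix height_column
          Let_def)
  next
    assume k: "k = 2"
    show ?thesis using *(1) *(2)[unfolded k weight_mult] w
      by (auto simp: t k subst_tile_def discrete_plane_def height_matrix Let_def)
  next
    assume k: "k = 3"
    show ?thesis using *(1) *(2)[unfolded k weight_mult] w
      by (auto simp: t k subst_tile_def discrete_plane_def height_matrix Let_def)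
  qed
qed

lemma patch_subset: "patch n \<subseteq> discrete_plane"
proof (induction n)
  case 0
  then show ?case by (auto simp: discrete_plane_def height_0 weight_pos)
next
  case (Suc n)
  then show ?case using subst_tile_discrete_plane by auto
qed

section \<open>Parents of tiles\<close>

definition rauzy_inv :: "int^3 \<Rightarrow> int^3" where
  "rauzy_inv w = vector [w$1 + w$2 + w$3, w$1, w$2]"

lemma rauzy_inv_cancel: "rauzy_matrix *v rauzy_inv w = w"
  by (simp add: matrix_mult rauzy_inv_def vec_eq_iff forall_3)

lemma rauzy_inv_add: "rauzy_inv (v + w) = rauzy_inv v + rauzy_inv w"
  and rauzy_inv_diff: "rauzy_inv (v - w) = rauzy_inv v - rauzy_inv w"
  by (simp_all add: rauzy_inv_def vec_eq_iff forall_3)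

lemma height_rauzy_inv: "contraction * height (rauzy_inv w) = height w"
  by (metis height_matrix rauzy_inv_cancel)

lemma matrix_axis: "rauzy_matrix *v axis 2 1 = column 2 rauzy_matrix"
  "rauzy_matrix *v axis 3 1 = column 3 rauzy_matrix"
  by (simp_all add: matrix_mult column_2 column_3 vec_eq_iff forall_3 axis_def)

text \<open>The columns added by the substitution are the images of the second and third unit
  vectors, so these are the corrections to \<open>rauzy_inv w\<close> that lead to a parent of a
  tile at w.\<close>

definition parent_shifts :: "(int^3) set" where
  "parent_shifts = {0, axis 2 1, axis 3 1}"

lemma matrix_shift_cancel: "rauzy_matrix *v (rauzy_inv w - e) + rauzy_matrix *v e = w"
  by (metis (no_types) diff_add_cancel rauzy_inv_cancel matrix_vector_right_distrib)

text \<open>The children partition the height intervals: [0, weight 1) is cut at 1 - weight 3 into a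
  piece with a parent of type 2 and one with a parent of type 1, and [0, weight 2) at weight 2 -
  weight 3 into pieces with parents of types 3 and 1. All of [0, weight 3) has parents of type
  1.\<close>

lemma parent_exists:
  assumes "(w, k) \<in> discrete_plane"
  shows "\<exists>e\<in>parent_shifts. \<exists>k'. (rauzy_inv w - e, k') \<in> discrete_plane \<and>
    (w, k) \<in> subst_tile (rauzy_inv w - e, k')"
proof -
  have c: "0 < contraction" using contraction_bounds by linarith
  have h: "0 \<le> height w" "height w < weight k" using assms by (auto simp: discrete_plane_def)
  \<comment> \<open>Multiplying the bounds by \<open>contraction\<close> replaces the height of
    \<open>rauzy_inv w\<close> by that of w.\<close>
  have in_plane: "(rauzy_inv w - e, k') \<in> discrete_plane \<longleftrightarrow>
      contraction * height e \<le> height w \<and> height w < contraction * weight k' + contraction * height e" for e k'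
  proof -
    have "0 \<le> height (rauzy_inv w - e) \<longleftrightarrow> 0 \<le> contraction * height (rauzy_inv w - e)"
      using c by (simp add: zero_le_mult_iff)
    moreover have "height (rauzy_inv w - e) < weight k' \<longleftrightarrow>
       contraction * height (rauzy_inv w - e) < contraction * weight k'"
      using c by simp
    ultimately show ?thesis
      by (auto simp: discrete_plane_def height_diff right_diff_distrib height_rauzy_inv)
  qed
  have shift: "w = rauzy_matrix *v (rauzy_inv w - e) + rauzy_matrix *v e" for e
    by (simp add: matrix_shift_cancel)
  have cw: "0 < weight 3" "weight 1 = 1" using weight_bounds weight_simps by auto
  consider "k = 1" "height w < 1 - weight 3" | "k = 1" "height w \<ge> 1 - weight 3"
    | "k = 2" "height w < weight 2 - weight 3" | "k = 2" "height w \<ge> weight 2 - weight 3"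
    | "k = 3" using exhaust_3[of k] by force
  then show ?thesis
  proof cases
    case 1
    then have "(rauzy_inv w - 0, 2) \<in> discrete_plane" "(w, k) \<in> subst_tile (rauzy_inv w - 0, 2)"
      unfolding in_plane height_0 mult_zero_right weight_mult using h cw
      by (auto simp: subst_tile_def Let_def rauzy_inv_cancel)
    then show ?thesis unfolding parent_shifts_def by blast
  next
    case 2
    then have "(rauzy_inv w - axis 2 1, 1) \<in> discrete_plane"
      "(w, k) \<in> subst_tile (rauzy_inv w - axis 2 1, 1)"
      unfolding in_plane height_axis weight_mult using h cw shift[of "axis 2 1"]
      by (auto simp: subst_tile_def Let_def matrix_axis)
    then show ?thesis unfolding parent_shifts_def by blast
  next
    case 3
    then have "(rauzy_inv w - 0, 3) \<in> discrete_plane" "(w, k) \<in> subst_tile (rauzy_inv w - 0, 3)"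
      unfolding in_plane height_0 mult_zero_right weight_mult using h cw
      by (auto simp: subst_tile_def Let_def rauzy_inv_cancel)
    then show ?thesis unfolding parent_shifts_def by blast
  next
    case 4
    then have "(rauzy_inv w - axis 3 1, 1) \<in> discrete_plane"
      "(w, k) \<in> subst_tile (rauzy_inv w - axis 3 1, 1)"
      unfolding in_plane height_axis weight_mult using h cw shift[of "axis 3 1"]
      by (auto simp: subst_tile_def Let_def matrix_axis)
    then show ?thesis unfolding parent_shifts_def by blast
  next
    case 5
    then have "(rauzy_inv w - 0, 1) \<in> discrete_plane" "(w, k) \<in> subst_tile (rauzy_inv w - 0, 1)"
      unfolding in_plane height_0 mult_zero_right weight_mult using h cw
      by (auto simp: subst_tile_def Let_def rauzy_inv_cancel)
    then show ?thesis unfolding parent_shifts_def by blast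
  qed
qed

section \<open>Computation with differences of base points\<close>

type_synonym triple = "int \<times> int \<times> int"

definition vec_of :: "triple \<Rightarrow> int^3" where
  "vec_of = (\<lambda>(i, j, l). vector [i, j, l])"

definition triple_of :: "int^3 \<Rightarrow> triple" where
  "triple_of z = (z$1, z$2, z$3)"

lemma vec_of_triple_of: "vec_of (triple_of z) = z"
  by (simp add: vec_of_def triple_of_def vec_eq_iff forall_3)

lemma triple_of_vec_of: "triple_of (vec_of d) = d"
  by (cases d) (simp add: vec_of_def triple_of_def)

text \<open>An integral lower bound for 10000 times the height: nonnegative coordinates take the
  lower bound of their weight, negative ones the upper bound. It makes comparisons of heights
  executable.\<close>

fun height_lower :: "triple \<Rightarrow> int" where
  "height_lower (i, j, l) = 10000 * i + (if 0 \<le> j then 8391 * j else 8394 * j)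
     + (if 0 \<le> l then 5436 * l else 5437 * l)"

lemma height_lower: "real_of_int (height_lower d) \<le> 10000 * height (vec_of d)"
proof (cases d)
  case (fields i j l)
  have *: "real_of_int (if 0 \<le> n then p * n else q * n) \<le> 10000 * (real_of_int n * r)"
    if "real_of_int p \<le> 10000 * r" "10000 * r \<le> real_of_int q" for n p q :: int and r :: real
  proof (cases "0 \<le> n")
    case True
    then show ?thesis using mult_left_mono[OF that(1), of "real_of_int n"] by (simp add: algebra_simps)
  next
    case False
    then show ?thesis using mult_left_mono_neg[OF that(2), of "real_of_int n"] by (simp add: algebra_simps)
  qed
  show ?thesis
    using *[of 8391 "weight 2" 8394 j] *[of 5436 "weight 3" 5437 l] weight_bounds
    by (simp add: fields vec_of_def height_3 algebra_simps)
qed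

fun tminus :: "triple \<Rightarrow> triple \<Rightarrow> triple" where
  "tminus (a, b, c) (d, e, f) = (a - d, b - e, c - f)"

lemma vec_of_minus: "vec_of (tminus c d) = vec_of c - vec_of d"
  by (cases c; cases d) (simp add: vec_of_def vec_eq_iff forall_3)

fun tinv :: "triple \<Rightarrow> triple" where
  "tinv (i, j, l) = (i + j + l, i, j)"

lemma vec_of_inv: "vec_of (tinv d) = rauzy_inv (vec_of d)"
  by (cases d) (simp add: vec_of_def rauzy_inv_def)

text \<open>The smallest set of vectors that contains those \<open>\<plusminus>e\<^sub>a\<close> and \<open>e\<^sub>a - e\<^sub>b\<close> whose height lies strictly
  between \<open>-1\<close> and \<open>1\<close>, and, with the difference of the base points of two tiles of the discrete
  plane, also the differences that their parents can have.\<close>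

definition contacts :: "triple list" where
  "contacts = [(-2,0,2), (-2,1,1), (-2,2,-1), (-2,2,0), (-1,-1,2), (-1,-1,3), (-1,0,1), (-1,0,2), (-1,0,3),
    (-1,1,-1), (-1,1,0), (-1,1,1), (-1,1,2), (-1,2,-3), (-1,2,-2), (-1,2,-1), (-1,2,0), (0,-3,3),
    (0,-2,2), (0,-2,3), (0,-1,0), (0,-1,1), (0,-1,2), (0,-1,3), (0,0,-1), (0,0,0), (0,0,1),
    (0,1,-3), (0,1,-2), (0,1,-1), (0,1,0), (0,2,-3), (0,2,-2), (0,3,-3), (1,-2,0), (1,-2,1),
    (1,-2,2), (1,-2,3), (1,-1,-2), (1,-1,-1), (1,-1,0), (1,-1,1), (1,0,-3), (1,0,-2), (1,0,-1),
    (1,1,-3), (1,1,-2), (2,-2,0), (2,-2,1), (2,-1,-1), (2,0,-2)]"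

definition shift_list :: "triple list" where
  "shift_list = [(0,0,0), (0,1,0), (0,0,1)]"

text \<open>The last two alternatives certify a height of at least 1 or at most -1, which the
  difference of two parents in the discrete plane cannot have.\<close>

lemma contacts_closed:
  "list_all (\<lambda>d. list_all (\<lambda>e. list_all (\<lambda>f. let c = tminus (tminus (tinv d) e) (tminus (0,0,0) f) in
     c \<in> set contacts \<or> 0 \<le> height_lower (tminus c (1,0,0)) \<or>
     0 \<le> height_lower (tminus (-1,0,0) c)) shift_list) shift_list) contacts"
  by code_simp

fun child_list :: "triple \<times> nat \<Rightarrow> (triple \<times> nat) list" where
  "child_list ((i, j, l), k) =
    (if k = 1 then [((j, l, i - j - l), 3), ((j + 1, l, i - j - l - 1), 1), ((j, l + 1, i - j - l - 1), 2)]
     else if k = 2 then [((j, l, i - j - l), 1)] else [((j, l, i - j - l), 2)])"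

fun patch_list :: "nat \<Rightarrow> (triple \<times> nat) list" where
  "patch_list 0 = [((0,0,0),1), ((0,0,0),2), ((0,0,0),3)]"
| "patch_list (Suc n) = concat (map child_list (patch_list n))"

text \<open>The height tests discard what lies outside the discrete plane; for all other tiles seven
  generations suffice. The condition \<open>0 \<le> height z\<close> is weak and
  \<open>height z < weight k\<close> is strict, hence one strict and one weak test.\<close>

lemma contacts_in_patch:
  "list_all (\<lambda>d. list_all (\<lambda>(e,k). (d, k) \<in> set (patch_list 7) \<or> 0 < height_lower (tminus (0,0,0) d) \<or>
     0 \<le> height_lower (tminus d e)) [((1,0,0),1), ((0,1,0),2), ((0,0,1),3)]) contacts"
  by code_simp

lemma patch_list_patch:
  "(d, k) \<in> set (patch_list n) \<Longrightarrow> k \<in> {1, 2, 3} \<and> (vec_of d, of_nat k) \<in> patch n"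
proof (induction n arbitrary: d k)
  case 0
  then show ?case by (auto simp: vec_of_def vec_eq_iff forall_3)
next
  case (Suc n)
  then obtain i j l k' where t: "((i, j, l), k') \<in> set (patch_list n)"
    and c: "(d, k) \<in> set (child_list ((i, j, l), k'))"
    by (force simp del: child_list.simps)
  from Suc.IH[OF t] have k': "k' \<in> {1, 2, 3}" and p: "(vec_of (i, j, l), of_nat k') \<in> patch n" by auto
  have "(vec_of d, of_nat k) \<in> subst_tile (vec_of (i, j, l), of_nat k')" "k \<in> {1, 2, 3}"
    using k' c
    by (auto simp: subst_tile_def matrix_mult vec_of_def column_2 column_3 vec_eq_iff forall_3 Let_def)
  with p show ?case by auto
qed

lemma contacts_base:
  assumes z: "triple_of z \<in> set contacts" and p: "(z, k) \<in> discrete_plane"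
  shows "(z, k) \<in> patch 7"
proof -
  have h: "0 \<le> height z" "height z < weight k" using p by (auto simp: discrete_plane_def)
  obtain j :: nat and e where j: "(e, j) \<in> {((1,0,0),1), ((0,1,0),2), ((0,0,1),3)}"
    and k: "k = of_nat j" and e: "vec_of e = axis k 1"
    using exhaust_3[of k]
    by (elim disjE) (auto simp: vec_of_def vec_eq_iff forall_3 axis_def)
  have 0: "vec_of (0, 0, 0) = 0" by (simp add: vec_of_def vec_eq_iff forall_3)
  have "\<not> 0 < height_lower (tminus (0,0,0) (triple_of z))"
    using height_lower[of "tminus (0,0,0) (triple_of z)"] h
    by (simp add: vec_of_minus vec_of_triple_of 0 height_minus del: height_lower.simps tminus.simps)
  moreover have "\<not> 0 \<le> height_lower (tminus (triple_of z) e)"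
    using height_lower[of "tminus (triple_of z) e"] h
    by (simp add: vec_of_minus vec_of_triple_of e height_diff height_axis del: height_lower.simps tminus.simps)
  moreover have "(triple_of z, j) \<in> set (patch_list 7) \<or> 0 < height_lower (tminus (0,0,0) (triple_of z))
      \<or> 0 \<le> height_lower (tminus (triple_of z) e)"
    using contacts_in_patch z j
    by (auto simp: list_all_iff simp del: height_lower.simps tminus.simps patch_list.simps)
  ultimately have "(triple_of z, j) \<in> set (patch_list 7)" by blast
  from patch_list_patch[OF this] show ?thesis by (simp add: vec_of_triple_of k)
qed

lemma shift_list: "e \<in> parent_shifts \<Longrightarrow> \<exists>f\<in>set shift_list. vec_of f = e"
  by (auto simp: parent_shifts_def shift_list_def vec_of_def vec_eq_iff forall_3 axis_def)

text \<open>Both parents have heights in [0, 1), so the height of their difference lies strictly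
  between -1 and 1, and only the first alternative of \<open>contacts_closed\<close>
  remains.\<close>

lemma contacts_parent:
  assumes d: "triple_of (z' - z) \<in> set contacts"
    and e: "e \<in> parent_shifts" "e' \<in> parent_shifts"
    and p: "(rauzy_inv z - e, k) \<in> discrete_plane" "(rauzy_inv z' - e', k') \<in> discrete_plane"
  shows "triple_of ((rauzy_inv z' - e') - (rauzy_inv z - e)) \<in> set contacts"
proof -
  obtain f f' where f: "f \<in> set shift_list" "f' \<in> set shift_list" and v: "vec_of f = e" "vec_of f' = e'"
    using e shift_list by blast
  define c where "c = tminus (tminus (tinv (triple_of (z' - z))) f') (tminus (0,0,0) f)"
  have 0: "vec_of (0, 0, 0) = 0" by (simp add: vec_of_def vec_eq_iff forall_3)
  have 1: "vec_of (1, 0, 0) = axis 1 1" "vec_of (-1, 0, 0) = - axis 1 1"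
    by (simp_all add: vec_of_def vec_eq_iff forall_3 axis_def)
  have c: "vec_of c = (rauzy_inv z' - e') - (rauzy_inv z - e)"
    by (simp add: c_def vec_of_minus vec_of_inv vec_of_triple_of v rauzy_inv_diff 0
        del: tminus.simps tinv.simps)
  have h: "height (vec_of c) < 1" "- 1 < height (vec_of c)"
    using p weight_le_1[of k] weight_le_1[of k'] unfolding c
    by (auto simp: discrete_plane_def height_diff)
  have "\<not> 0 \<le> height_lower (tminus c (1,0,0))"
    using height_lower[of "tminus c (1,0,0)"] h weight_simps(1)
    by (simp add: vec_of_minus 1 height_diff height_axis del: height_lower.simps tminus.simps)
  moreover have "\<not> 0 \<le> height_lower (tminus (-1,0,0) c)"
    using height_lower[of "tminus (-1,0,0) c"] h weight_simps(1)
    by (simp add: vec_of_minus 1 height_diff height_minus height_axis del: height_lower.simps tminus.simps)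
  moreover have "c \<in> set contacts \<or> 0 \<le> height_lower (tminus c (1,0,0)) \<or>
     0 \<le> height_lower (tminus (-1,0,0) c)"
    using contacts_closed d f unfolding list_all_iff Let_def c_def by blast
  ultimately have "c \<in> set contacts" by blast
  then show ?thesis by (simp flip: c add: triple_of_vec_of)
qed

lemma subst_tile_parent:
  assumes "(w, k) \<in> subst_tile (z, l)"
  shows "\<exists>e\<in>parent_shifts. z = rauzy_inv w - e"
proof -
  have inv: "rauzy_inv (rauzy_matrix *v z) = z"
    by (simp add: matrix_mult rauzy_inv_def vec_eq_iff forall_3)
  have col: "rauzy_inv (column 2 rauzy_matrix) = axis 2 1" "rauzy_inv (column 3 rauzy_matrix) = axis 3 1"
    by (simp_all add: column_2 column_3 rauzy_inv_def vec_eq_iff forall_3 axis_def)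
  from assms have "w \<in> {rauzy_matrix *v z, rauzy_matrix *v z + column 2 rauzy_matrix,
      rauzy_matrix *v z + column 3 rauzy_matrix}"
    by (auto simp: subst_tile_def Let_def split: if_splits)
  then show ?thesis by (auto simp: parent_shifts_def rauzy_inv_add inv col)
qed

text \<open>Passing to parents preserves contact. After n generations the known tile has an ancestor
  at the origin, where \<open>contacts_base\<close> applies to the ancestor of the other tile; the
  delay of seven generations does not grow with n.\<close>

lemma contacts_patch:
  assumes "(z, k) \<in> patch n" "triple_of (z' - z) \<in> set contacts" "(z', k') \<in> discrete_plane"
  shows "(z', k') \<in> patch (n + 7)"
  using assms
proof (induction n arbitrary: z k z' k')
  case 0
  then have "z = 0" by auto
  with 0 show ?case using contacts_base by simp
next
  case (Suc n)
  then obtain z1 k1 where p: "(z1, k1) \<in> patch n" and s: "(z, k) \<in> subst_tile (z1, k1)" by auto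
  obtain e where e: "e \<in> parent_shifts" "z1 = rauzy_inv z - e" using subst_tile_parent[OF s] by blast
  obtain e' k1' where e': "e' \<in> parent_shifts" "(rauzy_inv z' - e', k1') \<in> discrete_plane"
    "(z', k') \<in> subst_tile (rauzy_inv z' - e', k1')" using parent_exists[OF Suc.prems(3)] by blast
  have "triple_of ((rauzy_inv z' - e') - (rauzy_inv z - e)) \<in> set contacts"
    using contacts_parent[OF Suc.prems(2) e(1) e'(1) _ e'(2)] p patch_subset e(2) by blast
  then have "(rauzy_inv z' - e', k1') \<in> patch (n + 7)" using Suc.IH[OF p] e' e(2) by simp
  with e'(3) have "(z', k') \<in> patch (Suc (n + 7))"
    unfolding patch.simps by blast
  then show ?case by simp
qed

section \<open>Descent to the origin inside the discrete plane\<close>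

lemma axis_nth_if: "axis a x $ b = (if b = a then x else 0)"
  by (simp add: axis_def)

lemma steps_in_contacts:
  "a \<noteq> 1 \<Longrightarrow> triple_of (axis a 1) \<in> set contacts"
  "a \<noteq> 1 \<Longrightarrow> triple_of (- axis a 1) \<in> set contacts"
  "triple_of (axis a 1 - axis b 1) \<in> set contacts" "triple_of 0 \<in> set contacts"
  using exhaust_3[of a] exhaust_3[of b] by (auto simp: triple_of_def axis_nth_if contacts_def)

text \<open>A nonzero vector without positive coordinates has negative height, so some coordinate is
  positive. Lowering it, raising a negative one, or doing both is possible within the heights [0,
  1), and each is a contact.\<close>

lemma discrete_plane_descent:
  assumes z: "0 \<le> height z" "height z < 1" "z \<noteq> 0"
  shows "\<exists>z'. 0 \<le> height z' \<and> height z' < 1 \<and> triple_of (z - z') \<in> set contacts \<and>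
    (\<Sum>a\<in>UNIV. \<bar>z' $ a\<bar>) < (\<Sum>a\<in>UNIV. \<bar>z $ a\<bar>)"
proof -
  have pos: "\<exists>a. 0 < z $ a"
  proof (rule ccontr)
    assume "\<nexists>a. 0 < z $ a"
    then have n: "z $ a \<le> 0" for a by (simp add: not_less)
    have "height z = 0"
      using z(1) n weight_pos unfolding height_def
      by (intro antisym sum_nonpos mult_nonpos_nonneg) (auto simp: less_imp_le)
    moreover have "height z = - (\<Sum>a\<in>UNIV. of_int (- z $ a) * weight a)"
      by (simp add: height_def sum_negf)
    ultimately have "(\<Sum>a\<in>UNIV. of_int (- z $ a) * weight a) = 0" by simp
    then have "\<forall>a\<in>UNIV. of_int (- z $ a) * weight a = 0"
      using n weight_pos by (subst (asm) sum_nonneg_eq_0_iff) (auto simp: less_imp_le mult_nonpos_nonneg)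
    then have "z = 0" using weight_pos by (auto simp: vec_eq_iff less_le)
    with z(3) show False ..
  qed
  then obtain a where a: "0 < z $ a" ..
  have norm: "(\<Sum>c\<in>UNIV. \<bar>w $ c\<bar>) < (\<Sum>c\<in>UNIV. \<bar>z $ c\<bar>)"
    if "\<And>c. \<bar>w $ c\<bar> \<le> \<bar>z $ c\<bar>" "\<bar>w $ d\<bar> < \<bar>z $ d\<bar>" for w :: "int^3" and d
    using that by (intro sum_strict_mono_ex1) auto
  show ?thesis
  proof (cases "weight a \<le> height z")
    case True
    then have "a \<noteq> 1" using z weight_simps(1) by auto
    with True show ?thesis using z a weight_pos[of a] steps_in_contacts(1)[of a]
      by (intro exI[of _ "z - axis a 1"] conjI norm[of _ a])
        (auto simp: height_diff height_axis axis_nth_if)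
  next
    case False
    then have "\<exists>b. z $ b < 0"
    proof (rule contrapos_np)
      assume "\<nexists>b. z $ b < 0"
      then have n: "0 \<le> z $ b" for b by (simp add: not_less)
      have "weight a \<le> of_int (z $ a) * weight a" using a weight_pos[of a] by simp
      also have "\<dots> \<le> height z" unfolding height_def
        using n weight_pos by (intro member_le_sum) (auto simp: less_imp_le)
      finally show "weight a \<le> height z" .
    qed
    then obtain b where b: "z $ b < 0" ..
    then have ab: "a \<noteq> b" using a by auto
    show ?thesis
    proof (cases "height z + weight b < 1")
      case True
      then have "b \<noteq> 1" using z weight_simps(1) by auto
      with True show ?thesis using z b weight_pos[of b] steps_in_contacts(2)[of b]
        by (intro exI[of _ "z + axis b 1"] conjI norm[of _ b])
          (auto simp: height_add height_axis axis_nth_if)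
    next
      case f: False
      \<comment> \<open>Here height z + weight b is at least 1, hence at least weight a, and height
        z is below weight a; so the height after both moves is at least 0 and below weight
        b.\<close>
      have "weight b \<le> 1" "weight a \<le> 1" by (rule weight_le_1)+
      then show ?thesis using z a b ab f False steps_in_contacts(3)[of a b]
        by (intro exI[of _ "z - axis a 1 + axis b 1"] conjI norm[of _ a])
          (auto simp: height_diff height_add height_axis axis_nth_if algebra_simps)
    qed
  qed
qed

text \<open>Type 1 has the largest weight, so it is available at every base point of the discrete
  plane. The chain of contacts from the origin runs through tiles of type 1; the contact 0 then
  gives the other types at the same base point.\<close>

lemma rauzy_tiling_eq: "rauzy_tiling = discrete_plane"
proof
  show "rauzy_tiling \<subseteq> discrete_plane" using patch_subset by (auto simp: rauzy_tiling_def)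
next
  have *: "(z, 1) \<in> rauzy_tiling" if "0 \<le> height z" "height z < 1" for z
    using that
  proof (induction "nat (\<Sum>a\<in>UNIV. \<bar>z $ a\<bar>)" arbitrary: z rule: less_induct)
    case less
    show ?case
    proof (cases "z = 0")
      case True
      have "(0, 1) \<in> patch 0" by simp
      then show ?thesis unfolding True rauzy_tiling_def by blast
    next
      case False
      then obtain z' where z': "0 \<le> height z'" "height z' < 1" "triple_of (z - z') \<in> set contacts"
        and lt: "(\<Sum>a\<in>UNIV. \<bar>z' $ a\<bar>) < (\<Sum>a\<in>UNIV. \<bar>z $ a\<bar>)"
        using discrete_plane_descent less.prems by blast
      moreover have "0 \<le> (\<Sum>a\<in>UNIV. \<bar>z' $ a\<bar>)" by (simp add: sum_nonneg)
      then have "nat (\<Sum>a\<in>UNIV. \<bar>z' $ a\<bar>) < nat (\<Sum>a\<in>UNIV. \<bar>z $ a\<bar>)" using lt by linarith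
      ultimately have "(z', 1) \<in> rauzy_tiling" using less.hyps[of z'] by simp
      then obtain n where "(z', 1) \<in> patch n" by (auto simp: rauzy_tiling_def)
      moreover have "(z, 1) \<in> discrete_plane"
        using less.prems by (simp add: discrete_plane_def weight_simps)
      ultimately have "(z, 1) \<in> patch (n + 7)" using contacts_patch z'(3) by blast
      then show ?thesis unfolding rauzy_tiling_def by blast
    qed
  qed
  show "discrete_plane \<subseteq> rauzy_tiling"
  proof (rule subrelI)
    fix z k assume p: "(z, k) \<in> discrete_plane"
    then have "(z, 1) \<in> rauzy_tiling"
      using * weight_le_1[of k] by (force simp: discrete_plane_def)
    then obtain n where "(z, 1) \<in> patch n" by (auto simp: rauzy_tiling_def)
    then have "(z, k) \<in> patch (n + 7)" using contacts_patch[of z 1 n z k] p steps_in_contacts(4) by simp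
    then show "(z, k) \<in> rauzy_tiling" unfolding rauzy_tiling_def by blast
  qed
qed

section \<open>The plane geometry of the tiling\<close>

definition step :: "3 \<Rightarrow> bool \<Rightarrow> real^2" where
  "step a \<sigma> = (if \<sigma> then plane_basis a else - plane_basis a)"

definition origin_offset :: "3 \<Rightarrow> bool \<Rightarrow> real^2" where
  "origin_offset a \<sigma> = (if \<sigma> then 0 else plane_basis a)"

text \<open>Some tile of type \<open>k\<close> has a corner at \<open>x\<close> and the sides \<open>step a \<sigma>\<close> and \<open>step b \<tau>\<close> there; the
  offsets lead from the base point of the tile to this corner.\<close>

definition tile_corner :: "3 \<Rightarrow> real^2 \<Rightarrow> 3 \<Rightarrow> bool \<Rightarrow> 3 \<Rightarrow> bool \<Rightarrow> bool" where
  "tile_corner k x a \<sigma> b \<tau> \<longleftrightarrow> {a, b, k} = UNIV \<and>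
     (\<exists>z. x = lattice_proj z + origin_offset a \<sigma> + origin_offset b \<tau> \<and> (z, k) \<in> rauzy_tiling)"

section \<open>Lattice points over a point of the plane\<close>

lemma lattice_proj_add: "lattice_proj (z + w) = lattice_proj z + lattice_proj w"
  and lattice_proj_diff: "lattice_proj (z - w) = lattice_proj z - lattice_proj w"
  by (simp_all add: lattice_proj_def plane_proj_def sum_3 algebra_simps)

lemma lattice_proj_axis: "lattice_proj (axis a 1) = plane_basis a"
  using exhaust_3[of a] by (auto simp: lattice_proj_def plane_proj_def sum_3 axis_nth_if)

lemma lattice_proj_component:
  "lattice_proj z $ 1 = sqrt 3 / 2 * (z $ 2 - z $ 1)"
  "lattice_proj z $ 2 = z $ 3 - (z $ 1 + z $ 2) / 2"
  by (auto simp: lattice_proj_def plane_proj_def sum_3 plane_basis_def field_simps)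

text \<open>The kernel is generated by (1, 1, 1): once the factor sqrt 3 is cancelled, the two
  coordinates give integral equations for the differences.\<close>

lemma lattice_proj_eq_iff: "lattice_proj z = lattice_proj w \<longleftrightarrow> (\<exists>n. w = z + (\<chi> i. n))"
proof
  assume eq: "lattice_proj z = lattice_proj w"
  have 1: "real_of_int (z$2 - z$1) = real_of_int (w$2 - w$1)"
    using arg_cong[OF eq, of "\<lambda>v. v $ 1"] by (simp add: lattice_proj_component)
  have 2: "real_of_int (2 * z$3 - z$1 - z$2) = real_of_int (2 * w$3 - w$1 - w$2)"
    using arg_cong[OF eq, of "\<lambda>v. v $ 2"] by (simp add: lattice_proj_component field_simps)
  have "w = z + (\<chi> i. w$1 - z$1)"
    using 1 2 unfolding of_int_eq_iff by (simp add: vec_eq_iff forall_3)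
  then show "\<exists>n. w = z + (\<chi> i. n)" ..
next
  assume "\<exists>n. w = z + (\<chi> i. n)"
  then show "lattice_proj z = lattice_proj w"
    by (auto simp: vec_eq_iff forall_2 lattice_proj_component field_simps)
qed

text \<open>The linear form \<open>v \<mapsto> 3 \<surd>3 v\<^sub>1 - 11 v\<^sub>2\<close> takes integral values at the six unit vectors, from
  which the summands of a nonzero sum of two of them can be read off.\<close>

definition step_code :: "3 \<Rightarrow> bool \<Rightarrow> int" where
  "step_code a \<sigma> = (if \<sigma> then 1 else -1) * (if a = 1 then 1 else if a = 2 then 10 else -11)"

lemma step_code: "3 * sqrt 3 * step a \<sigma> $ 1 - 11 * step a \<sigma> $ 2 = of_int (step_code a \<sigma>)"
  using exhaust_3[of a] by (auto simp: step_def plane_basis_def step_code_def mult.assoc)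

lemma step_code_eq_iff: "step_code a \<sigma> = step_code b \<tau> \<longleftrightarrow> a = b \<and> \<sigma> = \<tau>"
  using exhaust_3[of a] exhaust_3[of b] by (auto simp: step_code_def)

lemma step_code_not: "step_code a (\<not> \<sigma>) = - step_code a \<sigma>"
  by (simp add: step_code_def)

lemma step_minus: "step a (\<not> \<sigma>) = - step a \<sigma>"
  by (simp add: step_def)

text \<open>By linearity of the form this is a finite check on the codes. The third alternative is
  the sum zero, which does not determine its summands.\<close>

lemma step_sum_eq:
  assumes "step a \<sigma> + step b \<tau> = step c \<rho> + step d \<pi>"
  shows "c = a \<and> \<rho> = \<sigma> \<and> d = b \<and> \<pi> = \<tau> \<or> c = b \<and> \<rho> = \<tau> \<and> d = a \<and> \<pi> = \<sigma>
    \<or> b = a \<and> \<tau> = (\<not> \<sigma>) \<and> d = c \<and> \<pi> = (\<not> \<rho>)"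
proof -
  let ?f = "\<lambda>v :: real^2. 3 * sqrt 3 * v $ 1 - 11 * v $ 2"
  let ?S = "{1, -1, 10, -10, 11, -11} :: int set"
  have add: "?f (v + w) = ?f v + ?f w" for v w by (simp add: algebra_simps)
  have "real_of_int (step_code a \<sigma> + step_code b \<tau>) = real_of_int (step_code c \<rho> + step_code d \<pi>)"
    using arg_cong[OF assms, of ?f] unfolding add step_code by simp
  then have eq: "step_code a \<sigma> + step_code b \<tau> = step_code c \<rho> + step_code d \<pi>"
    unfolding of_int_eq_iff .
  have S: "step_code e \<pi> \<in> ?S" for e \<pi> by (simp add: step_code_def)
  have "\<forall>p\<in>?S. \<forall>q\<in>?S. \<forall>r\<in>?S. \<forall>t\<in>?S. p + q = r + t \<longrightarrow>
      r = p \<and> t = q \<or> r = q \<and> t = p \<or> q = - p \<and> t = - r"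
    by code_simp
  then have "step_code c \<rho> = step_code a \<sigma> \<and> step_code d \<pi> = step_code b \<tau> \<or>
      step_code c \<rho> = step_code b \<tau> \<and> step_code d \<pi> = step_code a \<sigma> \<or>
      step_code b \<tau> = - step_code a \<sigma> \<and> step_code d \<pi> = - step_code c \<rho>"
    using S eq by blast
  then show ?thesis unfolding step_code_not[symmetric] step_code_eq_iff by blast
qed

lemma step_eq_iff: "step a \<sigma> = step b \<tau> \<longleftrightarrow> a = b \<and> \<sigma> = \<tau>"
  using step_sum_eq[of a \<sigma> a \<sigma> b \<tau> b \<tau>] by auto

lemma step_nonzero: "step a \<sigma> \<noteq> 0"
proof
  assume "step a \<sigma> = 0"
  then have "step a \<sigma> = step a (\<not> \<sigma>)" by (simp add: step_minus)
  then show False by (simp add: step_eq_iff)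
qed

lemma step_sum_zero_iff: "step a \<sigma> + step b \<tau> = 0 \<longleftrightarrow> b = a \<and> \<tau> = (\<not> \<sigma>)"
proof -
  have "step a \<sigma> + step b \<tau> = 0 \<longleftrightarrow> step b \<tau> = step a (\<not> \<sigma>)"
    by (simp add: step_minus eq_neg_iff_add_eq_0 add.commute)
  then show ?thesis by (simp add: step_eq_iff)
qed

lemma UNIV_3_iff: "{a, b, c} = (UNIV :: 3 set) \<longleftrightarrow> a \<noteq> b \<and> a \<noteq> c \<and> b \<noteq> c"
proof
  assume "{a, b, c} = UNIV"
  then have "card {a, b, c} = 3" by simp
  then show "a \<noteq> b \<and> a \<noteq> c \<and> b \<noteq> c" by (auto simp: card_insert_if split: if_splits)
next
  assume "a \<noteq> b \<and> a \<noteq> c \<and> b \<noteq> c"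
  then have "card {a, b, c} = card (UNIV :: 3 set)" by simp
  then show "{a, b, c} = UNIV" by (intro card_subset_eq) auto
qed

lemma third_unique: "{a, b, c} = (UNIV :: 3 set) \<Longrightarrow> {a, b, d} = (UNIV :: 3 set) \<Longrightarrow> c = d"
  using exhaust_3[of a] exhaust_3[of b] exhaust_3[of c] exhaust_3[of d]
  unfolding UNIV_3_iff by auto

lemma third_exists: "a \<noteq> b \<Longrightarrow> \<exists>c. {a, b, c} = (UNIV :: 3 set)"
  using exhaust_3[of a] exhaust_3[of b] unfolding UNIV_3_iff
  by (elim disjE) (auto intro: exI[of _ 1] exI[of _ 2] exI[of _ 3])

section \<open>Tiles seen from their corners\<close>

lemma origin_offset_step: "origin_offset a (\<not> \<sigma>) = origin_offset a \<sigma> + step a \<sigma>"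
  by (simp add: origin_offset_def step_def)

lemma origin_offset_inj:
  assumes "a \<noteq> b" "origin_offset a \<sigma> + origin_offset b \<tau> = origin_offset a \<sigma>' + origin_offset b \<tau>'"
  shows "\<sigma> = \<sigma>' \<and> \<tau> = \<tau>'"
proof -
  \<comment> \<open>Twice an offset is a constant minus a step, which reduces the claim to sums of
    two steps.\<close>
  have o: "2 *\<^sub>R origin_offset c \<rho> = plane_basis c - step c \<rho>" for c \<rho>
    by (simp add: origin_offset_def step_def scaleR_2)
  have "2 *\<^sub>R (origin_offset a \<sigma> + origin_offset b \<tau>) = 2 *\<^sub>R (origin_offset a \<sigma>' + origin_offset b \<tau>')"
    using assms(2) by simp
  then have "step a \<sigma> + step b \<tau> = step a \<sigma>' + step b \<tau>'"
    unfolding scaleR_add_right o by (simp add: algebra_simps)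
  then show ?thesis using step_sum_eq[of a \<sigma> b \<tau> a \<sigma>' b \<tau>'] assms(1) by auto
qed

lemma tile_corner_swap: "tile_corner k x a \<sigma> b \<tau> \<longleftrightarrow> tile_corner k x b \<tau> a \<sigma>"
  unfolding tile_corner_def by (simp add: insert_commute add.commute add.left_commute)

text \<open>The same tile seen from the other end of its side: the direction along the side is
  reversed, the other one is kept.\<close>

lemma tile_corner_move: "tile_corner k (x + step a \<sigma>) a (\<not> \<sigma>) b \<tau> \<longleftrightarrow> tile_corner k x a \<sigma> b \<tau>"
proof -
  have "x + step a \<sigma> = z + origin_offset a (\<not> \<sigma>) + w \<longleftrightarrow> x = z + origin_offset a \<sigma> + w" for z w
    by (simp add: origin_offset_step algebra_simps)
  then show ?thesis unfolding tile_corner_def by simp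
qed

lemma tile_corner_distinct: "tile_corner k x a \<sigma> b \<tau> \<Longrightarrow> a \<noteq> b \<and> a \<noteq> k \<and> b \<noteq> k"
  unfolding tile_corner_def UNIV_3_iff by blast

lemma tile_corner_type:
  "tile_corner k x a \<sigma> b \<tau> \<Longrightarrow> tile_corner l x' a \<sigma>' b \<tau>' \<Longrightarrow> l = k"
  unfolding tile_corner_def using third_unique by blast

lemma sides_iff:
  "{x, u} \<in> sides (z, k) \<longleftrightarrow> (\<exists>a \<sigma> b \<tau>. {a, b, k} = UNIV \<and>
     x = lattice_proj z + origin_offset a \<sigma> + origin_offset b \<tau> \<and> u = x + step a \<sigma>)"
  (is "?L \<longleftrightarrow> ?R")
proof
  assume ?L
  then obtain a b where k: "{a, b, k} = UNIV" and
    c: "{x, u} = {lattice_proj z, lattice_proj z + plane_basis a} \<or>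
      {x, u} = {lattice_proj z + plane_basis b, lattice_proj z + plane_basis a + plane_basis b}"
    by (auto simp: sides_def lattice_proj_add lattice_proj_axis)
  obtain \<sigma> \<tau> where "x = lattice_proj z + origin_offset a \<sigma> + origin_offset b \<tau> \<and> u = x + step a \<sigma>"
  proof -
    from c consider "x = lattice_proj z" "u = lattice_proj z + plane_basis a"
      | "u = lattice_proj z" "x = lattice_proj z + plane_basis a"
      | "x = lattice_proj z + plane_basis b" "u = lattice_proj z + plane_basis a + plane_basis b"
      | "u = lattice_proj z + plane_basis b" "x = lattice_proj z + plane_basis a + plane_basis b"
      unfolding doubleton_eq_iff by blast
    then show ?thesis
    proof cases
      case 1 then show ?thesis using that[of True True] by (simp add: origin_offset_def step_def)
    next
      case 2 then show ?thesis using that[of False True] by (simp add: origin_offset_def step_def)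
    next
      case 3 then show ?thesis using that[of True False] by (simp add: origin_offset_def step_def algebra_simps)
    next
      case 4 then show ?thesis using that[of False False] by (simp add: origin_offset_def step_def)
    qed
  qed
  with k show ?R by blast
next
  assume ?R
  then obtain a \<sigma> b \<tau> where k: "{a, b, k} = UNIV" and x: "u = x + step a \<sigma>"
    "x = lattice_proj z + origin_offset a \<sigma> + origin_offset b \<tau>" by blast
  have "{x, u} = {lattice_proj z, lattice_proj z + plane_basis a} \<or>
      {x, u} = {lattice_proj z + plane_basis b, lattice_proj z + plane_basis a + plane_basis b}"
    by (cases \<sigma>; cases \<tau>) (auto simp: x origin_offset_def step_def algebra_simps)
  with k show ?L
    unfolding sides_def by (auto simp: lattice_proj_add lattice_proj_axis)
qed

lemma edge_iff: "{x, u} \<in> edges \<longleftrightarrow> (\<exists>k a \<sigma> b \<tau>. u = x + step a \<sigma> \<and> tile_corner k x a \<sigma> b \<tau>)"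
proof
  assume "{x, u} \<in> edges"
  then obtain z k where "(z, k) \<in> rauzy_tiling" "{x, u} \<in> sides (z, k)"
    unfolding edges_def by (metis UN_E prod.exhaust)
  then show "\<exists>k a \<sigma> b \<tau>. u = x + step a \<sigma> \<and> tile_corner k x a \<sigma> b \<tau>"
    unfolding sides_iff tile_corner_def by metis
next
  assume "\<exists>k a \<sigma> b \<tau>. u = x + step a \<sigma> \<and> tile_corner k x a \<sigma> b \<tau>"
  then obtain k a \<sigma> b \<tau> z where *: "u = x + step a \<sigma>" "{a, b, k} = UNIV" "(z, k) \<in> rauzy_tiling"
    "x = lattice_proj z + origin_offset a \<sigma> + origin_offset b \<tau>"
    unfolding tile_corner_def by blast
  then have "{x, u} \<in> sides (z, k)" unfolding sides_iff by blast
  with *(3) show "{x, u} \<in> edges" unfolding edges_def by blast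
qed

lemma tile_corner_edge:
  assumes "tile_corner k x a \<sigma> b \<tau>"
  shows "{x, x + step a \<sigma>} \<in> edges" "{x, x + step b \<tau>} \<in> edges"
  using assms edge_iff tile_corner_swap by blast+

lemma tile_corner_sides:
  assumes "tile_corner k x a \<sigma> b \<tau>"
  shows "\<exists>t\<in>rauzy_tiling. {x, x + step a \<sigma>} \<in> sides t \<and> {x, x + step b \<tau>} \<in> sides t \<and>
    {x + step a \<sigma>, x + step a \<sigma> + step b \<tau>} \<in> sides t \<and>
    {x + step b \<tau>, x + step a \<sigma> + step b \<tau>} \<in> sides t"
proof -
  from assms obtain z where k: "{a, b, k} = UNIV" and z: "(z, k) \<in> rauzy_tiling"
    and x: "x = lattice_proj z + origin_offset a \<sigma> + origin_offset b \<tau>"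
    unfolding tile_corner_def by blast
  have *: "{lattice_proj z + origin_offset a \<rho> + origin_offset b \<pi>,
      lattice_proj z + origin_offset a \<rho> + origin_offset b \<pi> + step a \<rho>} \<in> sides (z, k)" for \<rho> \<pi>
    unfolding sides_iff using k by blast
  have **: "{lattice_proj z + origin_offset a \<rho> + origin_offset b \<pi>,
      lattice_proj z + origin_offset a \<rho> + origin_offset b \<pi> + step b \<pi>} \<in> sides (z, k)" for \<rho> \<pi>
  proof -
    have "{b, a, k} = UNIV" using k by (simp add: insert_commute)
    then show ?thesis unfolding sides_iff by (metis add.assoc add.commute)
  qed
  have "{x, x + step a \<sigma>} \<in> sides (z, k)" using *[of \<sigma> \<tau>] by (simp add: x)
  moreover have "{x, x + step b \<tau>} \<in> sides (z, k)" using **[of \<sigma> \<tau>] by (simp add: x)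
  moreover have "{x + step a \<sigma>, x + step a \<sigma> + step b \<tau>} \<in> sides (z, k)"
    using **[of "\<not> \<sigma>" \<tau>] by (simp add: x origin_offset_step algebra_simps)
  moreover have "{x + step b \<tau>, x + step a \<sigma> + step b \<tau>} \<in> sides (z, k)"
    using *[of \<sigma> "\<not> \<tau>"] by (simp add: x origin_offset_step algebra_simps)
  ultimately show ?thesis using z by blast
qed

text \<open>Both sides present u as a corner of t by two signs. The signs at a corner are unique, so
  two sides along the same axis would have equal ends.\<close>

lemma common_tile_corner:
  assumes "t \<in> rauzy_tiling" "{u, x} \<in> sides t" "{u, y} \<in> sides t" "x \<noteq> y"
  shows "\<exists>k a \<sigma> b \<tau>. tile_corner k u a \<sigma> b \<tau> \<and> x = u + step a \<sigma> \<and> y = u + step b \<tau>"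
proof -
  obtain z k where t: "t = (z, k)" by fastforce
  obtain a \<sigma> b \<tau> where a: "{a, b, k} = UNIV" "x = u + step a \<sigma>"
    "u = lattice_proj z + origin_offset a \<sigma> + origin_offset b \<tau>"
    using assms(2) unfolding t sides_iff by blast
  obtain a' \<sigma>' b' \<tau>' where a': "{a', b', k} = UNIV" "y = u + step a' \<sigma>'"
    "u = lattice_proj z + origin_offset a' \<sigma>' + origin_offset b' \<tau>'"
    using assms(3) unfolding t sides_iff by blast
  have ab: "a \<noteq> b" using a(1) UNIV_3_iff by blast
  have "a' = a \<and> b' = b \<or> a' = b \<and> b' = a"
  proof -
    have "a' \<in> {a, b, k}" "b' \<in> {a, b, k}" using a(1) by auto
    then show ?thesis using a'(1) unfolding UNIV_3_iff by auto
  qed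
  then show ?thesis
  proof
    assume e: "a' = a \<and> b' = b"
    then have "origin_offset a \<sigma> + origin_offset b \<tau> = origin_offset a \<sigma>' + origin_offset b \<tau>'"
      using a(3) a'(3) by (simp add: add.assoc)
    then have "\<sigma>' = \<sigma>" using origin_offset_inj ab by blast
    then show ?thesis using e a(2) a'(2) assms(4) by simp
  next
    assume e: "a' = b \<and> b' = a"
    then have "origin_offset a \<sigma> + origin_offset b \<tau> = origin_offset a \<tau>' + origin_offset b \<sigma>'"
      using a(3) a'(3) by (simp add: algebra_simps)
    then have "\<sigma>' = \<tau>" using origin_offset_inj ab by blast
    then show ?thesis using e a a'(2) assms(1) unfolding tile_corner_def t by blast
  qed
qed

section \<open>The two sides of an edge\<close>

lemma weight_sum: "{a, b, c} = UNIV \<Longrightarrow> weight a + weight b + weight c = weight 1 + weight 2 + weight 3"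
  unfolding UNIV_3_iff using exhaust_3[of a] exhaust_3[of b] exhaust_3[of c] by auto

text \<open>Lattice points over one point differ by multiples of (1, 1, 1), whose height is the sum
  of the weights; so the tiles based there depend on the height modulo this sum.\<close>

lemma tile_at_iff:
  "(\<exists>w. lattice_proj z = lattice_proj w \<and> (w, k) \<in> rauzy_tiling) \<longleftrightarrow>
    (\<exists>n::int. 0 \<le> height z + n * (weight 1 + weight 2 + weight 3) \<and>
       height z + n * (weight 1 + weight 2 + weight 3) < weight k)"
proof -
  have "height (\<chi> i. n) = n * (weight 1 + weight 2 + weight 3)" for n
    by (simp add: height_def sum_3 algebra_simps)
  then show ?thesis
    by (auto simp: lattice_proj_eq_iff rauzy_tiling_eq discrete_plane_def height_add)
qed

lemma int_mult_bounds: "0 < (H::real) \<Longrightarrow> of_int n * H = 0 \<or> H \<le> of_int n * H \<or> of_int n * H \<le> - H"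
proof -
  assume H: "0 < H"
  consider "n = 0" | "1 \<le> n" | "n \<le> -1" by linarith
  then show ?thesis
  proof cases
    case 2
    then have "(1::real) \<le> of_int n" by linarith
    then have "1 * H \<le> of_int n * H" using H by (intro mult_right_mono) auto
    then show ?thesis by simp
  next
    case 3
    then have "of_int n \<le> (-1::real)" by linarith
    then have "of_int n * H \<le> -1 * H" using H by (intro mult_right_mono) auto
    then show ?thesis by simp
  qed simp
qed

text \<open>A side along axis a starts at the base point of its tile or one unit along b above it.
  The intervals [0, weight k) and [weight b, weight b + weight k) both lie in [0, weight b + weight
  k).\<close>

lemma edge_origin_height:
  assumes "{x, x + plane_basis a} \<in> edges"
  shows "\<exists>z. x = lattice_proj z \<and> 0 \<le> height z \<and> height z < weight 1 + weight 2 + weight 3 - weight a"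
proof -
  have "x + plane_basis a = x + step a True" by (simp add: step_def)
  then obtain k b \<tau> where "tile_corner k x a True b \<tau>"
    using assms unfolding edge_iff by (auto simp: step_eq_iff)
  then obtain z where k: "{a, b, k} = UNIV" and x: "x = lattice_proj z + origin_offset b \<tau>"
    and z: "0 \<le> height z" "height z < weight k"
    unfolding tile_corner_def rauzy_tiling_eq discrete_plane_def by (auto simp: origin_offset_def)
  have w: "weight a + weight b + weight k = weight 1 + weight 2 + weight 3" using weight_sum[OF k] .
  show ?thesis
  proof (cases \<tau>)
    case True
    then show ?thesis using x z w weight_pos[of b] by (intro exI[of _ z]) (auto simp: origin_offset_def)
  next
    case False
    then show ?thesis using x z w weight_pos[of b]
      by (intro exI[of _ "z + axis b 1"])
        (auto simp: origin_offset_def lattice_proj_add lattice_proj_axis height_add height_axis)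
  qed
qed

text \<open>The height of the origin decides: below weight c, it is the base point of a tile of type
  c; from weight c on, going back one unit along c leads to the base point of a tile of type b. Both
  tiles would lie on the same side of the edge, because the projections of the three unit vectors
  add up to zero.\<close>

lemma tile_corner_xor_aux:
  assumes e: "{x, x + plane_basis a} \<in> edges" and k: "{a, b, c} = UNIV"
  shows "tile_corner c x a True b True \<longleftrightarrow> \<not> tile_corner b x a True c False"
proof -
  let ?H = "weight 1 + weight 2 + weight 3"
  have H: "0 < ?H" using weight_pos[of 1] weight_pos[of 2] weight_pos[of 3] by linarith
  have w: "weight a + weight b + weight c = ?H" "0 < weight a" "0 < weight b" "0 < weight c"
    using weight_sum[OF k] weight_pos by auto
  obtain z where x: "x = lattice_proj z" and h: "0 \<le> height z" "height z < ?H - weight a"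
    using edge_origin_height[OF e] by blast
  have "tile_corner c x a True b True \<longleftrightarrow> (\<exists>n::int. 0 \<le> height z + n * ?H \<and> height z + n * ?H < weight c)"
    using k by (simp add: tile_corner_def origin_offset_def x tile_at_iff)
  also have "\<dots> \<longleftrightarrow> height z < weight c"
  proof safe
    fix n :: int assume "0 \<le> height z + n * ?H" "height z + n * ?H < weight c"
    \<comment> \<open>Every other representative is at least \<open>?H\<close> higher or lower and
      leaves the interval, so n = 0.\<close>
    with int_mult_bounds[OF H, of n] h w show "height z < weight c" by linarith
  next
    assume "height z < weight c"
    then show "\<exists>n::int. 0 \<le> height z + n * ?H \<and> height z + n * ?H < weight c"
      using h by (intro exI[of _ 0]) simp
  qed
  finally have 1: "tile_corner c x a True b True \<longleftrightarrow> height z < weight c" .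
  have k': "{a, c, b} = UNIV" using k by (simp add: insert_commute)
  have "x = lattice_proj w + plane_basis c \<longleftrightarrow> lattice_proj (z - axis c 1) = lattice_proj w" for w
    by (auto simp: x lattice_proj_diff lattice_proj_axis algebra_simps)
  then have "tile_corner b x a True c False \<longleftrightarrow>
      (\<exists>n::int. 0 \<le> height (z - axis c 1) + n * ?H \<and> height (z - axis c 1) + n * ?H < weight b)"
    using k' by (simp add: tile_corner_def origin_offset_def tile_at_iff)
  also have "\<dots> \<longleftrightarrow> weight c \<le> height z"
    unfolding height_diff height_axis
  proof safe
    fix n :: int
    assume "0 \<le> height z - weight c + n * ?H" "height z - weight c + n * ?H < weight b"
    with int_mult_bounds[OF H, of n] h w show "weight c \<le> height z" by linarith
  next
    assume "weight c \<le> height z"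
    then show "\<exists>n::int. 0 \<le> height z - weight c + n * ?H \<and> height z - weight c + n * ?H < weight b"
      using h w by (intro exI[of _ 0]) simp
  qed
  finally show ?thesis using 1 by auto
qed

text \<open>On each side of an edge there are two candidates for a tile, one with an angle of 120 degrees
  at \<open>x\<close> and one with an angle of 60 degrees.\<close>

lemma tile_corner_xor:
  assumes e: "{x, x + step a \<sigma>} \<in> edges" and k: "{a, b, c} = UNIV"
  shows "tile_corner c x a \<sigma> b \<tau> \<longleftrightarrow> \<not> tile_corner b x a \<sigma> c (\<not> \<tau>)"
proof -
  have k': "{a, c, b} = UNIV" using k by (simp add: insert_commute)
  have pos: "tile_corner c y a True b \<tau> \<longleftrightarrow> \<not> tile_corner b y a True c (\<not> \<tau>)"
    if "{y, y + plane_basis a} \<in> edges" for y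
    using tile_corner_xor_aux[OF that k] tile_corner_xor_aux[OF that k'] by (cases \<tau>) auto
  show ?thesis
  proof (cases \<sigma>)
    case True
    then show ?thesis using pos[of x] e by (simp add: step_def)
  next
    case False
    have "tile_corner l (x + step a False) a True d \<rho> \<longleftrightarrow> tile_corner l x a False d \<rho>" for l d \<rho>
      using tile_corner_move[of l x a False d \<rho>] by simp
    moreover have "{x + step a False, x + step a False + plane_basis a} \<in> edges"
      using e False by (simp add: step_def insert_commute)
    ultimately show ?thesis using pos[of "x + step a False"] False by simp
  qed
qed

section \<open>A trace form on closed paths of length four\<close>

definition corner :: "3 \<Rightarrow> real^2 \<Rightarrow> real^2 \<Rightarrow> real^2 \<Rightarrow> bool" where
  "corner k u x y \<longleftrightarrow> (\<exists>a \<sigma> b \<tau>. tile_corner k u a \<sigma> b \<tau> \<and> x = u + step a \<sigma> \<and> y = u + step b \<tau>)"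

lemma corner_step: "corner k u (u + step a \<sigma>) (u + step b \<tau>) \<longleftrightarrow> tile_corner k u a \<sigma> b \<tau>"
  unfolding corner_def by (auto simp: step_eq_iff)

lemma corner_sym: "corner k u x y \<longleftrightarrow> corner k u y x"
  unfolding corner_def using tile_corner_swap by blast

lemma corner_distinct: "corner k u x y \<Longrightarrow> x \<noteq> y"
  unfolding corner_def using tile_corner_distinct by (auto simp: step_eq_iff)

lemma corner_unique: "corner k u x y \<Longrightarrow> corner l u x y \<Longrightarrow> l = k"
  unfolding corner_def using tile_corner_type by (auto simp: step_eq_iff)

lemma corner_edges: "corner k u x y \<Longrightarrow> {u, x} \<in> edges \<and> {u, y} \<in> edges"
  unfolding corner_def using tile_corner_edge by blast

lemma corner_opposite:
  assumes "corner k u x y"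
  shows "corner k x u (x + y - u)" "corner k (x + y - u) x y"
proof -
  obtain a \<sigma> b \<tau> where t: "tile_corner k u a \<sigma> b \<tau>" and xy: "x = u + step a \<sigma>" "y = u + step b \<tau>"
    using assms unfolding corner_def by blast
  have 1: "tile_corner k x a (\<not> \<sigma>) b \<tau>" using t by (simp add: xy tile_corner_move)
  then show "corner k x u (x + y - u)"
    using corner_step[of k x a "\<not> \<sigma>" b \<tau>] by (simp add: xy step_minus algebra_simps)
  have "tile_corner k (x + step b \<tau>) b (\<not> \<tau>) a (\<not> \<sigma>)"
    using 1 tile_corner_swap tile_corner_move by blast
  then show "corner k (x + y - u) x y"
    using corner_step[of k "x + step b \<tau>" b "\<not> \<tau>" a "\<not> \<sigma>"] by (simp add: xy step_minus algebra_simps)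
qed

text \<open>The difference x - y is a sum of two steps along different axes and determines them up
  to order. The same order gives the same centre, the other one the opposite vertex.\<close>

lemma corner_centers:
  assumes "corner k u x y" "corner l q x y" "u \<noteq> q"
  shows "q = x + y - u"
proof -
  obtain a \<sigma> b \<tau> where t: "a \<noteq> b" and xy: "x = u + step a \<sigma>" "y = u + step b \<tau>"
    using assms(1) tile_corner_distinct unfolding corner_def by blast
  obtain c \<rho> d \<pi> where t': "c \<noteq> d" and xy': "x = q + step c \<rho>" "y = q + step d \<pi>"
    using assms(2) tile_corner_distinct unfolding corner_def by blast
  have "x - y = step a \<sigma> + step b (\<not> \<tau>)" by (simp add: xy step_minus)
  moreover have "x - y = step c \<rho> + step d (\<not> \<pi>)" by (simp add: xy' step_minus)
  ultimately have "step a \<sigma> + step b (\<not> \<tau>) = step c \<rho> + step d (\<not> \<pi>)" by simp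
  from step_sum_eq[OF this] have "d = a \<and> \<rho> = (\<not> \<tau>) \<and> c = b"
    using t t' assms(3) xy xy' by auto
  then show ?thesis using xy xy' by (simp add: step_minus algebra_simps)
qed

lemma edge_steps:
  assumes "{x, u} \<in> edges"
  obtains a \<sigma> where "u = x + step a \<sigma>"
  using assms unfolding edge_iff by blast

lemma edge_vertices: "{x, u} \<in> edges \<Longrightarrow> x \<in> vertices \<and> u \<in> vertices"
  unfolding vertices_def by auto

text \<open>Each of the two tiles at an edge leaves x by a second side, along a positive or a
  negative step. The last factor is half the number of positive ones minus half the number of
  negative ones; the factor in front makes the excess change sign with the direction of the
  edge.\<close>

definition excess :: "real^2 \<Rightarrow> 3 \<Rightarrow> bool \<Rightarrow> int" where
  "excess x a \<sigma> = (if \<sigma> then 1 else -1) * (int (card {b. \<exists>k. tile_corner k x a \<sigma> b True}) - 1)"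

text \<open>In the algebra, the closed path \<open>x \<rightarrow> u \<rightarrow> y \<rightarrow> q \<rightarrow> x\<close> is this multiple of one and the same
  element.\<close>

definition cyclic_value :: "(3 \<Rightarrow> real^2 \<Rightarrow> int) \<Rightarrow> real^2 \<Rightarrow> real^2 \<Rightarrow> real^2 \<Rightarrow> real^2 \<Rightarrow> int" where
  "cyclic_value s x u y q =
    (if x \<noteq> y then \<Sum>k | corner k u x y \<and> corner k q x y. s k x
     else if u \<noteq> q then \<Sum>k | corner k x u q. s k x
     else (\<Prod>k\<in>UNIV. s k x) * (THE e. \<exists>a \<sigma>. u = x + step a \<sigma> \<and> e = excess x a \<sigma>))"

lemma excess_opposite: "excess (x + step a \<sigma>) a (\<not> \<sigma>) = - excess x a \<sigma>"
  by (simp add: excess_def tile_corner_move)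

text \<open>By \<open>tile_corner_xor\<close>, a positive step along the third axis k is the same as
  a missing negative step along b. Hence both axes other than a compute the same number, which is
  what makes relation (3) consistent with the trace.\<close>

lemma excess_axis:
  assumes e: "{x, x + step a \<sigma>} \<in> edges" and k: "{a, b, k} = UNIV"
  shows "excess x a \<sigma> = (if \<sigma> then 1 else -1) *
    (of_bool (tile_corner k x a \<sigma> b True) - of_bool (tile_corner k x a \<sigma> b False))"
proof -
  have d: "b \<noteq> k" using k UNIV_3_iff by blast
  have k': "{a, k, b} = UNIV" using k by (simp add: insert_commute)
  have "{c. \<exists>l. tile_corner l x a \<sigma> c True} =
      (if tile_corner k x a \<sigma> b True then {b} else {}) \<union> (if tile_corner b x a \<sigma> k True then {k} else {})"
  proof -
    have "c = b \<and> l = k \<or> c = k \<and> l = b" if "tile_corner l x a \<sigma> c True" for c l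
    proof -
      have "{a, c, l} = UNIV" using that by (simp add: tile_corner_def)
      moreover have "c \<in> {a, b, k}" "l \<in> {a, b, k}" using k by auto
      ultimately show ?thesis unfolding UNIV_3_iff by auto
    qed
    then show ?thesis by auto
  qed
  then have "int (card {c. \<exists>l. tile_corner l x a \<sigma> c True}) =
      of_bool (tile_corner k x a \<sigma> b True) + of_bool (tile_corner b x a \<sigma> k True)"
    using d by auto
  moreover have "tile_corner b x a \<sigma> k True \<longleftrightarrow> \<not> tile_corner k x a \<sigma> b False"
    using tile_corner_xor[OF e k', of True] by simp
  ultimately show ?thesis by (simp add: excess_def)
qed

lemma sum_unique:
  assumes "P k" "\<And>l. P l \<Longrightarrow> l = k"
  shows "(\<Sum>l | P l. f l) = f k"
proof -
  have "{l. P l} = {k}" using assms by blast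
  then show ?thesis by simp
qed

lemma cyclic_value_corner:
  assumes "corner k u x y" "corner k q x y"
  shows "cyclic_value s x u y q = s k x"
proof -
  have "(\<Sum>l | corner l u x y \<and> corner l q x y. s l x) = s k x"
    by (rule sum_unique) (use assms corner_unique[OF assms(1)] in blast)+
  then show ?thesis using corner_distinct[OF assms(1)] by (simp add: cyclic_value_def)
qed

lemma cyclic_value_no_corner:
  assumes "x \<noteq> y" "\<And>k. \<not> corner k u x y"
  shows "cyclic_value s x u y q = 0"
  using assms by (simp add: cyclic_value_def)

lemma cyclic_value_no_corner':
  assumes "x \<noteq> y" "\<And>k. \<not> corner k q x y"
  shows "cyclic_value s x u y q = 0"
  using assms by (simp add: cyclic_value_def)

lemma cyclic_value_no_loops:
  assumes "u \<noteq> q" "\<And>k. \<not> corner k x u q"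
  shows "cyclic_value s x u x q = 0"
  using assms by (simp add: cyclic_value_def)

lemma cyclic_value_power:
  "cyclic_value s x (x + step a \<sigma>) x (x + step a \<sigma>) = (\<Prod>k\<in>UNIV. s k x) * excess x a \<sigma>"
proof -
  have "(THE e. \<exists>b \<tau>. x + step a \<sigma> = x + step b \<tau> \<and> e = excess x b \<tau>) = excess x a \<sigma>"
    by (rule the_equality) (auto simp: step_eq_iff)
  then show ?thesis by (simp add: cyclic_value_def)
qed

section \<open>Signs and the invariance of the values\<close>

locale rauzy_signs =
  fixes s :: "3 \<Rightarrow> real^2 \<Rightarrow> int"
  assumes signs: "sign_choice s"
begin

lemma sign_square: "x \<in> vertices \<Longrightarrow> s a x * s a x = 1"
  using signs unfolding sign_choice_def by (auto dest!: spec[of _ a])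

lemma sign_step:
  assumes e: "{x, x + step a \<sigma>} \<in> edges"
  shows "s a (x + step a \<sigma>) = - s a x" "c \<noteq> a \<Longrightarrow> s c (x + step a \<sigma>) = s c x"
proof -
  have *: "s a (y + plane_basis a) = - s a y" "c \<noteq> a \<Longrightarrow> s c (y + plane_basis a) = s c y"
    if "{y, y + plane_basis a} \<in> edges" for y c
    using signs that unfolding sign_choice_def by auto
  show "s a (x + step a \<sigma>) = - s a x" "c \<noteq> a \<Longrightarrow> s c (x + step a \<sigma>) = s c x"
    using e *(1)[of x] *(2)[of x c] *(1)[of "x - plane_basis a"] *(2)[of "x - plane_basis a" c]
    by (cases \<sigma>; force simp: step_def insert_commute)+
qed

text \<open>The sides of a tile of type k run along the other two axes, and along these the sign of
  k is constant.\<close>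

lemma corner_sign:
  assumes "corner k u x y"
  shows "s k x = s k u"
proof -
  obtain a \<sigma> b \<tau> where t: "tile_corner k u a \<sigma> b \<tau>" "x = u + step a \<sigma>"
    using assms unfolding corner_def by blast
  have "k \<noteq> a" using tile_corner_distinct[OF t(1)] by blast
  then show ?thesis using sign_step(2)[OF tile_corner_edge(1)[OF t(1)]] t(2) by simp
qed

text \<open>Rotation exchanges the two pairs of opposite points. Around a tile the type persists by
  \<open>corner_opposite\<close> and its sign is constant. On a path back and forth along one edge
  exactly one of the three signs flips, and so does the excess.\<close>

lemma cyclic_value_rotate:
  assumes e: "{x, u} \<in> edges"
  shows "cyclic_value s x u y q = cyclic_value s u y q x"
proof -
  have shift: "corner k y u q \<and> corner k x u q \<and> s k u = s k x"
    if "corner k u x y" "corner k q x y" "u \<noteq> q" for k x u y q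
  proof -
    have q: "q = x + y - u" "q = y + x - u" using corner_centers that by (simp_all add: add.commute)
    have "corner k x u q" using corner_opposite(1)[OF that(1)] q(1) by simp
    moreover have "corner k y u q" using corner_opposite(1)[of k u y x] that(1) corner_sym q(2) by simp
    ultimately show ?thesis using corner_sign that(1) by metis
  qed
  consider "x \<noteq> y" "u \<noteq> q" | "x \<noteq> y" "u = q" | "x = y" "u \<noteq> q" | "x = y" "u = q" by blast
  then show ?thesis
  proof cases
    case 1
    have "corner k u x y \<and> corner k q x y \<longleftrightarrow> corner k y u q \<and> corner k x u q" for k
      using shift[of k u x y q] shift[of k x u q y] shift[of k y u q x] 1 corner_sym by metis
    moreover have "s k x = s k u" if "corner k u x y \<and> corner k q x y" for k
      using corner_sign that by blast
    ultimately show ?thesis using 1 by (simp add: cyclic_value_def)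
  next
    case 2
    then show ?thesis using corner_sign by (auto simp: cyclic_value_def corner_sym intro!: sum.cong)
  next
    case 3
    then show ?thesis using corner_sign by (auto simp: cyclic_value_def intro!: sum.cong)
  next
    case 4
    obtain a \<sigma> where u: "u = x + step a \<sigma>" using edge_steps[OF e] .
    have x: "x = u + step a (\<not> \<sigma>)" by (simp add: u step_minus)
    have "s k u = (if k = a then -1 else 1) * s k x" for k
      using sign_step[of x a \<sigma>] e by (simp add: u)
    then have "(\<Prod>k\<in>UNIV. s k u) = - (\<Prod>k\<in>UNIV. s k x)"
      by (simp add: prod.distrib)
    moreover have "excess u a (\<not> \<sigma>) = - excess x a \<sigma>" using excess_opposite by (simp add: u)
    moreover have "cyclic_value s u x u x = (\<Prod>k\<in>UNIV. s k u) * excess u a (\<not> \<sigma>)"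
      using cyclic_value_power[of s u a "\<not> \<sigma>"] by (simp flip: x)
    ultimately show ?thesis
      using 4 cyclic_value_power[of s x a \<sigma>] by (simp add: u)
  qed
qed

lemma cyclic_value_loop_edge:
  assumes "\<And>k. corner k z x q \<Longrightarrow> {z, x} \<in> edges" "x \<noteq> q"
  shows "(if {z, x} \<in> edges then cyclic_value s z x z q else 0) = (\<Sum>k | corner k z x q. s k z)"
proof (cases "{z, x} \<in> edges")
  case True
  then show ?thesis using assms(2) by (simp add: cyclic_value_def)
next
  case False
  then have "{k. corner k z x q} = {}" using assms(1) by blast
  then show ?thesis using False by simp
qed

text \<open>This is relation (3) completed by a loop along the edge in direction d; the point is
  that a is absent from the right-hand side. For a = d only the loop along the edge itself
  contributes. Otherwise the tiles between the two axes contribute, and the product of all signs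
  times \<open>s d z\<close> is \<open>s a z * s k z\<close>.\<close>

lemma cyclic_value_axis:
  assumes e: "{z, z + step d \<sigma>} \<in> edges"
  shows "s a z * ((if {z, z + plane_basis a} \<in> edges then cyclic_value s z (z + plane_basis a) z (z + step d \<sigma>) else 0)
      - (if {z, z - plane_basis a} \<in> edges then cyclic_value s z (z - plane_basis a) z (z + step d \<sigma>) else 0))
    = (\<Prod>k\<in>UNIV. s k z) * s d z * ((if \<sigma> then 1 else -1) * excess z d \<sigma>)"
proof -
  have z: "z \<in> vertices" using edge_vertices[OF e] ..
  define v where "v \<rho> = (if {z, z + step a \<rho>} \<in> edges then cyclic_value s z (z + step a \<rho>) z (z + step d \<sigma>) else 0)" for \<rho>
  have "s a z * (v True - v False) = (\<Prod>k\<in>UNIV. s k z) * s d z * ((if \<sigma> then 1 else -1) * excess z d \<sigma>)"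
  proof (cases "a = d")
    case True
    have "v (\<not> \<sigma>) = 0"
    proof -
      have "\<not> corner k z (z + step a (\<not> \<sigma>)) (z + step d \<sigma>)" for k
        unfolding corner_step using tile_corner_distinct True by blast
      then show ?thesis using True by (simp add: v_def cyclic_value_no_loops step_eq_iff)
    qed
    moreover have "v \<sigma> = (\<Prod>k\<in>UNIV. s k z) * excess z d \<sigma>"
      using True e by (simp add: v_def cyclic_value_power)
    ultimately show ?thesis using True by (cases \<sigma>) simp_all
  next
    case False
    then obtain k where k: "{d, a, k} = UNIV" using third_exists by metis
    have v: "v \<rho> = of_bool (tile_corner k z d \<sigma> a \<rho>) * s k z" for \<rho>
    proof -
      have "v \<rho> = (\<Sum>l | corner l z (z + step a \<rho>) (z + step d \<sigma>). s l z)"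
        unfolding v_def using corner_edges False
        by (intro cyclic_value_loop_edge) (auto simp: step_eq_iff)
      also have "\<dots> = (\<Sum>l | tile_corner l z d \<sigma> a \<rho>. s l z)"
        unfolding corner_step using tile_corner_swap by metis
      also have "\<dots> = of_bool (tile_corner k z d \<sigma> a \<rho>) * s k z"
      proof (cases "tile_corner k z d \<sigma> a \<rho>")
        case True
        then show ?thesis using tile_corner_type by (simp add: sum_unique[of _ k])
      next
        case False
        then have "{l. tile_corner l z d \<sigma> a \<rho>} = {}"
          using k third_unique unfolding tile_corner_def by blast
        then show ?thesis using False by simp
      qed
      finally show ?thesis .
    qed
    have "(\<Prod>l\<in>UNIV. s l z) = s d z * s a z * s k z"
      using k UNIV_3_iff[of d a k] by (simp flip: k)
    then have "(\<Prod>l\<in>UNIV. s l z) * s d z = s a z * s k z"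
      using sign_square[OF z, of d] by (simp add: algebra_simps)
    then show ?thesis
      unfolding excess_axis[OF e k] v by (cases \<sigma>) (simp_all add: algebra_simps)
  qed
  moreover have st: "z + step a True = z + plane_basis a" "z + step a False = z - plane_basis a"
    by (simp_all add: step_def)
  ultimately show ?thesis unfolding v_def st by blast
qed

end

section \<open>Rings without identity and their right ideals\<close>

locale nonunital_ring = abelian_group R for R (structure) +
  assumes m_closed: "\<lbrakk>a \<in> carrier R; b \<in> carrier R\<rbrakk> \<Longrightarrow> a \<otimes> b \<in> carrier R"
    and m_assoc: "\<lbrakk>a \<in> carrier R; b \<in> carrier R; c \<in> carrier R\<rbrakk> \<Longrightarrow> a \<otimes> b \<otimes> c = a \<otimes> (b \<otimes> c)"
    and l_distr: "\<lbrakk>a \<in> carrier R; b \<in> carrier R; c \<in> carrier R\<rbrakk> \<Longrightarrow> (a \<oplus> b) \<otimes> c = a \<otimes> c \<oplus> b \<otimes> c"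
    and r_distr: "\<lbrakk>a \<in> carrier R; b \<in> carrier R; c \<in> carrier R\<rbrakk> \<Longrightarrow> c \<otimes> (a \<oplus> b) = c \<otimes> a \<oplus> c \<otimes> b"
begin

lemma l_null: "a \<in> carrier R \<Longrightarrow> \<zero> \<otimes> a = \<zero>"
  using l_distr[of \<zero> \<zero> a] by (simp add: m_closed)

lemma r_null: "a \<in> carrier R \<Longrightarrow> a \<otimes> \<zero> = \<zero>"
  using r_distr[of \<zero> \<zero> a] by (simp add: m_closed)

lemma r_minus: "\<lbrakk>a \<in> carrier R; b \<in> carrier R\<rbrakk> \<Longrightarrow> a \<otimes> (\<ominus> b) = \<ominus> (a \<otimes> b)"
proof -
  assume a: "a \<in> carrier R" and b: "b \<in> carrier R"
  then have "a \<otimes> (\<ominus> b) \<oplus> a \<otimes> b = \<zero>" by (simp flip: r_distr add: l_neg r_null)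
  then show ?thesis using a b by (metis minus_equality m_closed a_inv_closed)
qed

end

locale nonunital_ideal = nonunital_ring R for R (structure) and I +
  assumes two_sided: "two_sided_ideal I R"
begin

lemma additive: "additive_subgroup I R"
  and I_l_closed: "\<lbrakk>a \<in> I; r \<in> carrier R\<rbrakk> \<Longrightarrow> r \<otimes> a \<in> I"
  and I_r_closed: "\<lbrakk>a \<in> I; r \<in> carrier R\<rbrakk> \<Longrightarrow> a \<otimes> r \<in> I"
  using two_sided unfolding two_sided_ideal_def by blast+

end

sublocale nonunital_ideal \<subseteq> abelian_subgroup I R
  using additive abelian_group_axioms by (rule abelian_subgroupI3)

context nonunital_ideal
begin

lemma rcoset_eq_iff:
  "\<lbrakk>f \<in> carrier R; g \<in> carrier R\<rbrakk> \<Longrightarrow> I +> f = I +> g \<longleftrightarrow> f \<ominus> g \<in> I"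
  using a_rcos_module[of g f] a_rcos_self[of f] a_repr_independence'[of f g]
  by (metis a_minus_def)

text \<open>The product of cosets is a union over all representatives; two-sidedness of the ideal
  makes all its terms the same coset.\<close>

lemma rcoset_mult_eq:
  assumes a: "a \<in> carrier R" and b: "b \<in> carrier R"
  shows "rcoset_mult R I (I +> a) (I +> b) = I +> (a \<otimes> b)"
proof -
  have *: "I +> (x \<otimes> y) = I +> (a \<otimes> b)" if "x \<in> I +> a" "y \<in> I +> b" for x y
  proof -
    obtain i j where i: "i \<in> I" "x = i \<oplus> a" and j: "j \<in> I" "y = j \<oplus> b"
      using \<open>x \<in> I +> a\<close> \<open>y \<in> I +> b\<close> by (auto simp: a_r_coset_def')
    have c: "i \<in> carrier R" "j \<in> carrier R" using i j a_subset by auto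
    have "x \<otimes> y = (i \<otimes> (j \<oplus> b) \<oplus> a \<otimes> j) \<oplus> a \<otimes> b"
      using a b c by (simp add: i(2) j(2) l_distr r_distr m_closed a_ac)
    moreover have "i \<otimes> (j \<oplus> b) \<oplus> a \<otimes> j \<in> I"
      using I_l_closed I_r_closed i j a b c by (intro a_closed) auto
    ultimately have "x \<otimes> y \<in> I +> (a \<otimes> b)" by (auto simp: a_r_coset_def')
    then show ?thesis using a_repr_independence' a b m_closed by metis
  qed
  moreover have "a \<in> I +> a" "b \<in> I +> b" using a_rcos_self a b by auto
  ultimately show ?thesis unfolding rcoset_mult_def by blast
qed

lemma carrier_quotient: "carrier (R Quot I) = (\<lambda>f. I +> f) ` carrier R"
  by (auto simp: FactRing_def A_RCOSETS_def')

lemma quotient_mult: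
  "\<lbrakk>a \<in> carrier R; b \<in> carrier R\<rbrakk> \<Longrightarrow> (I +> a) \<otimes>\<^bsub>R Quot I\<^esub> (I +> b) = I +> (a \<otimes> b)"
  by (simp add: FactRing_def rcoset_mult_eq)

lemma quotient_add:
  "\<lbrakk>a \<in> carrier R; b \<in> carrier R\<rbrakk> \<Longrightarrow> (I +> a) \<oplus>\<^bsub>R Quot I\<^esub> (I +> b) = I +> (a \<oplus> b)"
  by (simp add: FactRing_def a_rcos_sum)

lemma quotient_zero: "\<zero>\<^bsub>R Quot I\<^esub> = I" "I +> \<zero> = I"
  by (simp_all add: FactRing_def a_rcos_const)

lemma nonunital_quotient: "nonunital_ring (R Quot I)"
proof -
  have "abelian_group (R Quot I)"
    by (rule comm_group_abelian_groupI)
      (simp add: FactRing_def a_factorgroup_is_comm_group[unfolded A_FactGroup_def'])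
  then show ?thesis
    by (auto simp: nonunital_ring_def nonunital_ring_axioms_def carrier_quotient quotient_mult
        quotient_add m_closed m_assoc l_distr r_distr)
qed

end

section \<open>Right ideals as modules\<close>

lemma right_ideal_module_simps:
  "carrier (right_ideal_module R N) = N" "mult (right_ideal_module R N) = add R"
  "one (right_ideal_module R N) = \<zero>\<^bsub>R\<^esub>" "act (right_ideal_module R N) = mult R"
  "(right_ideal_module R N)\<lparr>carrier := N'\<rparr> = right_ideal_module R N'"
  by (simp_all add: right_ideal_module_def)

context nonunital_ring
begin

lemma right_ideal_module_group:
  assumes "additive_subgroup N R"
  shows "group (right_ideal_module R N)"
proof -
  interpret additive_subgroup N R by fact
  show ?thesis
  proof (rule groupI)
    fix x assume "x \<in> carrier (right_ideal_module R N)"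
    then have x: "x \<in> N" "x \<in> carrier R" using a_subset by (auto simp: right_ideal_module_simps)
    then show "\<exists>y\<in>carrier (right_ideal_module R N).
        y \<otimes>\<^bsub>right_ideal_module R N\<^esub> x = \<one>\<^bsub>right_ideal_module R N\<^esub>"
      by (intro bexI[of _ "\<ominus> x"]) (simp_all add: right_ideal_module_simps a_inv_closed l_neg)
  qed (use a_subset in \<open>auto simp: right_ideal_module_simps a_assoc subset_iff\<close>)
qed

lemma right_multiples: "a <# carrier R = (\<lambda>r. a \<otimes> r) ` carrier R"
  by (auto simp: l_coset_def)

lemma right_multiples_subgroup:
  assumes a: "a \<in> carrier R"
  shows "additive_subgroup (a <# carrier R) R"
proof (rule additive_subgroupI, rule add.subgroupI)
  show "a <# carrier R \<subseteq> carrier R" "a <# carrier R \<noteq> {}"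
    using a m_closed by (auto simp: right_multiples)
  fix x assume "x \<in> a <# carrier R"
  then obtain r where r: "r \<in> carrier R" "x = a \<otimes> r" by (auto simp: right_multiples)
  have "\<ominus> x = a \<otimes> \<ominus> r" using a r by (simp add: r_minus)
  then show "\<ominus> x \<in> a <# carrier R" using r(1) by (auto simp: right_multiples)
  fix y assume "y \<in> a <# carrier R"
  then obtain q where q: "q \<in> carrier R" "y = a \<otimes> q" by (auto simp: right_multiples)
  have "x \<oplus> y = a \<otimes> (r \<oplus> q)" using a r q by (simp add: r_distr)
  then show "x \<oplus> y \<in> a <# carrier R" using r(1) q(1) by (auto simp: right_multiples)
qed

lemma right_submoduleI:
  assumes N: "additive_subgroup N R" and M: "additive_subgroup M R" and sub: "N \<subseteq> M"
    and act: "\<And>n r. n \<in> N \<Longrightarrow> r \<in> carrier R \<Longrightarrow> n \<otimes> r \<in> N"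
  shows "right_submodule R N (right_ideal_module R M)"
proof -
  interpret M: group "right_ideal_module R M" using M by (rule right_ideal_module_group)
  interpret N: additive_subgroup N R by fact
  have "subgroup N (right_ideal_module R M)"
  proof (rule M.subgroupI)
    show "N \<noteq> {}" using N.zero_closed by blast
    fix x assume x: "x \<in> N"
    then have "x \<in> carrier R" "\<ominus> x \<in> N" using N.a_subset by auto
    then have "inv\<^bsub>right_ideal_module R M\<^esub> x = \<ominus> x"
      using x sub by (intro M.inv_equality) (auto simp: right_ideal_module_simps l_neg)
    with \<open>\<ominus> x \<in> N\<close> show "inv\<^bsub>right_ideal_module R M\<^esub> x \<in> N" by simp
  qed (use sub in \<open>auto simp: right_ideal_module_simps\<close>)
  then show ?thesis using act by (simp add: right_submodule_def right_ideal_module_simps)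
qed

end

text \<open>The first isomorphism theorem. The action on a coset is a union over its elements, and
  it is a single coset because elements with equal image under h still have equal image after the
  action of r.\<close>

lemma quotient_module_iso:
  assumes M: "group M" "group M'" and hom: "h \<in> hom M M'" and surj: "h ` carrier M = carrier M'"
    and act: "\<And>m r. m \<in> carrier M \<Longrightarrow> r \<in> carrier R \<Longrightarrow> act M m r \<in> carrier M"
    and h_act: "\<And>m r. m \<in> carrier M \<Longrightarrow> r \<in> carrier R \<Longrightarrow> h (act M m r) = act M' (h m) r"
  shows "module_iso R (quotient_module M (kernel M M' h)) M'"
proof -
  interpret group_hom M M' h
    using M hom by (simp add: group_hom_def group_hom_axioms_def)
  let ?N = "kernel M M' h" and ?g = "\<lambda>X. the_elem (h ` X)"
  have iso: "?g \<in> iso (M Mod ?N) M'" using surj by (rule FactGroup_iso_set)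
  have coset: "X \<noteq> {} \<and> X \<subseteq> carrier M \<and> (\<forall>x\<in>X. h x = h m)"
    if "m \<in> carrier M" "X = ?N #>\<^bsub>M\<^esub> m" for X m
    using that by (auto simp: r_coset_def kernel_def intro: exI[of _ "\<one>\<^bsub>M\<^esub>"])
  have g: "?g (?N #>\<^bsub>M\<^esub> m) = h m" if "m \<in> carrier M" for m
  proof -
    have "h ` (?N #>\<^bsub>M\<^esub> m) = {h m}" using coset[OF that refl] by auto
    then show ?thesis by simp
  qed
  have "?g (act (quotient_module M ?N) X r) = act M' (?g X) r"
    if X: "X \<in> carrier (quotient_module M ?N)" and r: "r \<in> carrier R" for X r
  proof -
    obtain m where m: "m \<in> carrier M" "X = ?N #>\<^bsub>M\<^esub> m"
      using X by (auto simp: quotient_module_def FactGroup_def RCOSETS_def)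
    have "?N #>\<^bsub>M\<^esub> act M x r = ?N #>\<^bsub>M\<^esub> act M m r" if "x \<in> X" for x
    proof -
      have x: "x \<in> carrier M" "h x = h m" using coset[OF m] that by auto
      then have "h (act M x r) = h (act M m r)" using h_act m(1) r by simp
      then show ?thesis using FactGroup_subset act x(1) m(1) r by (metis subset_antisym)
    qed
    then have "act (quotient_module M ?N) X r = ?N #>\<^bsub>M\<^esub> act M m r"
      using coset[OF m] by (auto simp: quotient_module_def)
    then show ?thesis using g act h_act m r by simp
  qed
  note g_act = this
  have "?g \<in> iso (quotient_module M ?N) M'"
    using iso by (simp add: quotient_module_def iso_def hom_def)
  then show ?thesis unfolding module_iso_def using g_act by (intro bexI[of _ ?g] ballI) simp_all
qed

context nonunital_ring
begin

lemma cyclic_simps: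
  "carrier (cyclic_right_ideal R a) = (\<lambda>r. a \<otimes> r) ` carrier R"
  "mult (cyclic_right_ideal R a) = add R" "one (cyclic_right_ideal R a) = \<zero>"
  "act (cyclic_right_ideal R a) = mult R"
  by (simp_all add: cyclic_right_ideal_def right_ideal_module_simps right_multiples)

lemma cyclic_group: "a \<in> carrier R \<Longrightarrow> group (cyclic_right_ideal R a)"
  unfolding cyclic_right_ideal_def by (intro right_ideal_module_group right_multiples_subgroup)

text \<open>The lowest quotient of a filtration is taken by the zero submodule, the kernel of the
  identity map.\<close>

lemma cyclic_quotient_zero_iso:
  assumes a: "a \<in> carrier R"
  shows "module_iso R (quotient_module (cyclic_right_ideal R a) {\<zero>}) (cyclic_right_ideal R a)"
proof -
  let ?M = "cyclic_right_ideal R a"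
  interpret M: group ?M using a by (rule cyclic_group)
  have "kernel ?M ?M (\<lambda>m. m) = {\<zero>}"
    using M.one_closed by (auto simp: kernel_def cyclic_simps(3))
  moreover have "module_iso R (quotient_module ?M (kernel ?M ?M (\<lambda>m. m))) ?M"
  proof (rule quotient_module_iso)
    show "act ?M m r \<in> carrier ?M" if "m \<in> carrier ?M" "r \<in> carrier R" for m r
      using that a by (auto simp: cyclic_simps m_assoc m_closed)
  qed (auto simp: hom_def M.group_axioms)
  ultimately show ?thesis by simp
qed

text \<open>Left multiplication commutes with the right action, so it maps the right ideal of a
  homomorphically onto that of \<open>l \<otimes> a\<close>.\<close>

lemma cyclic_quotient_iso:
  assumes a: "a \<in> carrier R" and l: "l \<in> carrier R"
    and N: "N = {m \<in> carrier (cyclic_right_ideal R a). l \<otimes> m = \<zero>}"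
  shows "module_iso R (quotient_module (cyclic_right_ideal R a) N) (cyclic_right_ideal R (l \<otimes> a))"
proof -
  let ?M = "cyclic_right_ideal R a" and ?M' = "cyclic_right_ideal R (l \<otimes> a)"
  have "kernel ?M ?M' (\<lambda>m. l \<otimes> m) = N"
    by (simp add: N kernel_def cyclic_simps(3))
  moreover have "(\<lambda>m. l \<otimes> m) \<in> hom ?M ?M'"
    using a l by (auto simp: hom_def cyclic_simps m_closed r_distr m_assoc[symmetric] intro!: imageI)
  moreover have "(\<lambda>m. l \<otimes> m) ` carrier ?M = carrier ?M'"
    using a l by (force simp: cyclic_simps m_assoc)
  moreover have "act ?M m r \<in> carrier ?M"
    "l \<otimes> act ?M m r = act ?M' (l \<otimes> m) r" if "m \<in> carrier ?M" "r \<in> carrier R" for m r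
    using that a l by (auto simp: cyclic_simps m_assoc m_closed)
  ultimately show ?thesis
    using quotient_module_iso[of ?M ?M' "\<lambda>m. l \<otimes> m" R] a l by (simp add: cyclic_group m_closed)
qed

end

section \<open>The path algebra\<close>

text \<open>The supports in the definition vary with the arguments. Larger finite sets give a common
  range of summation, from which bilinearity follows termwise.\<close>

lemma path_mult_eq_sum:
  assumes "finite A" "Poly_Mapping.keys f \<subseteq> A" "finite B" "Poly_Mapping.keys g \<subseteq> B"
  shows "path_mult f g = (\<Sum>u\<in>A. \<Sum>w\<in>B. if last u = hd w
    then Poly_Mapping.single (u @ tl w) (Poly_Mapping.lookup f u * Poly_Mapping.lookup g w) else 0)"
proof -
  have inner: "(\<Sum>w\<in>Poly_Mapping.keys g. if last u = hd w
      then Poly_Mapping.single (u @ tl w) (Poly_Mapping.lookup f u * Poly_Mapping.lookup g w) else 0)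
    = (\<Sum>w\<in>B. if last u = hd w
      then Poly_Mapping.single (u @ tl w) (Poly_Mapping.lookup f u * Poly_Mapping.lookup g w) else 0)" for u
    using assms(3,4) by (intro sum.mono_neutral_left) (auto simp: in_keys_iff)
  show ?thesis
    unfolding path_mult_def inner using assms(1,2)
    by (intro sum.mono_neutral_left) (auto simp: in_keys_iff intro!: sum.neutral)
qed

lemma path_mult_single:
  "path_mult (Poly_Mapping.single u c) (Poly_Mapping.single w d) =
    (if last u = hd w then Poly_Mapping.single (u @ tl w) (c * d) else 0)"
  by (subst path_mult_eq_sum[of "{u}" _ "{w}"]) auto

lemma path_mult_add_left: "path_mult (f + f') g = path_mult f g + path_mult f' g"
proof -
  let ?A = "Poly_Mapping.keys f \<union> Poly_Mapping.keys f'" and ?B = "Poly_Mapping.keys g"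
  have "Poly_Mapping.keys (f + f') \<subseteq> ?A" by (rule keys_add)
  then show ?thesis
    by (simp add: path_mult_eq_sum[of ?A _ ?B] lookup_add distrib_right single_add
        flip: sum.distrib cong: if_cong)
      (intro sum.cong refl, simp)
qed

lemma path_mult_add_right: "path_mult f (g + g') = path_mult f g + path_mult f g'"
proof -
  let ?A = "Poly_Mapping.keys f" and ?B = "Poly_Mapping.keys g \<union> Poly_Mapping.keys g'"
  have "Poly_Mapping.keys (g + g') \<subseteq> ?B" by (rule keys_add)
  then show ?thesis
    by (simp add: path_mult_eq_sum[of ?A _ ?B] lookup_add distrib_left single_add
        flip: sum.distrib cong: if_cong)
      (intro sum.cong refl, simp)
qed

lemma path_mult_0: "path_mult 0 g = 0" "path_mult f 0 = 0"
  by (simp_all add: path_mult_def)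

abbreviation path_carrier :: "(qpath \<Rightarrow>\<^sub>0 'k::field) set" where
  "path_carrier \<equiv> carrier path_algebra"

lemma path_algebra_simps:
  "path_carrier = {f. Poly_Mapping.keys f \<subseteq> paths}"
  "mult path_algebra = path_mult" "\<zero>\<^bsub>path_algebra\<^esub> = 0" "add path_algebra = (+)"
  by (simp_all add: path_algebra_def)

lemma path_carrier_closed:
  "0 \<in> path_carrier" "f \<in> path_carrier \<Longrightarrow> g \<in> path_carrier \<Longrightarrow> f + g \<in> path_carrier"
  "f \<in> path_carrier \<Longrightarrow> - f \<in> path_carrier"
  "f \<in> path_carrier \<Longrightarrow> g \<in> path_carrier \<Longrightarrow> f - g \<in> path_carrier"
  "u \<in> paths \<Longrightarrow> Poly_Mapping.single u c \<in> path_carrier"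
  using keys_add[of f g] keys_diff[of f g] by (auto simp: path_algebra_simps)

text \<open>Paths span the algebra, so additive statements need only be checked on multiples of
  paths.\<close>

lemma path_carrier_induct [consumes 1, case_names zero single add]:
  assumes f: "f \<in> path_carrier" and "P 0"
    and "\<And>u c. u \<in> paths \<Longrightarrow> P (Poly_Mapping.single u c)"
    and "\<And>f g. \<lbrakk>f \<in> path_carrier; g \<in> path_carrier; P f; P g\<rbrakk> \<Longrightarrow> P (f + g)"
  shows "P f"
proof -
  have "(\<Sum>u\<in>A. Poly_Mapping.single u (Poly_Mapping.lookup f u)) \<in> path_carrier \<and>
      P (\<Sum>u\<in>A. Poly_Mapping.single u (Poly_Mapping.lookup f u))"
    if "finite A" "A \<subseteq> paths" for A
    using that
  proof (induction A rule: finite_induct)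
    case empty
    then show ?case using assms(2) by (simp add: path_algebra_simps)
  next
    case (insert u A)
    let ?g = "Poly_Mapping.single u (Poly_Mapping.lookup f u)"
    have "?g \<in> path_carrier" using insert.prems by (simp add: path_algebra_simps)
    moreover have "P ?g" using assms(3) insert.prems by simp
    moreover have "(\<Sum>u\<in>A. Poly_Mapping.single u (Poly_Mapping.lookup f u)) \<in> path_carrier \<and>
        P (\<Sum>u\<in>A. Poly_Mapping.single u (Poly_Mapping.lookup f u))" using insert by blast
    ultimately show ?case
      unfolding sum.insert[OF insert.hyps] using assms(4) path_carrier_closed(2) by blast
  qed
  moreover have "f = (\<Sum>u\<in>Poly_Mapping.keys f. Poly_Mapping.single u (Poly_Mapping.lookup f u))"
    by (rule poly_mapping_eqI) (auto simp: lookup_sum lookup_single when_def in_keys_iff)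
  ultimately show ?thesis using f by (metis (no_types, lifting) finite_keys mem_Collect_eq path_algebra_simps(1))
qed

lemma paths_append:
  assumes "u \<in> paths" "w \<in> paths" "last u = hd w"
  shows "u @ tl w \<in> paths"
proof (cases "tl w = []")
  case True
  then show ?thesis using assms by simp
next
  case False
  then have "w = hd w # hd (tl w) # tl (tl w)" by (cases w; cases "tl w") auto
  moreover have "successively (\<lambda>x y. {x, y} \<in> edges) w" using assms(2) by (simp add: paths_def)
  ultimately have "{last u, hd (tl w)} \<in> edges" "successively (\<lambda>x y. {x, y} \<in> edges) (tl w)"
    using assms(3) by (metis successively.simps(3) list.sel(3))+
  moreover have "set (tl w) \<subseteq> vertices"
    using assms(2) by (cases w) (auto simp: paths_def)
  ultimately show ?thesis using assms by (simp add: paths_def successively_append_iff)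
qed

lemma path_mult_carrier:
  assumes "f \<in> path_carrier" "g \<in> path_carrier"
  shows "path_mult f g \<in> path_carrier"
  using assms(1)
proof (induction f rule: path_carrier_induct)
  case (single u c)
  from assms(2) show ?case
  proof (induction g rule: path_carrier_induct)
    case (single w d)
    then show ?case
      using \<open>u \<in> paths\<close> paths_append by (auto simp: path_mult_single path_algebra_simps)
  next
    case (add f g)
    then show ?case by (simp add: path_mult_add_right path_carrier_closed)
  qed (simp add: path_mult_0 path_algebra_simps)
next
  case (add f g)
  then show ?case by (simp add: path_mult_add_left path_carrier_closed)
qed (simp add: path_mult_0 path_algebra_simps)

lemma path_mult_assoc:
  assumes "f \<in> path_carrier" "g \<in> path_carrier" "h \<in> path_carrier"
  shows "path_mult (path_mult f g) h = path_mult f (path_mult g h)"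
  using assms(2)
proof (induction g rule: path_carrier_induct)
  case (single v d)
  then have v: "v \<noteq> []" by (simp add: paths_def)
  from assms(1) show ?case
  proof (induction f rule: path_carrier_induct)
    case (single u c)
    from assms(3) show ?case
    proof (induction h rule: path_carrier_induct)
      case (single w e)
      have "last (u @ tl v) = last v" if "last u = hd v"
        using v that by (cases v) auto
      then show ?case using v by (auto simp: path_mult_single path_mult_0 mult.assoc)
    qed (simp_all add: path_mult_0 path_mult_add_right)
  qed (simp_all add: path_mult_0 path_mult_add_left)
qed (simp_all add: path_mult_0 path_mult_add_left path_mult_add_right)

global_interpretation path_algebra: nonunital_ring "path_algebra :: (qpath \<Rightarrow>\<^sub>0 'k::field) ring"
proof -
  have "\<exists>g\<in>path_carrier. g + f = 0" if "f \<in> path_carrier" for f :: "qpath \<Rightarrow>\<^sub>0 'k"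
    using path_carrier_closed(3)[OF that] by (intro bexI[of _ "- f"]) auto
  then have "abelian_group (path_algebra :: (qpath \<Rightarrow>\<^sub>0 'k) ring)"
    by (intro abelian_groupI)
      (auto simp: path_algebra_simps(2-4) path_carrier_closed algebra_simps)
  then show "nonunital_ring (path_algebra :: (qpath \<Rightarrow>\<^sub>0 'k) ring)"
    by (auto simp: nonunital_ring_def nonunital_ring_axioms_def path_algebra_simps(2-4)
        path_mult_carrier path_mult_assoc path_mult_add_left path_mult_add_right)
qed

lemma path_algebra_a_inv: "f \<in> path_carrier \<Longrightarrow> \<ominus>\<^bsub>path_algebra\<^esub> f = - f"
  using path_algebra.minus_equality[of "- f" f] by (simp add: path_algebra_simps(3,4) path_carrier_closed)

lemma path_algebra_minus:
  "f \<in> path_carrier \<Longrightarrow> g \<in> path_carrier \<Longrightarrow> f \<ominus>\<^bsub>path_algebra\<^esub> g = f - g"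
  by (simp add: a_minus_def path_algebra_a_inv path_algebra_simps(4))

lemma path_mult_minus:
  "f \<in> path_carrier \<Longrightarrow> g \<in> path_carrier \<Longrightarrow> g' \<in> path_carrier \<Longrightarrow>
    path_mult f (g - g') = path_mult f g - path_mult f g'"
  using path_mult_add_right[of f "g - g'" g'] by simp

lemma path_mult_minus_left: "path_mult (f - f') g = path_mult f g - path_mult f' g"
  using path_mult_add_left[of "f - f'" f' g] by simp

section \<open>The Rauzy ideal and the trace\<close>

text \<open>The ring itself is one of the intersected ideals, which keeps the intersection inside
  the carrier.\<close>

lemma (in nonunital_ring) generated_ideal_two_sided:
  assumes S: "S \<subseteq> carrier R"
  shows "two_sided_ideal (generated_ideal R S) R"
proof -
  have "additive_subgroup (carrier R) R"
    by (intro additive_subgroupI add.subgroupI) auto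
  then have "two_sided_ideal (carrier R) R"
    by (simp add: two_sided_ideal_def m_closed)
  then have sub: "generated_ideal R S \<subseteq> carrier R"
    using S unfolding generated_ideal_def by blast
  have "additive_subgroup (generated_ideal R S) R"
  proof (rule additive_subgroupI, rule add.subgroupI)
    show "generated_ideal R S \<subseteq> carrier R" by (rule sub)
    have "\<zero> \<in> generated_ideal R S"
      by (auto simp: generated_ideal_def two_sided_ideal_def intro: additive_subgroup.zero_closed)
    then show "generated_ideal R S \<noteq> {}" by blast
    fix f assume f: "f \<in> generated_ideal R S"
    show "\<ominus> f \<in> generated_ideal R S"
      using f unfolding a_inv_def
      by (auto simp: generated_ideal_def two_sided_ideal_def
          intro: subgroup.m_inv_closed additive_subgroup.a_subgroup)
    fix g assume "g \<in> generated_ideal R S"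
    then show "f \<oplus> g \<in> generated_ideal R S"
      using f by (auto simp: generated_ideal_def two_sided_ideal_def intro: additive_subgroup.a_closed)
  qed
  then show ?thesis
    unfolding two_sided_ideal_def by (auto simp: generated_ideal_def two_sided_ideal_def)
qed

lemma generated_ideal_superset: "S \<subseteq> generated_ideal R S"
  unfolding generated_ideal_def by blast

lemma generated_ideal_least: "two_sided_ideal J R \<Longrightarrow> S \<subseteq> J \<Longrightarrow> generated_ideal R S \<subseteq> J"
  unfolding generated_ideal_def by blast

section \<open>Paths and relations as elements of the path algebra\<close>

lemma paths_Cons: "u # p \<in> paths \<longleftrightarrow> u \<in> vertices \<and> (p = [] \<or> {u, hd p} \<in> edges \<and> p \<in> paths)"
  by (cases p) (auto simp: paths_def)

lemma paths_2: "[x, y] \<in> paths \<longleftrightarrow> {x, y} \<in> edges"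
  and paths_3: "[x, y, z] \<in> paths \<longleftrightarrow> {x, y} \<in> edges \<and> {y, z} \<in> edges"
  using edge_vertices by (auto simp: paths_Cons)

lemma paths_appendD:
  assumes "p @ q \<in> paths"
  shows "p \<noteq> [] \<Longrightarrow> p \<in> paths" "q \<noteq> [] \<Longrightarrow> q \<in> paths"
  using assms by (auto simp: paths_def successively_append_iff)

lemma signed_difference_eq:
  "signed_difference s a z =
    (if {z, z + plane_basis a} \<in> edges then Poly_Mapping.single [z, z + plane_basis a, z] (of_int (s a z)) else 0)
    - (if {z, z - plane_basis a} \<in> edges then Poly_Mapping.single [z, z - plane_basis a, z] (of_int (s a z)) else 0)"
proof -
  have map: "Poly_Mapping.lookup (Poly_Mapping.map ((*) c) f) u = c * Poly_Mapping.lookup f u"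
    for c :: 'a and f :: "qpath \<Rightarrow>\<^sub>0 'a" and u
    by (simp add: map.rep_eq when_def)
  show ?thesis
    by (rule poly_mapping_eqI)
      (simp add: signed_difference_def axis_difference_def loop_at_def map lookup_minus lookup_single
        when_def algebra_simps)
qed

lemma around_tile_corner:
  assumes "t \<in> rauzy_tiling" "around_tile t x u y"
  shows "\<exists>k. corner k u x y"
  using common_tile_corner[of t u x y] assms unfolding around_tile_def corner_def
  by (auto simp: insert_commute)

lemma corner_sides:
  assumes "corner k u x y"
  shows "\<exists>t\<in>rauzy_tiling. around_tile t x u y \<and> around_tile t x (x + y - u) y"
proof -
  obtain a \<sigma> b \<tau> where t: "tile_corner k u a \<sigma> b \<tau>" and xy: "x = u + step a \<sigma>" "y = u + step b \<tau>"
    using assms unfolding corner_def by blast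
  have q: "x + y - u = u + step a \<sigma> + step b \<tau>" by (simp add: xy)
  show ?thesis
    using tile_corner_sides[OF t] corner_distinct[OF assms] unfolding around_tile_def q
    by (auto simp: xy insert_commute)
qed

lemma relations_carrier: "relations1 \<union> relations2 \<union> relations3 s \<subseteq> path_carrier"
proof -
  have 1: "relations1 \<subseteq> path_carrier"
    by (auto simp: relations1_def paths_3 intro!: path_carrier_closed)
  have "{x, u} \<in> edges \<and> {u, y} \<in> edges" if "t \<in> rauzy_tiling" "around_tile t x u y" for t x u y
    using that by (auto simp: around_tile_def edges_def)
  then have 2: "relations2 \<subseteq> path_carrier"
    by (auto simp: relations2_def paths_3 intro!: path_carrier_closed)
  have "signed_difference s a z \<in> path_carrier" for a z
    unfolding signed_difference_eq
    by (intro path_carrier_closed) (auto simp: paths_3 insert_commute intro!: path_carrier_closed)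
  then have 3: "relations3 s \<subseteq> path_carrier"
    by (auto simp: relations3_def intro!: path_carrier_closed)
  from 1 2 3 show ?thesis by blast
qed

lemma rauzy_ideal_two_sided: "two_sided_ideal (rauzy_ideal s) path_algebra"
  unfolding rauzy_ideal_def by (intro path_algebra.generated_ideal_two_sided relations_carrier)

global_interpretation rauzy_ideal: nonunital_ideal path_algebra "rauzy_ideal s" for s
  by unfold_locales (rule rauzy_ideal_two_sided)

lemma rauzy_ideal_carrier: "f \<in> rauzy_ideal s \<Longrightarrow> f \<in> path_carrier"
  using rauzy_ideal.a_subset by blast

lemma rauzy_ideal_closed:
  "0 \<in> rauzy_ideal s"
  "f \<in> rauzy_ideal s \<Longrightarrow> g \<in> rauzy_ideal s \<Longrightarrow> f + g \<in> rauzy_ideal s"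
  "f \<in> rauzy_ideal s \<Longrightarrow> - f \<in> rauzy_ideal s"
  "f \<in> rauzy_ideal s \<Longrightarrow> g \<in> path_carrier \<Longrightarrow> path_mult f g \<in> rauzy_ideal s"
  "f \<in> rauzy_ideal s \<Longrightarrow> g \<in> path_carrier \<Longrightarrow> path_mult g f \<in> rauzy_ideal s"
  using rauzy_ideal.zero_closed[of s] rauzy_ideal.a_closed[of f s g] rauzy_ideal.a_inv_closed[of f s]
    rauzy_ideal.I_l_closed[of f s g] rauzy_ideal.I_r_closed[of f s g] rauzy_ideal_carrier[of f s]
  by (auto simp: path_algebra_simps(2-4) path_algebra_a_inv)

lemma rauzy_ideal_diff:
  "f \<in> rauzy_ideal s \<Longrightarrow> g \<in> rauzy_ideal s \<Longrightarrow> f - g \<in> rauzy_ideal s"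
  using rauzy_ideal_closed(2)[of f s "- g"] rauzy_ideal_closed(3)[of g s] by simp

section \<open>The trace form and its radical\<close>

definition path_trace :: "(3 \<Rightarrow> real^2 \<Rightarrow> int) \<Rightarrow> qpath \<Rightarrow> 'k::field" where
  "path_trace s u =
    (if length u = 5 \<and> u ! 4 = u ! 0 then of_int (cyclic_value s (u ! 0) (u ! 1) (u ! 2) (u ! 3)) else 0)"

definition trace_form :: "(3 \<Rightarrow> real^2 \<Rightarrow> int) \<Rightarrow> (qpath \<Rightarrow>\<^sub>0 'k::field) \<Rightarrow> 'k" where
  "trace_form s f = (\<Sum>u\<in>Poly_Mapping.keys f. Poly_Mapping.lookup f u * path_trace s u)"

lemma trace_form_single: "trace_form s (Poly_Mapping.single u c) = c * path_trace s u"
  by (cases "c = 0") (simp_all add: trace_form_def)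

lemma trace_form_0: "trace_form s 0 = 0"
  by (simp add: trace_form_def)

lemma trace_form_eq_sum:
  assumes "finite A" "Poly_Mapping.keys f \<subseteq> A"
  shows "trace_form s f = (\<Sum>u\<in>A. Poly_Mapping.lookup f u * path_trace s u)"
  unfolding trace_form_def using assms by (intro sum.mono_neutral_left) (auto simp: in_keys_iff)

lemma trace_form_add: "trace_form s (f + g) = trace_form s f + trace_form s g"
  using keys_add[of f g]
  by (simp add: trace_form_eq_sum[of "Poly_Mapping.keys f \<union> Poly_Mapping.keys g"] lookup_add
      distrib_right sum.distrib)

lemma trace_form_minus: "trace_form s (- f) = - trace_form s f"
  using trace_form_add[of s "- f" f] by (simp add: trace_form_0 eq_neg_iff_add_eq_0)

lemma trace_form_diff: "trace_form s (f - g) = trace_form s f - trace_form s g"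
  using trace_form_add[of s "f - g" g] by simp

text \<open>Different middle vertices are opposite corners of one tile by
  \<open>corner_centers\<close>.\<close>

lemma corner_same_type:
  assumes "corner k u x y" "corner l q x y"
  shows "l = k"
proof (cases "u = q")
  case True
  then show ?thesis using assms corner_unique by blast
next
  case False
  then have "corner k q x y" using corner_centers assms corner_opposite(2) by metis
  then show ?thesis using assms(2) corner_unique by blast
qed

context rauzy_signs
begin

text \<open>Every relation combines paths x -> m -> y of length two with common ends. Between u and
  w such a path has trace 0 for every m, unless the result is closed of length four; then rotation
  brings x to the front, and the fourth vertex q is independent of m.\<close>

lemma path_trace_cases:
  assumes u: "u \<in> paths" "last u = x" and w: "w \<in> paths" "hd w = y"
  obtains "\<And>m. path_trace s (u @ m # y # tl w) = (0 :: 'k::field)"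
  | q where "{y, q} \<in> edges" "{q, x} \<in> edges"
    "\<And>m. {x, m} \<in> edges \<Longrightarrow> {m, y} \<in> edges \<Longrightarrow>
      path_trace s (u @ m # y # tl w) = (of_int (cyclic_value s x m y q) :: 'k)"
\<comment> \<open>A path of length four visits five vertices: those of u, those of w, which begin
  with y, and m.\<close>
proof (cases "length u + length w = 4")
  case False
  have "u \<noteq> []" "w \<noteq> []" using u w by (auto simp: paths_def)
  then have "length (u @ m # y # tl w) \<noteq> 5" for m using False by (cases w) auto
  then show ?thesis using that(1) by (simp add: path_trace_def)
next
  case True
  have "u \<noteq> []" "w \<noteq> []" using u w by (auto simp: paths_def)
  then have "0 < length u" "0 < length w" by auto
  with True consider "length u = 1" "length w = 3" | "length u = 2" "length w = 2"
    | "length u = 3" "length w = 1" by linarith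
  then show ?thesis
  proof cases
    case 1
    then obtain q z where uw: "u = [x]" "w = [y, q, z]"
      using u w by (auto simp: length_Suc_conv numeral_eq_Suc)
    show ?thesis
    proof (cases "z = x")
      case True
      then show ?thesis using w uw that(2)[of q] by (simp add: path_trace_def paths_3)
    next
      case False
      then show ?thesis using uw that(1) by (simp add: path_trace_def)
    qed
  next
    case 2
    then obtain q z where uw: "u = [q, x]" "w = [y, z]"
      using u w by (auto simp: length_Suc_conv numeral_eq_Suc)
    show ?thesis
    proof (cases "z = q")
      case True
      have "{q, x} \<in> edges" "{y, q} \<in> edges" using u w uw True by (simp_all add: paths_2)
      then show ?thesis using uw True that(2)[of q] cyclic_value_rotate[of q x]
        by (simp add: path_trace_def)
    next
      case False
      then show ?thesis using uw that(1) by (simp add: path_trace_def)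
    qed
  next
    case 3
    then obtain q z where uw: "u = [z, q, x]" "w = [y]"
      using u w by (auto simp: length_Suc_conv numeral_eq_Suc)
    show ?thesis
    proof (cases "z = y")
      case True
      have "{q, x} \<in> edges" "{y, q} \<in> edges" using u uw True by (simp_all add: paths_3)
      then show ?thesis using uw True that(2)[of q] cyclic_value_rotate[of q x] cyclic_value_rotate[of y q]
        by (simp add: path_trace_def)
    next
      case False
      then show ?thesis using uw that(1) by (simp add: path_trace_def)
    qed
  qed
qed

lemma trace_form_sandwich:
  assumes u: "u \<in> paths" and w: "w \<in> paths"
  shows "trace_form s (path_mult (path_mult (Poly_Mapping.single u c) (Poly_Mapping.single [x, m, y] e))
      (Poly_Mapping.single w d)) =
    (if last u = x \<and> hd w = y then c * e * d * path_trace s (u @ m # y # tl w) else 0)"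
  by (auto simp: path_mult_single path_mult_0 trace_form_single trace_form_0)

text \<open>The condition on all two-sided multiples turns the kernel of the trace form into an
  ideal, so only the generators of the Rauzy ideal have to be tested.\<close>

definition trace_radical :: "(qpath \<Rightarrow>\<^sub>0 'k::field) set" where
  "trace_radical = {f \<in> path_carrier. \<forall>g\<in>path_carrier. \<forall>h\<in>path_carrier.
     trace_form s (path_mult (path_mult g f) h) = 0}"

lemma trace_radicalI:
  assumes f: "f \<in> path_carrier"
    and *: "\<And>u w c d. u \<in> paths \<Longrightarrow> w \<in> paths \<Longrightarrow>
      trace_form s (path_mult (path_mult (Poly_Mapping.single u c) f) (Poly_Mapping.single w d)) = 0"
  shows "f \<in> trace_radical"
proof -
  have "trace_form s (path_mult (path_mult g f) h) = 0" if "g \<in> path_carrier" "h \<in> path_carrier" for g h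
    using that(1)
  proof (induction g rule: path_carrier_induct)
    case (single u c)
    from that(2) show ?case
    proof (induction h rule: path_carrier_induct)
      case (single w d)
      then show ?case using * \<open>u \<in> paths\<close> by blast
    qed (simp_all add: path_mult_0 trace_form_0 path_mult_add_right trace_form_add)
  qed (simp_all add: path_mult_0 trace_form_0 path_mult_add_left trace_form_add)
  then show ?thesis using f by (simp add: trace_radical_def)
qed

lemma trace_radical_ideal: "two_sided_ideal (trace_radical :: (qpath \<Rightarrow>\<^sub>0 'k::field) set) path_algebra"
proof -
  have "additive_subgroup (trace_radical :: (qpath \<Rightarrow>\<^sub>0 'k) set) path_algebra"
  proof (rule additive_subgroup.intro, rule path_algebra.add.subgroupI)
    show "(trace_radical :: (qpath \<Rightarrow>\<^sub>0 'k) set) \<subseteq> path_carrier" by (auto simp: trace_radical_def)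
    have "0 \<in> trace_radical" by (simp add: trace_radical_def path_carrier_closed path_mult_0 trace_form_0)
    then show "(trace_radical :: (qpath \<Rightarrow>\<^sub>0 'k) set) \<noteq> {}" by blast
    fix f :: "qpath \<Rightarrow>\<^sub>0 'k" assume f: "f \<in> trace_radical"
    then have fc: "f \<in> path_carrier" by (simp add: trace_radical_def)
    have "path_mult (path_mult g (- f)) h = 0 - path_mult (path_mult g f) h"
      if "g \<in> path_carrier" for g h
      using path_mult_minus[of g 0 f] path_mult_minus_left[of 0 "path_mult g f" h] that fc
      by (simp add: path_mult_0 path_carrier_closed)
    then have "- f \<in> trace_radical"
      using f by (auto simp: trace_radical_def path_carrier_closed trace_form_minus)
    then show "\<ominus>\<^bsub>path_algebra\<^esub> f \<in> trace_radical" using fc by (simp add: path_algebra_a_inv)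
    fix g :: "qpath \<Rightarrow>\<^sub>0 'k" assume "g \<in> trace_radical"
    then show "f \<oplus>\<^bsub>path_algebra\<^esub> g \<in> trace_radical"
      using f by (simp add: trace_radical_def path_algebra_simps(4) path_carrier_closed
          path_mult_add_left path_mult_add_right trace_form_add)
  qed
  moreover have "path_mult r f \<in> trace_radical \<and> path_mult f r \<in> trace_radical"
    if "f \<in> trace_radical" "r \<in> path_carrier" for f r :: "qpath \<Rightarrow>\<^sub>0 'k"
    using that by (auto simp: trace_radical_def path_mult_carrier simp flip: path_mult_assoc)
      (simp add: path_mult_assoc path_mult_carrier)
  ultimately show ?thesis by (simp add: two_sided_ideal_def path_algebra_simps(2))
qed

text \<open>The points x and y form no corner at m, so the sum in \<open>cyclic_value\<close> is
  empty for every fourth vertex.\<close>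

lemma relations1_radical: "relations1 \<subseteq> trace_radical"
proof
  fix f :: "qpath \<Rightarrow>\<^sub>0 'k::field" assume f: "f \<in> relations1"
  then obtain x m y where r: "f = path_elt [x, m, y]" "{x, m} \<in> edges" "{m, y} \<in> edges" "x \<noteq> y"
    and n: "\<not> (\<exists>t\<in>rauzy_tiling. {x, m} \<in> sides t \<and> {m, y} \<in> sides t)"
    by (force simp: relations1_def doubleton_eq_iff)
  have nc: "\<not> corner k m x y" for k
    using corner_sides[of k m x y] n unfolding around_tile_def by blast
  show "f \<in> trace_radical"
  proof (rule trace_radicalI)
    show "f \<in> path_carrier" using f relations_carrier by blast
    fix u w :: qpath and c d :: 'k assume uw: "u \<in> paths" "w \<in> paths"
    show "trace_form s (path_mult (path_mult (Poly_Mapping.single u c) f) (Poly_Mapping.single w d)) = 0"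
    proof (cases "last u = x \<and> hd w = y")
      case True
      then have "last u = x" "hd w = y" by auto
      from uw(1) this(1) uw(2) this(2) have "path_trace s (u @ m # y # tl w) = (0::'k)"
        by (rule path_trace_cases[where ?'k = 'k]) (simp_all add: r cyclic_value_no_corner nc)
      then show ?thesis by (simp add: r(1) trace_form_sandwich uw)
    next
      case False
      then show ?thesis by (auto simp: r(1) trace_form_sandwich uw)
    qed
  qed
qed

text \<open>For distinct x and y the value depends on a middle vertex only through the type of its
  corner, and m and n have the same type.\<close>

lemma relations2_radical: "relations2 \<subseteq> trace_radical"
proof
  fix f :: "qpath \<Rightarrow>\<^sub>0 'k::field" assume f: "f \<in> relations2"
  then obtain x m n y t where r: "f = path_elt [x, m, y] - path_elt [x, n, y]"
    and t: "t \<in> rauzy_tiling" "around_tile t x m y" "around_tile t x n y"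
    by (auto simp: relations2_def)
  obtain k where k: "corner k m x y" using around_tile_corner t by blast
  have k': "corner k n x y" using around_tile_corner t corner_same_type[OF k] by blast
  have e: "{x, m} \<in> edges" "{m, y} \<in> edges" "{x, n} \<in> edges" "{n, y} \<in> edges"
    using corner_edges[OF k] corner_edges[OF k'] by (simp_all add: insert_commute)
  have eq: "cyclic_value s x m y q = cyclic_value s x n y q" for q
  proof (cases "\<exists>l. corner l q x y")
    case True
    then have "corner k q x y" using corner_same_type[OF k] by blast
    then show ?thesis using k k' by (simp add: cyclic_value_corner)
  next
    case False
    then show ?thesis using corner_distinct[OF k] by (simp add: cyclic_value_no_corner')
  qed
  show "f \<in> trace_radical"
  proof (rule trace_radicalI)
    show "f \<in> path_carrier" using f relations_carrier by blast
    fix u w :: qpath and c d :: 'k assume uw: "u \<in> paths" "w \<in> paths"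
    show "trace_form s (path_mult (path_mult (Poly_Mapping.single u c) f) (Poly_Mapping.single w d)) = 0"
    proof (cases "last u = x \<and> hd w = y")
      case True
      then have "last u = x" "hd w = y" by auto
      from uw(1) this(1) uw(2) this(2)
      have "path_trace s (u @ m # y # tl w) = (path_trace s (u @ n # y # tl w) :: 'k)"
        by (rule path_trace_cases[where ?'k = 'k]) (simp_all add: e eq)
      then show ?thesis
        by (simp add: r path_mult_minus path_mult_minus_left path_carrier_closed paths_3 e uw
            trace_form_diff trace_form_sandwich)
    next
      case False
      then show ?thesis
        by (auto simp: r path_mult_minus path_mult_minus_left path_carrier_closed paths_3 e uw
            trace_form_diff trace_form_sandwich)
    qed
  qed
qed

lemma signed_difference_carrier: "signed_difference s a z \<in> path_carrier"
  unfolding signed_difference_eq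
  by (intro path_carrier_closed) (auto simp: paths_3 insert_commute intro!: path_carrier_closed)

text \<open>The contribution \<open>E e\<close> of an axis e is rewritten by
  \<open>cyclic_value_axis\<close> into an expression without e.\<close>

lemma relations3_radical: "relations3 s \<subseteq> trace_radical"
proof
  fix f :: "qpath \<Rightarrow>\<^sub>0 'k::field" assume f: "f \<in> relations3 s"
  then obtain a b z where r: "f = signed_difference s a z - signed_difference s b z"
    by (auto simp: relations3_def)
  show "f \<in> trace_radical"
  proof (rule trace_radicalI)
    show "f \<in> path_carrier" using f relations_carrier by blast
    fix u w :: qpath and c d :: 'k assume uw: "u \<in> paths" "w \<in> paths"
    define E :: "3 \<Rightarrow> 'k" where "E e = of_int (s e z) *
      ((if {z, z + plane_basis e} \<in> edges then path_trace s (u @ (z + plane_basis e) # z # tl w) else 0)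
      - (if {z, z - plane_basis e} \<in> edges then path_trace s (u @ (z - plane_basis e) # z # tl w) else 0))" for e
    have E: "trace_form s (path_mult (path_mult (Poly_Mapping.single u c) (signed_difference s e z))
        (Poly_Mapping.single w d)) = (if last u = z \<and> hd w = z then c * d * E e else 0)" for e
      unfolding signed_difference_eq E_def
      by (auto simp: path_mult_minus path_mult_minus_left path_carrier_closed paths_3 uw path_mult_0
          insert_commute trace_form_diff trace_form_sandwich trace_form_0 algebra_simps)
    have "E a = E b" if "last u = z" "hd w = z"
      using uw(1) that(1) uw(2) that(2)
    proof (rule path_trace_cases[where ?'k = 'k])
      assume "\<And>m. path_trace s (u @ m # z # tl w) = (0::'k)"
      then show ?thesis by (simp add: E_def)
    next
      fix q assume q: "{z, q} \<in> edges" and m: "\<And>m. {z, m} \<in> edges \<Longrightarrow> {m, z} \<in> edges \<Longrightarrow>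
        path_trace s (u @ m # z # tl w) = (of_int (cyclic_value s z m z q) :: 'k)"
      obtain g \<sigma> where g: "q = z + step g \<sigma>" using edge_steps[OF q] .
      have "E e = of_int ((\<Prod>k\<in>UNIV. s k z) * s g z * ((if \<sigma> then 1 else -1) * excess z g \<sigma>))" for e
        unfolding cyclic_value_axis[OF q[unfolded g], of e, symmetric] E_def
        using m[of "z + plane_basis e"] m[of "z - plane_basis e"]
        by (simp add: g insert_commute)
      then show ?thesis by simp
    qed
    then show "trace_form s (path_mult (path_mult (Poly_Mapping.single u c) f) (Poly_Mapping.single w d)) = 0"
      using E by (simp add: r path_mult_minus path_mult_minus_left path_carrier_closed
          signed_difference_carrier uw trace_form_diff)
  qed
qed

lemma trace_rauzy_ideal:
  assumes "f \<in> rauzy_ideal s" "g \<in> path_carrier" "h \<in> path_carrier"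
  shows "trace_form s (path_mult (path_mult g f) h) = 0"
proof -
  have "rauzy_ideal s \<subseteq> trace_radical"
    unfolding rauzy_ideal_def
    using relations1_radical relations2_radical relations3_radical
    by (intro generated_ideal_least trace_radical_ideal) auto
  then show ?thesis using assms by (auto simp: trace_radical_def)
qed

end

section \<open>The two filtrations\<close>

text \<open>The sign in \<open>tile_corner_xor\<close> selects a side of the edge, and exactly one
  of the two candidates there is a tile. The four cases are the possible choices for both
  sides.\<close>

lemma edge_two_tiles:
  assumes e: "{x, x + step a \<sigma>} \<in> edges"
  obtains k1 d1 \<tau>1 k2 d2 \<tau>2 where
    "tile_corner k1 x a \<sigma> d1 \<tau>1" "tile_corner k2 x a \<sigma> d2 \<tau>2" "(d1, \<tau>1) \<noteq> (d2, \<tau>2)"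
    "\<And>k d \<tau>. tile_corner k x a \<sigma> d \<tau> \<Longrightarrow> (d, \<tau>) = (d1, \<tau>1) \<or> (d, \<tau>) = (d2, \<tau>2)"
proof -
  obtain b c where k: "{a, b, c} = UNIV"
  proof -
    have "a \<noteq> 1 \<or> a \<noteq> 2" by auto
    then obtain b where "a \<noteq> b" by blast
    then show ?thesis using third_exists that by blast
  qed
  have k': "{a, c, b} = UNIV" using k by (simp add: insert_commute)
  have bc: "b \<noteq> c" using k UNIV_3_iff by blast
  have x1: "tile_corner c x a \<sigma> b True \<longleftrightarrow> \<not> tile_corner b x a \<sigma> c False"
    using tile_corner_xor[OF e k, of True] by simp
  have x2: "tile_corner c x a \<sigma> b False \<longleftrightarrow> \<not> tile_corner b x a \<sigma> c True"
    using tile_corner_xor[OF e k, of False] by simp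
  have only: "d = b \<and> l = c \<or> d = c \<and> l = b" if "tile_corner l x a \<sigma> d \<tau>" for l d \<tau>
  proof -
    have "d \<in> {a, b, c}" "l \<in> {a, b, c}" using k by auto
    then show ?thesis using tile_corner_distinct[OF that] by auto
  qed
  show ?thesis
  proof (cases "tile_corner c x a \<sigma> b True"; cases "tile_corner c x a \<sigma> b False")
    assume "tile_corner c x a \<sigma> b True" "tile_corner c x a \<sigma> b False"
    then show ?thesis using x1 x2 only by (intro that[of c b True c b False]) (auto, metis+)
  next
    assume "tile_corner c x a \<sigma> b True" "\<not> tile_corner c x a \<sigma> b False"
    then show ?thesis using x1 x2 only bc by (intro that[of c b True b c True]) (auto, metis+)
  next
    assume "\<not> tile_corner c x a \<sigma> b True" "tile_corner c x a \<sigma> b False"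
    then show ?thesis using x1 x2 only bc by (intro that[of b c False c b False]) (auto, metis+)
  next
    assume "\<not> tile_corner c x a \<sigma> b True" "\<not> tile_corner c x a \<sigma> b False"
    then show ?thesis using x1 x2 only by (intro that[of b c False b c True]) (auto, metis+)
  qed
qed

section \<open>The relations inside longer paths\<close>

lemma relations_in_ideal:
  "relations1 \<subseteq> rauzy_ideal s" "relations2 \<subseteq> rauzy_ideal s" "relations3 s \<subseteq> rauzy_ideal s"
  using generated_ideal_superset[of "relations1 \<union> relations2 \<union> relations3 s" path_algebra]
  unfolding rauzy_ideal_def by auto

lemma ideal_sandwich:
  assumes r: "r \<in> rauzy_ideal s" and p: "p @ [u] \<in> paths" and q: "z # q \<in> paths"
  shows "path_mult (path_mult (Poly_Mapping.single (p @ [u]) c) r) (path_elt (z # q)) \<in> rauzy_ideal s"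
  using assms by (intro rauzy_ideal_closed path_carrier_closed)

lemma relation1_in_ideal:
  assumes p: "p @ u # m # z # q \<in> paths" and uz: "u \<noteq> z" and n: "\<And>k. \<not> corner k m u z"
  shows "Poly_Mapping.single (p @ u # m # z # q) c \<in> rauzy_ideal s"
proof -
  have mem: "(p @ [u]) @ m # z # q \<in> paths" "(p @ [u, m]) @ z # q \<in> paths" using p by simp_all
  have pu: "p @ [u] \<in> paths" "z # q \<in> paths"
    using paths_appendD(1)[OF mem(1)] paths_appendD(2)[OF mem(2)] by simp_all
  have e: "{u, m} \<in> edges" "{m, z} \<in> edges"
    using p by (simp_all add: paths_def successively_append_iff)
  have "\<not> (\<exists>t\<in>rauzy_tiling. {u, m} \<in> sides t \<and> {m, z} \<in> sides t)"
    using around_tile_corner[of _ u m z] uz n unfolding around_tile_def by blast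
  moreover have "{u, m} \<noteq> {m, z}" using uz by (auto simp: doubleton_eq_iff)
  ultimately have "path_elt [u, m, z] \<in> relations1"
    using e unfolding relations1_def by blast
  then have "path_elt [u, m, z] \<in> rauzy_ideal s" using relations_in_ideal(1) by blast
  from ideal_sandwich[OF this pu, of c] show ?thesis by (simp add: path_mult_single)
qed

lemma relation2_in_ideal:
  assumes p: "p @ u # m # z # q \<in> paths" and k: "corner k m u z" "corner l n u z"
  shows "Poly_Mapping.single (p @ u # m # z # q) c - Poly_Mapping.single (p @ u # n # z # q) c \<in> rauzy_ideal s"
proof (cases "m = n")
  case True
  then show ?thesis by (simp add: rauzy_ideal_closed)
next
  case False
  have mem: "(p @ [u]) @ m # z # q \<in> paths" "(p @ [u, m]) @ z # q \<in> paths" using p by simp_all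
  have pu: "p @ [u] \<in> paths" "z # q \<in> paths"
    using paths_appendD(1)[OF mem(1)] paths_appendD(2)[OF mem(2)] by simp_all
  have "n = u + z - m" using corner_centers k False by blast
  then have "path_elt [u, m, z] - path_elt [u, n, z] \<in> relations2"
    using corner_sides[OF k(1)] unfolding relations2_def by blast
  then have "path_elt [u, m, z] - path_elt [u, n, z] \<in> rauzy_ideal s" using relations_in_ideal(2) by blast
  from ideal_sandwich[OF this pu, of c] show ?thesis
    using pu corner_edges[OF k(1)] corner_edges[OF k(2)]
    by (simp add: path_mult_single path_mult_minus path_mult_minus_left path_carrier_closed paths_3
        insert_commute)
qed

context rauzy_signs
begin

text \<open>Relation (3) at y is multiplied by the arrow x -> y from the left. The loop straight
  ahead vanishes by relation (1), as do the loops along d that span no tile with the edge. The loop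
  back to x carries a minus sign if x lies at \<open>y - plane_basis a\<close>.\<close>

lemma relation3_in_ideal:
  assumes e: "{x, y} \<in> edges" and y: "y = x + step a \<sigma>" and k: "{a, d, k} = UNIV"
  shows "Poly_Mapping.single [x, y, x, y] ((if \<sigma> then -1 else 1) * of_int (s a y)) -
    (Poly_Mapping.single [x, y, y + step d True, y] (of_int (s d y) * of_bool (tile_corner k x a \<sigma> d True))
      - Poly_Mapping.single [x, y, y + step d False, y] (of_int (s d y) * of_bool (tile_corner k x a \<sigma> d False)))
    \<in> rauzy_ideal s"
proof -
  define T :: "3 \<Rightarrow> bool \<Rightarrow> qpath \<Rightarrow>\<^sub>0 'a" where "T b \<rho> = (if {y, y + step b \<rho>} \<in> edges
    then Poly_Mapping.single [x, y, y + step b \<rho>, y] (of_int (s b y)) else 0)" for b \<rho>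
  have v: "y \<in> vertices" using edge_vertices[OF e] ..
  have e': "{y, x} \<in> edges" using e by (simp add: insert_commute)
  have yx: "y + step a (\<not> \<sigma>) = x" by (simp add: y step_minus)
  have R: "path_mult (path_elt [x, y]) (signed_difference s b y) = T b True - T b False" for b
    unfolding signed_difference_eq T_def using e e'
    by (subst path_mult_minus)
      (auto simp: path_mult_single path_mult_0 step_def path_carrier_closed paths_2 paths_3 insert_commute)
  have "signed_difference s a y - signed_difference s d y \<in> (rauzy_ideal s :: (qpath \<Rightarrow>\<^sub>0 'a) set)"
    using v relations_in_ideal(3) unfolding relations3_def by blast
  then have "path_mult (path_elt [x, y]) (signed_difference s a y - signed_difference s d y)
      \<in> (rauzy_ideal s :: (qpath \<Rightarrow>\<^sub>0 'a) set)"
    using e by (intro rauzy_ideal_closed path_carrier_closed) (simp_all add: paths_2)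
  then have 0: "(T a True - T a False) - (T d True - T d False) \<in> rauzy_ideal s"
    using e by (simp add: path_mult_minus path_carrier_closed paths_2 signed_difference_carrier R)
  have "y + step a \<sigma> \<noteq> x" using step_sum_zero_iff[of a \<sigma> a \<sigma>] by (auto simp: y add.assoc)
  moreover have "\<not> corner l y x (y + step a \<sigma>)" for l
    using corner_step[of l y a "\<not> \<sigma>" a \<sigma>] tile_corner_distinct unfolding yx by blast
  ultimately have straight: "T a \<sigma> \<in> rauzy_ideal s"
    using relation1_in_ideal[of "[]" x y "y + step a \<sigma>" "[y]" "of_int (s a y)"] e v
    by (auto simp: T_def rauzy_ideal_closed paths_Cons insert_commute edge_vertices)
  have "T a (\<not> \<sigma>) = Poly_Mapping.single [x, y, x, y] (of_int (s a y))"
    using e' by (simp add: T_def yx)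
  then have A: "(T a True - T a False) -
      Poly_Mapping.single [x, y, x, y] ((if \<sigma> then -1 else 1) * of_int (s a y)) \<in> rauzy_ideal s"
    using straight rauzy_ideal_closed(3)[OF straight] by (cases \<sigma>) (simp_all add: single_uminus)
  have D: "T d \<rho> - Poly_Mapping.single [x, y, y + step d \<rho>, y]
      (of_int (s d y) * of_bool (tile_corner k x a \<sigma> d \<rho>)) \<in> rauzy_ideal s" for \<rho>
  proof (cases "tile_corner k x a \<sigma> d \<rho>")
    case True
    then have "tile_corner k y a (\<not> \<sigma>) d \<rho>" by (simp add: y tile_corner_move)
    then have "{y, y + step d \<rho>} \<in> edges" by (rule tile_corner_edge)
    then show ?thesis using True by (simp add: T_def rauzy_ideal_closed)
  next
    case False
    have "\<not> corner l y x (y + step d \<rho>)" for l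
    proof
      assume "corner l y x (y + step d \<rho>)"
      then have "tile_corner l x a \<sigma> d \<rho>"
        using corner_step[of l y a "\<not> \<sigma>" d \<rho>] unfolding yx by (simp add: y tile_corner_move)
      moreover from this have "l = k" using k third_unique unfolding tile_corner_def by blast
      ultimately show False using False by simp
    qed
    moreover have "x \<noteq> y + step d \<rho>"
      using k step_eq_iff[of a "\<not> \<sigma>" d \<rho>] UNIV_3_iff[of a d k] unfolding yx[symmetric] by auto
    ultimately show ?thesis
      using relation1_in_ideal[of "[]" x y "y + step d \<rho>" "[y]" "of_int (s d y)"] e v False
      by (auto simp: T_def rauzy_ideal_closed paths_Cons insert_commute edge_vertices)
  qed
  have "0 - A' + D1 - D2 + S \<in> rauzy_ideal s"
    if "A' \<in> rauzy_ideal s" "D1 \<in> rauzy_ideal s" "D2 \<in> rauzy_ideal s" "S \<in> rauzy_ideal s"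
    for A' D1 D2 S :: "qpath \<Rightarrow>\<^sub>0 'a"
    using that by (intro rauzy_ideal_closed rauzy_ideal_diff)
  from this[OF A D[of True] D[of False] 0] show ?thesis by (simp add: algebra_simps)
qed

end

section \<open>The two tiles at an edge\<close>

locale edge_tiles = rauzy_signs +
  fixes x y v1 w1 v2 w2 :: "real^2" and a d1 d2 k1 k2 :: 3 and \<sigma> \<tau>1 \<tau>2 :: bool
  assumes tile1: "tile_corner k1 x a \<sigma> d1 \<tau>1" and tile2: "tile_corner k2 x a \<sigma> d2 \<tau>2"
    and distinct: "(d1, \<tau>1) \<noteq> (d2, \<tau>2)"
    and only: "\<And>k d \<tau>. tile_corner k x a \<sigma> d \<tau> \<Longrightarrow> (d, \<tau>) = (d1, \<tau>1) \<or> (d, \<tau>) = (d2, \<tau>2)"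
    and y: "y = x + step a \<sigma>" and v1: "v1 = x + step d1 \<tau>1" and v2: "v2 = x + step d2 \<tau>2"
    and w1: "w1 = y + step d1 \<tau>1" and w2: "w2 = y + step d2 \<tau>2"
begin

text \<open>This symmetry transfers every fact about one tile to the other and yields the second
  filtration.\<close>

lemma swapped: "edge_tiles s x y v2 w2 v1 w1 a d2 d1 k2 k1 \<sigma> \<tau>2 \<tau>1"
  using tile1 tile2 distinct only y v1 v2 w1 w2 by unfold_locales blast+

lemma corners1: "corner k1 x y v1" "corner k1 y x w1" "corner k1 v1 x w1" "corner k1 w1 y v1"
proof -
  show 1: "corner k1 x y v1" using tile1 by (simp add: y v1 corner_step)
  have w: "w1 = y + v1 - x" and w': "w1 = v1 + y - x" by (simp_all add: y v1 w1)
  show "corner k1 y x w1" "corner k1 w1 y v1" unfolding w by (rule corner_opposite[OF 1])+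
  have "corner k1 x v1 y" using 1 corner_sym by blast
  then show "corner k1 v1 x w1" unfolding w' by (rule corner_opposite)
qed

lemma corners2: "corner k2 x y v2" "corner k2 y x w2" "corner k2 v2 x w2" "corner k2 w2 y v2"
  by (rule edge_tiles.corners1[OF swapped])+

lemma neighbour_edges:
  "{x, y} \<in> edges" "{y, x} \<in> edges" "{y, w1} \<in> edges" "{y, w2} \<in> edges" "{w2, y} \<in> edges"
  "{x, v1} \<in> edges" "{x, v2} \<in> edges" "{v2, x} \<in> edges" "{v2, w2} \<in> edges" "{w2, v2} \<in> edges"
  "{w1, v1} \<in> edges" "{w1, y} \<in> edges" "{v1, x} \<in> edges"
  using corner_edges[OF corners1(1)] corner_edges[OF corners1(2)] corner_edges[OF corners1(4)]
    corner_edges[OF corners2(1)] corner_edges[OF corners2(2)] corner_edges[OF corners2(4)]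
  by (simp_all add: insert_commute)

lemma points_distinct: "w1 \<noteq> w2" "v1 \<noteq> v2"
  using distinct by (auto simp: w1 w2 v1 v2 step_eq_iff)

lemma corner_at_x: "corner k x y n \<Longrightarrow> n = v1 \<or> n = v2"
  unfolding corner_def y v1 v2 by (auto simp: step_eq_iff dest: only)

lemma corner_at_y:
  assumes "corner k y x n"
  shows "n = w1 \<or> n = w2"
proof -
  obtain b \<rho> c \<pi> where t: "tile_corner k y b \<rho> c \<pi>" and x: "x = y + step b \<rho>" and n: "n = y + step c \<pi>"
    using assms unfolding corner_def by blast
  have "step a \<sigma> + step b \<rho> = 0" using x by (simp add: y)
  then have "b = a" "\<rho> = (\<not> \<sigma>)" by (simp_all add: step_sum_zero_iff)
  then have "tile_corner k x a \<sigma> c \<pi>" using t by (simp add: y tile_corner_move)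
  then show ?thesis using only n w1 w2 by blast
qed

text \<open>Steps along the two other axes with opposite signs point to the same side of the edge,
  where \<open>tile_corner_xor\<close> allows only one tile.\<close>

lemma same_orientation:
  assumes "d1 \<noteq> d2"
  shows "\<tau>1 = \<tau>2" "k1 = d2"
proof -
  have k: "{a, d1, k1} = UNIV" "{a, d2, k2} = UNIV" using tile1 tile2 by (simp_all add: tile_corner_def)
  have "d2 \<in> {a, d1, k1}" "d1 \<in> {a, d2, k2}" using k by auto
  then have *: "d2 = k1" "d1 = k2" using assms k UNIV_3_iff by blast+
  have e: "{x, x + step a \<sigma>} \<in> edges" using neighbour_edges(1) by (simp add: y)
  show "\<tau>1 = \<tau>2"
    using tile_corner_xor[OF e k(1), of \<tau>1] tile1 tile2 * by (cases \<tau>1; cases \<tau>2) auto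
  show "k1 = d2" using * by simp
qed

text \<open>Otherwise \<open>x\<close> and \<open>y\<close> would both have three tiles around them, all with angles of 120 degrees;
  but the angles at \<open>x\<close> and \<open>y\<close> of a tile with side \<open>{x, y}\<close> add up to 180 degrees.\<close>

lemma no_corner_x_or_y: "(\<forall>k. \<not> corner k x v2 v1) \<or> (\<forall>k. \<not> corner k y w2 w1)"
proof (cases "d1 = d2")
  case True
  then have "\<not> corner k x v2 v1" for k
    using tile_corner_distinct unfolding v1 v2 corner_step by blast
  then show ?thesis by blast
next
  case False
  note o = same_orientation[OF False]
  have "{a, d1, d2} = UNIV" using tile1 o(2) by (simp add: tile_corner_def)
  then have k: "{d1, a, d2} = UNIV" by (simp add: insert_commute)
  show ?thesis
  proof (cases "\<sigma> = \<tau>1")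
    case True
    have e: "{y, y + step d1 \<tau>1} \<in> edges" using neighbour_edges(3) by (simp add: w1)
    have "tile_corner d2 y d1 \<tau>1 a (\<not> \<tau>1)"
      using tile1 o(2) True tile_corner_move tile_corner_swap unfolding y by blast
    then have "\<not> tile_corner a y d1 \<tau>1 d2 \<tau>1"
      using tile_corner_xor[OF e k, of "\<not> \<tau>1"] by simp
    moreover have "k = a" if "tile_corner k y d1 \<tau>1 d2 \<tau>1" for k
      using that k third_unique[of d1 d2 k a] by (simp add: tile_corner_def insert_commute)
    ultimately have "\<not> tile_corner k y d2 \<tau>2 d1 \<tau>1" for k
      using o(1) tile_corner_swap by blast
    then have "\<not> corner k y w2 w1" for k unfolding w1 w2 corner_step .
    then show ?thesis by blast
  next
    case f: False
    have e: "{x, x + step d1 \<tau>1} \<in> edges" using neighbour_edges(6) by (simp add: v1)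
    have "tile_corner d2 x d1 \<tau>1 a (\<not> \<tau>1)"
      using tile1 o(2) f tile_corner_swap by (cases \<sigma>; cases \<tau>1) auto
    then have "\<not> tile_corner a x d1 \<tau>1 d2 \<tau>1"
      using tile_corner_xor[OF e k, of "\<not> \<tau>1"] by simp
    moreover have "k = a" if "tile_corner k x d1 \<tau>1 d2 \<tau>1" for k
      using that k third_unique[of d1 d2 k a] by (simp add: tile_corner_def insert_commute)
    ultimately have "\<not> tile_corner k x d2 \<tau>2 d1 \<tau>1" for k
      using o(1) tile_corner_swap by blast
    then have "\<not> corner k x v2 v1" for k unfolding v1 v2 corner_step .
    then show ?thesis by blast
  qed
qed

text \<open>The preimage in the path algebra of the right ideal generated by \<open>x \<rightarrow> y \<rightarrow> w1\<close>.\<close>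

definition lower :: "(qpath \<Rightarrow>\<^sub>0 'k::field) set" where
  "lower = {f \<in> path_carrier. \<exists>g\<in>path_carrier. f - path_mult (path_elt [x, y, w1]) g \<in> rauzy_ideal s}"

section \<open>Closure properties of the lower submodule\<close>

lemma p1_path: "[x, y, w1] \<in> paths"
  using neighbour_edges by (simp add: paths_3)

lemma generators_carrier:
  "Poly_Mapping.single [x] c \<in> path_carrier" "Poly_Mapping.single [w1] c \<in> path_carrier"
  "Poly_Mapping.single [x, y] c \<in> path_carrier" "Poly_Mapping.single [x, y, w1] c \<in> path_carrier"
  "Poly_Mapping.single [x, y, w2] c \<in> path_carrier" "Poly_Mapping.single [v2, x] c \<in> path_carrier"
  "Poly_Mapping.single [x, y, x] c \<in> path_carrier" "Poly_Mapping.single [x, y, w2, v2] c \<in> path_carrier"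
  using neighbour_edges edge_vertices by (auto intro!: path_carrier_closed simp: paths_Cons)

lemma lower_carrier: "f \<in> lower \<Longrightarrow> f \<in> path_carrier"
  by (simp add: lower_def)

lemma ideal_lower: "f \<in> rauzy_ideal s \<Longrightarrow> f \<in> lower"
  unfolding lower_def using rauzy_ideal_carrier path_carrier_closed(1) by (force simp: path_mult_0)

lemma lower_add:
  assumes "f \<in> lower" "f' \<in> lower"
  shows "f + f' \<in> lower"
proof -
  obtain g g' where *: "g \<in> path_carrier" "f - path_mult (path_elt [x, y, w1]) g \<in> rauzy_ideal s"
    "g' \<in> path_carrier" "f' - path_mult (path_elt [x, y, w1]) g' \<in> rauzy_ideal s"
    using assms unfolding lower_def by blast
  have "f + f' - path_mult (path_elt [x, y, w1]) (g + g') \<in> rauzy_ideal s"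
    using rauzy_ideal_closed(2)[OF *(2,4)] by (simp add: path_mult_add_right algebra_simps)
  then show ?thesis using assms * path_carrier_closed(2) unfolding lower_def by blast
qed

lemma lower_right:
  assumes "f \<in> lower" "h \<in> path_carrier"
  shows "path_mult f h \<in> lower"
proof -
  obtain g where *: "g \<in> path_carrier" "f - path_mult (path_elt [x, y, w1]) g \<in> rauzy_ideal s"
    using assms unfolding lower_def by blast
  have "path_mult f h - path_mult (path_elt [x, y, w1]) (path_mult g h) \<in> rauzy_ideal s"
    using rauzy_ideal_closed(4)[OF *(2) assms(2)] * assms(2) p1_path
    by (simp add: path_mult_minus_left path_mult_assoc path_carrier_closed)
  then show ?thesis using assms * path_mult_carrier lower_carrier unfolding lower_def by blast
qed

text \<open>A multiple of the idempotent at x can be moved through the path to its other end w1; so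
  scalars act on \<open>lower\<close>.\<close>

lemma lower_scale:
  assumes "f \<in> lower"
  shows "path_mult (Poly_Mapping.single [x] c) f \<in> lower"
proof -
  obtain g where g: "g \<in> path_carrier" "f - path_mult (path_elt [x, y, w1]) g \<in> rauzy_ideal s"
    using assms unfolding lower_def by blast
  have "path_mult (Poly_Mapping.single [x] c) (path_mult (path_elt [x, y, w1]) g)
      = path_mult (path_elt [x, y, w1]) (path_mult (Poly_Mapping.single [w1] c) g)"
    using g(1) by (simp add: generators_carrier path_mult_assoc[symmetric] path_mult_single)
  then have "path_mult (Poly_Mapping.single [x] c) f
      - path_mult (path_elt [x, y, w1]) (path_mult (Poly_Mapping.single [w1] c) g) \<in> rauzy_ideal s"
    using rauzy_ideal_closed(5)[OF g(2) generators_carrier(1)[of c]] g(1) lower_carrier[OF assms]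
    by (simp add: generators_carrier path_mult_minus path_mult_carrier)
  moreover have "path_mult (Poly_Mapping.single [w1] c) g \<in> path_carrier"
    using g(1) by (simp add: generators_carrier path_mult_carrier)
  moreover have "path_mult (Poly_Mapping.single [x] c) f \<in> path_carrier"
    using lower_carrier[OF assms] by (simp add: generators_carrier path_mult_carrier)
  ultimately show ?thesis unfolding lower_def by blast
qed

lemma lower_uminus:
  assumes "f \<in> lower"
  shows "- f \<in> lower"
proof -
  obtain g where g: "g \<in> path_carrier" "f - path_mult (path_elt [x, y, w1]) g \<in> rauzy_ideal s"
    using assms unfolding lower_def by blast
  have "- f - path_mult (path_elt [x, y, w1]) (- g) \<in> rauzy_ideal s"
    using rauzy_ideal_closed(3)[OF g(2)] path_mult_minus[of "path_elt [x, y, w1]" 0 g] g(1) p1_path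
    by (simp add: path_carrier_closed path_mult_0)
  then show ?thesis using assms g(1) path_carrier_closed(3) unfolding lower_def by blast
qed

lemma lower_cong: "f - g \<in> rauzy_ideal s \<Longrightarrow> g \<in> lower \<Longrightarrow> f \<in> lower"
  using lower_add[of "f - g" g] ideal_lower[of "f - g"] by simp

lemma lower_cong': "f - g \<in> rauzy_ideal s \<Longrightarrow> f \<in> lower \<Longrightarrow> g \<in> lower"
  using lower_cong[of g f] rauzy_ideal_closed(3)[of "f - g"] by simp

lemma lower_single:
  fixes c e :: "'k::field"
  assumes "Poly_Mapping.single (x # u) e \<in> lower" "e \<noteq> 0"
  shows "Poly_Mapping.single (x # u) c \<in> lower"
  using lower_scale[OF assms(1), of "c / e"] assms(2) by (simp add: path_mult_single)

lemma lower_append: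
  assumes "Poly_Mapping.single (x # u) e \<in> lower" "last (x # u) # q \<in> paths"
  shows "Poly_Mapping.single (x # u @ q) e \<in> lower"
  using lower_right[OF assms(1), of "path_elt (last (x # u) # q)"] assms(2)
  by (simp add: path_mult_single path_carrier_closed split: if_splits)

lemma p1_lower: "Poly_Mapping.single [x, y, w1] c \<in> lower"
proof (rule lower_single)
  have "path_elt [w1] \<in> path_carrier"
    using neighbour_edges edge_vertices by (auto intro!: path_carrier_closed simp: paths_Cons)
  then show "path_elt [x, y, w1] \<in> lower"
    unfolding lower_def using p1_path
    by (auto intro!: bexI[of _ "path_elt [w1]"] simp: path_mult_single rauzy_ideal_closed path_carrier_closed)
qed simp

lemma sign_nonzero: "(of_int (s c y) :: 'k::field) \<noteq> 0"
proof -
  have "y \<in> vertices" using neighbour_edges edge_vertices by blast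
  then have "(of_int (s c y) :: 'k) * of_int (s c y) = 1"
    using sign_square[of y c] by (metis of_int_1 of_int_mult)
  then show ?thesis by auto
qed

text \<open>Relation (3) at y is applied for both axes other than a. If the tiles use different
  axes, one axis involves only w1 and puts x -> y -> x -> y into \<open>lower\<close>, and the other
  then does the same for the loop at w2. If they share an axis, the third axis meets no tile, so x
  -> y -> x -> y vanishes in the algebra, and the shared axis ties the loop at w2 to the loop at
  w1.\<close>

lemma loops_lower:
  "Poly_Mapping.single [x, y, x, y] (c :: 'k::field) \<in> lower"
  "Poly_Mapping.single [x, y, w2, y] (c :: 'k) \<in> lower"
proof -
  let ?L = "lower :: (qpath \<Rightarrow>\<^sub>0 'k) set"
  define e0 :: 'k where "e0 = (if \<sigma> then -1 else 1) * of_int (s a y)"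
  have e0: "e0 \<noteq> 0" using sign_nonzero[of a] by (simp add: e0_def)
  define t :: "3 \<Rightarrow> 3 \<Rightarrow> bool \<Rightarrow> qpath \<Rightarrow>\<^sub>0 'k" where "t k d \<rho> =
    Poly_Mapping.single [x, y, y + step d \<rho>, y] (of_int (s d y) * of_bool (tile_corner k x a \<sigma> d \<rho>))" for k d \<rho>
  have rel: "Poly_Mapping.single [x, y, x, y] e0 - (t k d True - t k d False) \<in> rauzy_ideal s"
    if "{a, d, k} = UNIV" for d k
    using relation3_in_ideal[OF neighbour_edges(1) y that] unfolding e0_def t_def .
  have k1: "{a, d1, k1} = UNIV" and k2: "{a, d2, k2} = UNIV"
    using tile1 tile2 by (simp_all add: tile_corner_def)
  have wl: "Poly_Mapping.single [x, y, w1, y] c \<in> ?L" for c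
    using lower_append[OF p1_lower, of "[y]"] neighbour_edges by (simp add: paths_2)
  have t1: "t k1 d1 \<tau>1 = Poly_Mapping.single [x, y, w1, y] (of_int (s d1 y))"
    using tile1 by (simp add: t_def w1)
  have t2: "t k2 d2 \<tau>2 = Poly_Mapping.single [x, y, w2, y] (of_int (s d2 y))"
    using tile2 by (simp add: t_def w2)
  have t0: "t k d \<rho> = 0" if "(d, \<rho>) \<noteq> (d1, \<tau>1)" "(d, \<rho>) \<noteq> (d2, \<tau>2)" for k d \<rho>
    using only[of k d \<rho>] that by (auto simp: t_def)
  have "Poly_Mapping.single [x, y, x, y] e0 \<in> ?L \<and> t k2 d2 \<tau>2 \<in> ?L"
  proof (cases "d1 = d2")
    case False
    have "t k1 d1 (\<not> \<tau>1) = 0" "t k2 d2 (\<not> \<tau>2) = 0" using t0 False by auto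
    then have d: "t k1 d1 True - t k1 d1 False = (if \<tau>1 then t k1 d1 \<tau>1 else - t k1 d1 \<tau>1)"
      "t k2 d2 True - t k2 d2 False = (if \<tau>2 then t k2 d2 \<tau>2 else - t k2 d2 \<tau>2)"
      by (cases \<tau>1; cases \<tau>2; simp)+
    have "t k1 d1 True - t k1 d1 False \<in> ?L" unfolding d t1 using wl lower_uminus by auto
    then have xy: "Poly_Mapping.single [x, y, x, y] e0 \<in> ?L" using lower_cong[OF rel[OF k1]] by blast
    then have "t k2 d2 True - t k2 d2 False \<in> ?L" using lower_cong'[OF rel[OF k2]] by blast
    then have "t k2 d2 \<tau>2 \<in> ?L"
      unfolding d using lower_uminus[of "- t k2 d2 \<tau>2"] by (simp split: if_splits)
    with xy show ?thesis by blast
  next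
    case True
    then have \<tau>: "\<tau>2 = (\<not> \<tau>1)" using distinct by auto
    have kk: "k2 = k1" using k1 k2 True third_unique by blast
    have k1': "{a, k1, d1} = UNIV" using k1 by (simp add: insert_commute)
    have ne: "k1 \<noteq> d1" using k1 UNIV_3_iff by blast
    have "t d1 k1 \<rho> = 0" for \<rho> using t0[of k1 \<rho> d1] ne True by auto
    then have xy: "Poly_Mapping.single [x, y, x, y] e0 \<in> ?L"
      using rel[OF k1'] by (intro ideal_lower) simp
    then have "t k1 d1 True - t k1 d1 False \<in> ?L" using lower_cong'[OF rel[OF k1]] by blast
    then have diff: "t k1 d1 \<tau>1 - t k2 d2 \<tau>2 \<in> ?L"
      using lower_uminus[of "t k1 d1 True - t k1 d1 False"] by (cases \<tau>1) (simp_all add: \<tau> kk True)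
    have "- (t k1 d1 \<tau>1 - t k2 d2 \<tau>2) + t k1 d1 \<tau>1 \<in> ?L"
      using lower_add[OF lower_uminus[OF diff]] wl unfolding t1 by blast
    with xy show ?thesis by simp
  qed
  then show "Poly_Mapping.single [x, y, x, y] c \<in> ?L" "Poly_Mapping.single [x, y, w2, y] c \<in> ?L"
    unfolding t2 using lower_single e0 sign_nonzero by blast+
qed

text \<open>If a tile has the corner y, w2, n, relation (2) replaces w2 by its opposite vertex q.
  For q = w1 the path begins with the generator; q = x forces n = v1, and the first tile leads to w1
  again; for any other q the path x -> y -> q vanishes.\<close>

lemma lower_w2:
  assumes n: "{w2, n} \<in> edges" "n \<noteq> v2"
  shows "Poly_Mapping.single [x, y, w2, n] c \<in> lower"
proof -
  have p: "[x, y, w2, n] \<in> paths" using neighbour_edges n edge_vertices by (auto simp: paths_Cons)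
  consider "n = y" | "n \<noteq> y" "\<And>k. \<not> corner k w2 y n" | k where "n \<noteq> y" "corner k w2 y n" by blast
  then show ?thesis
  proof cases
    case 1
    then show ?thesis using loops_lower by simp
  next
    case 2
    then show ?thesis using relation1_in_ideal[of "[x]" y w2 n "[]" c] p by (intro ideal_lower) simp
  next
    case 3
    define q where "q = y + n - w2"
    have q: "corner k q y n" using corner_opposite(2)[OF 3(2)] by (simp add: q_def)
    have pq: "[x, y, q, n] \<in> paths"
      using corner_edges[OF q] neighbour_edges edge_vertices by (auto simp: paths_Cons insert_commute)
    have "Poly_Mapping.single [x, y, q, n] c \<in> lower"
    proof (cases "q = x")
      case True
      then have "n = v1" using corner_at_x q n(2) by blast
      have "Poly_Mapping.single [x, y, w1, v1] c \<in> lower"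
        using lower_append[OF p1_lower, of "[v1]"] neighbour_edges by (simp add: paths_2)
      moreover have "Poly_Mapping.single [x, y, x, v1] c - Poly_Mapping.single [x, y, w1, v1] c \<in> rauzy_ideal s"
        using relation2_in_ideal[of "[x]" y x v1 "[]" k1 k1 w1 c s] corners1 pq True \<open>n = v1\<close> by simp
      ultimately show ?thesis using True \<open>n = v1\<close> lower_cong by blast
    next
      case False
      show ?thesis
      proof (cases "\<exists>l. corner l y x q")
        case True
        moreover have "q \<noteq> w2"
          using corner_distinct[OF corner_opposite(1)[OF 3(2)]] by (metis q_def)
        ultimately have "q = w1" using corner_at_y by blast
        then show ?thesis using lower_append[OF p1_lower, of "[n]"] pq by (simp add: paths_Cons)
      next
        case f: False
        then show ?thesis using relation1_in_ideal[of "[]" x y q "[n]" c] pq False by (intro ideal_lower) simp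
      qed
    qed
    then show ?thesis
      using relation2_in_ideal[of "[x]" y w2 n "[]" k k q c s] 3(2) q p lower_cong by simp
  qed
qed

text \<open>The path to v2 represents the socle of the upper rhombus module, so every further arrow
  has to lead into \<open>lower\<close>. Turning back to w2 amounts to x -> y -> x -> y -> w2; at a
  corner, passing to the opposite vertex reduces to \<open>lower_w2\<close>.\<close>

lemma lower_v2:
  assumes n: "{v2, n} \<in> edges"
  shows "Poly_Mapping.single [x, y, w2, v2, n] c \<in> lower"
proof -
  have p: "[x, y, w2, v2, n] \<in> paths" using neighbour_edges n edge_vertices by (auto simp: paths_Cons)
  consider "n = w2" | "n \<noteq> w2" "\<And>k. \<not> corner k v2 w2 n" | k where "n \<noteq> w2" "corner k v2 w2 n" by blast
  then show ?thesis
  proof cases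
    case 1
    have ps: "[x, y, w2, v2, w2] \<in> paths" "[x, y, x, v2, w2] \<in> paths"
      using p 1 neighbour_edges edge_vertices by (auto simp: paths_Cons)
    have "Poly_Mapping.single [x, y, w2, v2, w2] c - Poly_Mapping.single [x, y, x, v2, w2] c \<in> rauzy_ideal s"
      using relation2_in_ideal[of "[x]" y w2 v2 "[w2]" k2 k2 x c s] corners2 ps by simp
    moreover have "Poly_Mapping.single [x, y, x, v2, w2] c - Poly_Mapping.single [x, y, x, y, w2] c \<in> rauzy_ideal s"
      using relation2_in_ideal[of "[x, y]" x v2 w2 "[]" k2 k2 y c s] corners2 ps by simp
    moreover have "Poly_Mapping.single [x, y, x, y, w2] c \<in> lower"
      using lower_append[OF loops_lower(1), of "[w2]"] neighbour_edges by (simp add: paths_2)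
    ultimately show ?thesis using 1 lower_cong by blast
  next
    case 2
    then show ?thesis using relation1_in_ideal[of "[x, y]" w2 v2 n "[]" c] p by (intro ideal_lower) simp
  next
    case 3
    define r where "r = w2 + n - v2"
    have r: "corner k r w2 n" using corner_opposite(2)[OF 3(2)] by (simp add: r_def)
    have "r \<noteq> v2"
      using corner_distinct[OF corner_opposite(1)[OF 3(2)]] by (metis r_def)
    then have "Poly_Mapping.single [x, y, w2, r] c \<in> lower"
      using corner_edges[OF r] by (intro lower_w2) (simp_all add: insert_commute)
    then have "Poly_Mapping.single [x, y, w2, r, n] c \<in> lower"
      using lower_append[of "[y, w2, r]" c "[n]"] corner_edges[OF r] by (simp add: paths_2)
    then show ?thesis
      using relation2_in_ideal[of "[x, y]" w2 v2 n "[]" k k r c s] 3(2) r p lower_cong by simp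
  qed
qed

text \<open>Multiplied by v2 -> x from the left, these paths represent a basis of the upper rhombus
  module: the top at y, the middle at x and w2, the socle at v2.\<close>

definition four_paths :: "'k \<Rightarrow> 'k \<Rightarrow> 'k \<Rightarrow> 'k \<Rightarrow> (qpath \<Rightarrow>\<^sub>0 'k::field)" where
  "four_paths c0 c1 c2 c3 = Poly_Mapping.single [x, y] c0 + Poly_Mapping.single [x, y, x] c1
     + Poly_Mapping.single [x, y, w2] c2 + Poly_Mapping.single [x, y, w2, v2] c3"

definition spanned :: "(qpath \<Rightarrow>\<^sub>0 'k::field) set" where
  "spanned = {f. \<exists>c0 c1 c2 c3. f - four_paths c0 c1 c2 c3 \<in> lower}"

lemma spanned_add:
  assumes "f \<in> spanned" "g \<in> spanned"
  shows "f + g \<in> spanned"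
proof -
  obtain c0 c1 c2 c3 e0 e1 e2 e3 where
    *: "f - four_paths c0 c1 c2 c3 \<in> lower" "g - four_paths e0 e1 e2 e3 \<in> lower"
    using assms unfolding spanned_def by blast
  have "f + g - four_paths (c0 + e0) (c1 + e1) (c2 + e2) (c3 + e3) \<in> lower"
    using lower_add[OF *] by (simp add: four_paths_def single_add algebra_simps)
  then show ?thesis unfolding spanned_def by blast
qed

lemma lower_spanned: "f \<in> lower \<Longrightarrow> f \<in> spanned"
  unfolding spanned_def four_paths_def
  by (rule CollectI, rule exI[of _ 0], rule exI[of _ 0], rule exI[of _ 0], rule exI[of _ 0]) simp

lemma zero_lower: "0 \<in> lower"
  by (simp add: ideal_lower rauzy_ideal_closed)

lemma four_spanned: "four_paths c0 c1 c2 c3 \<in> spanned"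
  unfolding spanned_def
  by (rule CollectI, rule exI[of _ c0], rule exI[of _ c1], rule exI[of _ c2], rule exI[of _ c3])
    (simp add: zero_lower)

lemma spanned_cong: "f - g \<in> rauzy_ideal s \<Longrightarrow> g \<in> spanned \<Longrightarrow> f \<in> spanned"
  using spanned_add[OF lower_spanned[OF ideal_lower], of "f - g" g] by simp

lemma basis_spanned:
  "Poly_Mapping.single [x, y] c \<in> spanned" "Poly_Mapping.single [x, y, x] c \<in> spanned"
  "Poly_Mapping.single [x, y, w2] c \<in> spanned" "Poly_Mapping.single [x, y, w2, v2] c \<in> spanned"
  using four_spanned[of c 0 0 0] four_spanned[of 0 c 0 0] four_spanned[of 0 0 c 0] four_spanned[of 0 0 0 c]
  by (simp_all add: four_paths_def)

text \<open>An arrow leads out of \<open>lower\<close> only along the second tile, and there x -> y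
  -> x -> v2 equals x -> y -> w2 -> v2 by relation (2). Induction on the length then spans all of
  bA.\<close>

lemma spanned_arrow:
  assumes f: "f \<in> spanned" and e: "{m, n} \<in> edges"
  shows "path_mult f (path_elt [m, n]) \<in> spanned"
proof -
  obtain c0 c1 c2 c3 where l: "f - four_paths c0 c1 c2 c3 \<in> lower"
    using f unfolding spanned_def by blast
  have "path_elt [m, n] \<in> path_carrier" using e by (simp add: path_carrier_closed paths_2)
  from lower_right[OF l this]
  have "path_mult (f - four_paths c0 c1 c2 c3) (path_elt [m, n]) \<in> spanned" by (rule lower_spanned)
  moreover have "path_mult (four_paths c0 c1 c2 c3) (path_elt [m, n]) \<in> spanned"
  proof -
    have 0: "0 \<in> spanned" using zero_lower by (rule lower_spanned)
    have ev: "{n, m} \<in> edges" "n \<in> vertices" "m \<in> vertices"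
      using e edge_vertices by (auto simp: insert_commute)
    have "Poly_Mapping.single [x, y, n] c \<in> spanned" if "m = y" for c
    proof -
      have p: "[x, y, n] \<in> paths" using that e neighbour_edges by (simp add: paths_3)
      consider "n = x" | "n = w1" | "n = w2" | "n \<noteq> x" "\<And>k. \<not> corner k y x n"
        using corner_at_y by blast
      then show ?thesis
      proof cases
        case 2
        then show ?thesis using lower_spanned[OF p1_lower] by simp
      next
        case 4
        then show ?thesis
          using relation1_in_ideal[of "[]" x y n "[]" c] p by (intro lower_spanned ideal_lower) simp
      qed (simp_all add: basis_spanned)
    qed
    moreover have "Poly_Mapping.single [x, y, x, n] c \<in> spanned" if "m = x" for c
    proof -
      have p: "[x, y, x, n] \<in> paths" using that e neighbour_edges ev edge_vertices by (auto simp: paths_Cons)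
      consider "n = y" | "n = v1" | "n = v2" | "n \<noteq> y" "\<And>k. \<not> corner k x y n"
        using corner_at_x by blast
      then show ?thesis
      proof cases
        case 1
        then show ?thesis using lower_spanned[OF loops_lower(1)] by simp
      next
        case 2
        have "Poly_Mapping.single [x, y, w1, v1] c \<in> spanned"
          using lower_spanned[OF lower_append[OF p1_lower, of "[v1]"]] neighbour_edges by (simp add: paths_2)
        moreover have "Poly_Mapping.single [x, y, x, v1] c - Poly_Mapping.single [x, y, w1, v1] c \<in> rauzy_ideal s"
          using relation2_in_ideal[of "[x]" y x v1 "[]" k1 k1 w1 c s] corners1 p 2 by simp
        ultimately show ?thesis using 2 spanned_cong by blast
      next
        case 3
        have "Poly_Mapping.single [x, y, x, v2] c - Poly_Mapping.single [x, y, w2, v2] c \<in> rauzy_ideal s"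
          using relation2_in_ideal[of "[x]" y x v2 "[]" k2 k2 w2 c s] corners2 p 3 by simp
        then show ?thesis using 3 spanned_cong basis_spanned(4) by blast
      next
        case 4
        then show ?thesis
          using relation1_in_ideal[of "[x]" y x n "[]" c] p by (intro lower_spanned ideal_lower) simp
      qed
    qed
    moreover have "Poly_Mapping.single [x, y, w2, n] c \<in> spanned" if "m = w2" for c
      using lower_spanned[OF lower_w2] basis_spanned(4) that e by (cases "n = v2") simp_all
    moreover have "Poly_Mapping.single [x, y, w2, v2, n] c \<in> spanned" if "m = v2" for c
      using lower_spanned[OF lower_v2] that e by simp
    ultimately show ?thesis
      unfolding four_paths_def path_mult_add_left path_mult_single
      using 0 by (intro spanned_add) (auto simp: eq_commute[of _ m])
  qed
  ultimately show ?thesis using spanned_add by (force simp: path_mult_minus_left)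
qed

lemma spanned_path: "x # y # u \<in> paths \<Longrightarrow> Poly_Mapping.single (x # y # u) c \<in> spanned"
proof (induction u rule: rev_induct)
  case Nil
  then show ?case by (simp add: basis_spanned)
next
  case (snoc n u)
  have p: "(x # y # u) @ [n] \<in> paths" using snoc.prems by simp
  then have "x # y # u \<in> paths" by (rule paths_appendD) simp
  moreover have "{last (x # y # u), n} \<in> edges"
    using p unfolding paths_def mem_Collect_eq successively_append_iff by simp
  ultimately have "path_mult (Poly_Mapping.single (x # y # u) c) (path_elt [last (x # y # u), n]) \<in> spanned"
    using snoc.IH spanned_arrow by blast
  then show ?case by (simp add: path_mult_single split: if_splits)
qed

lemma spanned_multiple:
  assumes "g \<in> path_carrier"
  shows "path_mult (path_elt [x, y]) g \<in> spanned"
  using assms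
proof (induction g rule: path_carrier_induct)
  case (single u c)
  show ?case
  proof (cases "hd u = y")
    case True
    then obtain q where q: "u = y # q" using single by (cases u) (auto simp: paths_def)
    then have "x # y # q \<in> paths" using single neighbour_edges edge_vertices by (auto simp: paths_Cons)
    then show ?thesis using spanned_path by (simp add: q path_mult_single)
  next
    case False
    then show ?thesis using lower_spanned zero_lower by (simp add: path_mult_single)
  qed
qed (simp_all add: path_mult_0 path_mult_add_right spanned_add lower_spanned zero_lower)

text \<open>The path v2 -> x -> y -> w1 equals v2 -> x -> v1 -> w1 across the first tile and v2 ->
  w2 -> y -> w1 across the second. By \<open>no_corner_x_or_y\<close> one of these turns at x or at
  y outside every tile and is zero.\<close>

lemma left_kills_lower:
  assumes "f \<in> lower"
  shows "path_mult (path_elt [v2, x]) f \<in> rauzy_ideal s"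
proof -
  obtain g where g: "g \<in> path_carrier" "f - path_mult (path_elt [x, y, w1]) g \<in> rauzy_ideal s"
    using assms unfolding lower_def by blast
  have p: "[v2, x, y, w1] \<in> paths" "[v2, x, v1, w1] \<in> paths" "[v2, w2, y, w1] \<in> paths"
    using neighbour_edges edge_vertices by (auto simp: paths_Cons insert_commute)
  have "path_elt [v2, x, y, w1] \<in> rauzy_ideal s"
    using no_corner_x_or_y
  proof
    assume "\<forall>k. \<not> corner k x v2 v1"
    then have "path_elt [v2, x, v1, w1] \<in> rauzy_ideal s"
      using relation1_in_ideal[of "[]" v2 x v1 "[w1]" 1] p points_distinct by simp
    moreover have "path_elt [v2, x, y, w1] - path_elt [v2, x, v1, w1] \<in> rauzy_ideal s"
      using relation2_in_ideal[of "[v2]" x y w1 "[]" k1 k1 v1 1 s] p corners1 by simp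
    ultimately show ?thesis using rauzy_ideal_closed(2) by fastforce
  next
    assume "\<forall>k. \<not> corner k y w2 w1"
    then have "path_elt [v2, w2, y, w1] \<in> rauzy_ideal s"
      using relation1_in_ideal[of "[v2]" w2 y w1 "[]" 1] p points_distinct by simp
    moreover have "path_elt [v2, x, y, w1] - path_elt [v2, w2, y, w1] \<in> rauzy_ideal s"
      using relation2_in_ideal[of "[]" v2 x y "[w1]" k2 k2 w2 1 s] p corners2 corner_sym by simp
    ultimately show ?thesis using rauzy_ideal_closed(2) by fastforce
  qed
  then have "path_mult (path_mult (path_elt [v2, x]) (path_elt [x, y, w1])) g \<in> rauzy_ideal s"
    using rauzy_ideal_closed(4) g(1) by (simp add: path_mult_single)
  then have 1: "path_mult (path_elt [v2, x]) (path_mult (path_elt [x, y, w1]) g) \<in> rauzy_ideal s"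
    using g(1) by (simp add: generators_carrier path_mult_assoc)
  have "path_mult (path_elt [v2, x]) (f - path_mult (path_elt [x, y, w1]) g) \<in> rauzy_ideal s"
    using g(2) generators_carrier(6) by (rule rauzy_ideal_closed)
  then have "path_mult (path_elt [v2, x]) f - path_mult (path_elt [v2, x]) (path_mult (path_elt [x, y, w1]) g)
      \<in> rauzy_ideal s"
    using g(1) lower_carrier[OF assms] by (simp add: generators_carrier path_mult_minus path_mult_carrier)
  from rauzy_ideal_closed(2)[OF this 1] show ?thesis by simp
qed

text \<open>The four terms end at different vertices, so a path from one of these back to v2
  isolates one coefficient. The closed paths of length four obtained lie on the second tile, and
  each has as its trace the sign \<open>s k2 v2\<close>, which is nonzero in every field.\<close>

lemma left_detects:
  assumes l: "path_mult (path_elt [v2, x]) (four_paths c0 c1 c2 c3) \<in> rauzy_ideal s"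
  shows "c0 = 0 \<and> c1 = 0 \<and> c2 = 0 \<and> c3 = (0 :: 'k::field)"
proof -
  have v: "v2 \<in> vertices" using neighbour_edges edge_vertices by blast
  have nz: "(of_int (s k2 v2) :: 'k) \<noteq> 0"
    using sign_square[OF v, of k2] by (metis mult_zero_left of_int_1 of_int_mult zero_neq_one)
  have cv: "cyclic_value s v2 x y w2 = s k2 v2" "cyclic_value s v2 x y x = s k2 v2"
    using corners2 corner_sym by (auto intro: cyclic_value_corner)
  have d: "x \<noteq> y" "y \<noteq> w2" "x \<noteq> w2" "w2 \<noteq> v2" "y \<noteq> v2" "x \<noteq> v2"
    using step_nonzero corner_distinct[OF corners2(1)] corner_distinct[OF corners2(2)]
    by (auto simp: y v2 w2)
  \<comment> \<open>The trivial path at v2 supplies the left factor in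
    \<open>trace_rauzy_ideal\<close> and changes nothing.\<close>
  have tr: "trace_form s (path_mult (path_mult (path_elt [v2]) (path_mult (path_elt [v2, x])
      (four_paths c0 c1 c2 c3))) (path_elt q)) = 0" if "q \<in> paths" for q
    using trace_rauzy_ideal[OF l] that v by (simp add: path_carrier_closed paths_Cons)
  have f: "path_mult (path_elt [v2]) (path_mult (path_elt [v2, x]) (four_paths c0 c1 c2 c3)) =
      Poly_Mapping.single [v2, x, y] c0 + Poly_Mapping.single [v2, x, y, x] c1
      + Poly_Mapping.single [v2, x, y, w2] c2 + Poly_Mapping.single [v2, x, y, w2, v2] c3"
    by (simp add: four_paths_def path_mult_add_right path_mult_single)
  note [simp] = path_mult_add_left path_mult_single trace_form_add trace_form_single trace_form_0
    path_trace_def cv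
  have "[y, w2, v2] \<in> paths" "[x, v2] \<in> paths" "[w2, v2] \<in> paths" "[v2] \<in> paths"
    using neighbour_edges v by (simp_all add: paths_2 paths_3 paths_Cons[of v2 "[]"])
  from this[THEN tr] show ?thesis using d nz unfolding f by auto
qed

text \<open>Modulo \<open>lower\<close>, which is annihilated, an element of bA is a combination of
  the four paths, and on these left multiplication by v2 -> x is injective.\<close>

lemma kernel_eq:
  assumes g: "g \<in> path_carrier"
  shows "path_mult (path_elt [v2, x]) (path_mult (path_elt [x, y]) g) \<in> rauzy_ideal s \<longleftrightarrow>
    path_mult (path_elt [x, y]) g \<in> lower"
proof
  let ?f = "path_mult (path_elt [x, y]) g"
  assume l: "path_mult (path_elt [v2, x]) ?f \<in> rauzy_ideal s"
  obtain c0 c1 c2 c3 where c: "?f - four_paths c0 c1 c2 c3 \<in> lower"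
    using spanned_multiple[OF g] unfolding spanned_def by blast
  have "four_paths c0 c1 c2 c3 \<in> path_carrier"
    unfolding four_paths_def by (intro path_carrier_closed generators_carrier)
  note pc = this generators_carrier
  have "path_mult (path_elt [v2, x]) ?f - path_mult (path_elt [v2, x]) (?f - four_paths c0 c1 c2 c3)
      \<in> rauzy_ideal s"
    using l left_kills_lower[OF c] by (rule rauzy_ideal_diff)
  then have "path_mult (path_elt [v2, x]) (four_paths c0 c1 c2 c3) \<in> rauzy_ideal s"
    using g by (simp add: pc path_mult_minus path_mult_carrier)
  from left_detects[OF this] show "?f \<in> lower" using c by (simp add: four_paths_def)
qed (rule left_kills_lower)

lemma not_in_lower: "path_elt [x, y] \<notin> lower" "path_elt [x, y, w2] \<notin> lower"
  using left_kills_lower[of "path_elt [x, y]"] left_detects[of 1 0 0 0]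
    left_kills_lower[of "path_elt [x, y, w2]"] left_detects[of 0 0 1 0]
  by (auto simp: four_paths_def)

lemma p1_not_in_ideal: "path_elt [x, y, w1] \<notin> rauzy_ideal s"
  using edge_tiles.not_in_lower(2)[OF swapped] edge_tiles.ideal_lower[OF swapped] by blast

end

section \<open>Passage to the Rauzy algebra\<close>

lemma nonunital_rauzy_algebra: "nonunital_ring (rauzy_algebra s)"
  unfolding rauzy_algebra_def by (rule rauzy_ideal.nonunital_quotient)

global_interpretation rauzy_algebra: nonunital_ring "rauzy_algebra s" for s
  by (rule nonunital_rauzy_algebra)

definition coset :: "(3 \<Rightarrow> real^2 \<Rightarrow> int) \<Rightarrow> (qpath \<Rightarrow>\<^sub>0 'k::field) \<Rightarrow> (qpath \<Rightarrow>\<^sub>0 'k) set" where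
  "coset s f = rauzy_ideal s +>\<^bsub>path_algebra\<^esub> f"

lemma path_class_eq: "path_class s u = coset s (path_elt u)"
  by (simp add: path_class_def coset_def)

lemma carrier_rauzy_algebra: "carrier (rauzy_algebra s) = coset s ` path_carrier"
  unfolding rauzy_algebra_def coset_def by (rule rauzy_ideal.carrier_quotient)

lemma coset_carrier: "f \<in> path_carrier \<Longrightarrow> coset s f \<in> carrier (rauzy_algebra s)"
  by (simp add: carrier_rauzy_algebra)

lemma coset_mult:
  "f \<in> path_carrier \<Longrightarrow> g \<in> path_carrier \<Longrightarrow>
    coset s f \<otimes>\<^bsub>rauzy_algebra s\<^esub> coset s g = coset s (path_mult f g)"
  unfolding rauzy_algebra_def coset_def by (simp add: rauzy_ideal.quotient_mult path_algebra_simps(2))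

lemma coset_eq_iff:
  "f \<in> path_carrier \<Longrightarrow> g \<in> path_carrier \<Longrightarrow> coset s f = coset s g \<longleftrightarrow> f - g \<in> rauzy_ideal s"
  unfolding coset_def by (simp add: rauzy_ideal.rcoset_eq_iff path_algebra_minus)

lemma zero_rauzy_algebra: "\<zero>\<^bsub>rauzy_algebra s\<^esub> = coset s 0"
  unfolding rauzy_algebra_def coset_def
  by (simp add: rauzy_ideal.quotient_zero rauzy_ideal.quotient_zero(2)[unfolded path_algebra_simps(3)])

lemma coset_eq_zero_iff:
  "f \<in> path_carrier \<Longrightarrow> coset s f = \<zero>\<^bsub>rauzy_algebra s\<^esub> \<longleftrightarrow> f \<in> rauzy_ideal s"
  by (simp add: zero_rauzy_algebra coset_eq_iff path_carrier_closed)

lemma cyclic_carrier: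
  assumes "f \<in> path_carrier"
  shows "carrier (cyclic_right_ideal (rauzy_algebra s) (coset s f)) = (\<lambda>g. coset s (path_mult f g)) ` path_carrier"
  using assms by (auto simp: rauzy_algebra.cyclic_simps carrier_rauzy_algebra coset_mult image_image cong: image_cong)

text \<open>The idempotent at the last vertex replaces the missing identity.\<close>

lemma path_class_cyclic:
  assumes u: "u \<in> paths"
  shows "path_class s u \<in> carrier (cyclic_right_ideal (rauzy_algebra s) (path_class s u))"
proof -
  have "last u \<in> vertices" using u by (auto simp: paths_def)
  then show ?thesis
    unfolding path_class_eq cyclic_carrier[OF path_carrier_closed(5)[OF u]]
    by (intro image_eqI[of _ _ "path_elt [last u]"])
      (simp_all add: path_mult_single path_carrier_closed paths_Cons)
qed

lemma all_upto_2: "(\<forall>j\<le>2. P j) \<longleftrightarrow> P 0 \<and> P 1 \<and> P (2 :: nat)"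
  by (auto simp: le_Suc_eq numeral_2_eq_2)

lemma all_below_2: "(\<forall>j<2. P j) \<longleftrightarrow> P 0 \<and> P (1 :: nat)"
  by (auto simp: less_Suc_eq numeral_2_eq_2)

section \<open>The filtration given by one of the two tiles\<close>

context edge_tiles
begin

lemma lower_cyclic:
  assumes f: "f \<in> path_carrier"
  shows "coset s f \<in> carrier (cyclic_right_ideal (rauzy_algebra s) (path_class s [x, y, w1])) \<longleftrightarrow> f \<in> lower"
proof -
  have "coset s f = coset s (path_mult (path_elt [x, y, w1]) g) \<longleftrightarrow>
      f - path_mult (path_elt [x, y, w1]) g \<in> rauzy_ideal s" if "g \<in> path_carrier" for g
    using f that by (simp add: coset_eq_iff generators_carrier path_mult_carrier)
  then show ?thesis
    unfolding path_class_eq cyclic_carrier[OF generators_carrier(4)] lower_def using f by blast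
qed

lemma corner_rhombus:
  assumes k: "corner k m u z"
    and iso: "module_iso (rauzy_algebra s) M (cyclic_right_ideal (rauzy_algebra s) (path_class s [u, m, z]))"
  shows "rhombus_module s M"
  using corner_sides[OF k] iso unfolding rhombus_module_def by blast

lemma filtration:
  fixes A :: "(qpath \<Rightarrow>\<^sub>0 'k::field) set ring"
  defines "A \<equiv> rauzy_algebra s"
  shows "rhombus_filtration s (cyclic_right_ideal A (path_class s [x, y])) 2
    [{\<zero>\<^bsub>A\<^esub>}, carrier (cyclic_right_ideal A (path_class s [x, y, w1])),
     carrier (cyclic_right_ideal A (path_class s [x, y]))]"
proof -
  let ?b = "path_class s [x, y] :: (qpath \<Rightarrow>\<^sub>0 'k) set"
  let ?c = "path_class s [x, y, w1] :: (qpath \<Rightarrow>\<^sub>0 'k) set"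
  let ?l = "path_class s [v2, x] :: (qpath \<Rightarrow>\<^sub>0 'k) set"
  let ?B = "cyclic_right_ideal A ?b" and ?C = "cyclic_right_ideal A ?c"
  interpret A: nonunital_ring A unfolding A_def by (rule nonunital_rauzy_algebra)
  have mem: "?b \<in> carrier A" "?c \<in> carrier A" "?l \<in> carrier A"
    unfolding A_def path_class_eq by (intro coset_carrier generators_carrier)+
  have prod: "?l \<otimes>\<^bsub>A\<^esub> ?b = path_class s [v2, x, y]"
    by (simp add: A_def path_class_eq coset_mult generators_carrier path_mult_single)
  have B: "carrier ?B = ?b <#\<^bsub>A\<^esub> carrier A"
    and C: "carrier ?C = ?c <#\<^bsub>A\<^esub> carrier A"
    by (simp_all add: cyclic_right_ideal_def right_ideal_module_simps)
  \<comment> \<open>As the kernel of left multiplication by v2 -> x, the middle term has the cyclic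
    module of v2 -> x -> y as its quotient in bA.\<close>
  have C_eq: "carrier ?C = {m \<in> carrier ?B. ?l \<otimes>\<^bsub>A\<^esub> m = \<zero>\<^bsub>A\<^esub>}"
  proof (intro equalityI subsetI)
    fix m assume m: "m \<in> carrier ?C"
    then obtain g where g: "g \<in> path_carrier" "m = coset s (path_mult (path_elt [x, y, w1]) g)"
      unfolding A_def path_class_eq by (auto simp: cyclic_carrier generators_carrier)
    have h: "path_mult (path_elt [y, w1]) g \<in> path_carrier"
      using g(1) neighbour_edges by (simp add: path_mult_carrier path_carrier_closed paths_2)
    have e: "path_mult (path_elt [x, y, w1]) g = path_mult (path_elt [x, y]) (path_mult (path_elt [y, w1]) g)"
      using g(1) neighbour_edges
      by (simp add: path_mult_assoc[symmetric] path_carrier_closed paths_2 path_mult_single)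
    have "m \<in> carrier ?B"
      unfolding A_def path_class_eq cyclic_carrier[OF generators_carrier(3)] g(2) e using h by blast
    moreover have "path_mult (path_elt [x, y, w1]) g \<in> lower"
      using lower_right[OF p1_lower g(1)] .
    then have "?l \<otimes>\<^bsub>A\<^esub> m = \<zero>\<^bsub>A\<^esub>"
      using g(1) left_kills_lower unfolding A_def path_class_eq g(2)
      by (simp add: coset_mult generators_carrier path_mult_carrier coset_eq_zero_iff)
    ultimately show "m \<in> {m \<in> carrier ?B. ?l \<otimes>\<^bsub>A\<^esub> m = \<zero>\<^bsub>A\<^esub>}" by blast
  next
    fix m assume "m \<in> {m \<in> carrier ?B. ?l \<otimes>\<^bsub>A\<^esub> m = \<zero>\<^bsub>A\<^esub>}"
    then have "m \<in> carrier ?B" and z: "?l \<otimes>\<^bsub>A\<^esub> m = \<zero>\<^bsub>A\<^esub>" by blast+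
    then obtain g where g: "g \<in> path_carrier" "m = coset s (path_mult (path_elt [x, y]) g)"
      unfolding A_def path_class_eq by (auto simp: cyclic_carrier generators_carrier)
    have "path_mult (path_elt [v2, x]) (path_mult (path_elt [x, y]) g) \<in> rauzy_ideal s"
      using z g(1) unfolding A_def path_class_eq g(2)
      by (simp add: coset_mult generators_carrier path_mult_carrier coset_eq_zero_iff)
    then have "path_mult (path_elt [x, y]) g \<in> lower" using kernel_eq[OF g(1)] by blast
    then show "m \<in> carrier ?C"
      unfolding A_def g(2) using g(1) by (simp add: lower_cyclic generators_carrier path_mult_carrier)
  qed
  have zero_C: "\<zero>\<^bsub>A\<^esub> \<in> carrier ?C"
    unfolding C by (rule additive_subgroup.zero_closed[OF A.right_multiples_subgroup[OF mem(2)]])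
  have strict0: "{\<zero>\<^bsub>A\<^esub>} \<subset> carrier ?C"
  proof -
    have "?c \<noteq> \<zero>\<^bsub>A\<^esub>"
      using p1_not_in_ideal unfolding A_def path_class_eq by (simp add: coset_eq_zero_iff generators_carrier)
    then show ?thesis using zero_C path_class_cyclic[OF p1_path] unfolding A_def by blast
  qed
  have strict1: "carrier ?C \<subset> carrier ?B"
  proof -
    have "?b \<in> carrier ?B" unfolding A_def using neighbour_edges by (intro path_class_cyclic) (simp add: paths_2)
    moreover have "?b \<notin> carrier ?C"
      unfolding A_def path_class_eq[of s "[x, y]"]
      by (simp add: lower_cyclic not_in_lower(1) generators_carrier)
    ultimately show ?thesis unfolding C_eq by blast
  qed
  have zero: "additive_subgroup {\<zero>\<^bsub>A\<^esub>} A"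
    by (intro additive_subgroupI A.add.subgroupI) auto
  have subC: "additive_subgroup (carrier ?C) A" and subB: "additive_subgroup (carrier ?B) A"
    unfolding B C by (intro A.right_multiples_subgroup mem)+
  have act: "m \<otimes>\<^bsub>A\<^esub> r \<in> carrier (cyclic_right_ideal A c)"
    if "m \<in> carrier (cyclic_right_ideal A c)" "r \<in> carrier A" "c \<in> carrier A" for m r c
    using that by (auto simp: A.cyclic_simps A.m_assoc A.m_closed)
  have subI: "right_submodule A N ?B" if "additive_subgroup N A" "N \<subseteq> carrier ?B"
    "\<And>n r. n \<in> N \<Longrightarrow> r \<in> carrier A \<Longrightarrow> n \<otimes>\<^bsub>A\<^esub> r \<in> N" for N
    unfolding cyclic_right_ideal_def
    by (rule A.right_submoduleI) (use that subB B in simp_all)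
  have sub: "right_submodule A {\<zero>\<^bsub>A\<^esub>} ?B" "right_submodule A (carrier ?C) ?B"
    "right_submodule A (carrier ?B) ?B"
  proof -
    show "right_submodule A {\<zero>\<^bsub>A\<^esub>} ?B"
      using zero strict0 strict1 A.l_null by (intro subI) auto
    show "right_submodule A (carrier ?C) ?B"
      using subC strict1 act mem(2) by (intro subI) auto
    show "right_submodule A (carrier ?B) ?B"
      using subB act mem(1) by (intro subI) auto
  qed
  have BC: "?B\<lparr>carrier := carrier ?C\<rparr> = ?C" "?B\<lparr>carrier := carrier ?B\<rparr> = ?B"
    by (simp_all add: cyclic_right_ideal_def right_ideal_module_simps)
  have rh0: "rhombus_module s (quotient_module ?C {\<zero>\<^bsub>A\<^esub>})"
    using corners1(2) A.cyclic_quotient_zero_iso[OF mem(2)] unfolding A_def by (rule corner_rhombus)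
  have "corner k2 x v2 y" using corners2(1) corner_sym by blast
  then have rh1: "rhombus_module s (quotient_module ?B (carrier ?C))"
    using A.cyclic_quotient_iso[OF mem(1) mem(3) C_eq] unfolding prod unfolding A_def
    by (rule corner_rhombus)
  have one: "\<one>\<^bsub>?B\<^esub> = \<zero>\<^bsub>A\<^esub>" by (rule A.cyclic_simps)
  show ?thesis
    unfolding rhombus_filtration_def all_upto_2 all_below_2
    using sub strict0 strict1 rh0 rh1
    by (simp add: one BC A_def[symmetric] numeral_2_eq_2)
qed

text \<open>The class of x -> y -> w2 separates the middle terms: it generates one of them, and left
  multiplication by v2 -> x annihilates the other but not this class.\<close>

lemma filtrations_distinct:
  "carrier (cyclic_right_ideal (rauzy_algebra s) (path_class s [x, y, w2])) \<noteq>
   (carrier (cyclic_right_ideal (rauzy_algebra s) (path_class s [x, y, w1])) :: (qpath \<Rightarrow>\<^sub>0 'k::field) set set)"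
proof -
  have "(path_elt [x, y, w2] :: qpath \<Rightarrow>\<^sub>0 'k) \<in> edge_tiles.lower s x y w2"
    by (rule edge_tiles.p1_lower[OF swapped])
  then have "coset s (path_elt [x, y, w2] :: qpath \<Rightarrow>\<^sub>0 'k) \<in>
      carrier (cyclic_right_ideal (rauzy_algebra s) (path_class s [x, y, w2]))"
    by (simp add: edge_tiles.lower_cyclic[OF swapped] generators_carrier)
  moreover have "coset s (path_elt [x, y, w2] :: qpath \<Rightarrow>\<^sub>0 'k) \<notin>
      carrier (cyclic_right_ideal (rauzy_algebra s) (path_class s [x, y, w1]))"
    using not_in_lower(2) by (simp add: lower_cyclic generators_carrier)
  ultimately show ?thesis by metis
qed

end

theorem lemma2:
  fixes s :: "3 \<Rightarrow> real^2 \<Rightarrow> int" and x y :: "real^2"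
    and bA :: "((qpath \<Rightarrow>\<^sub>0 'k::field) set, (qpath \<Rightarrow>\<^sub>0 'k) set) rmodule"
  assumes "sign_choice s"
    and "{x, y} \<in> edges"
    and "bA = cyclic_right_ideal (rauzy_algebra s) (path_class s [x, y])"
  shows "\<exists>F G. F \<noteq> G \<and> rhombus_filtration s bA 2 F \<and> rhombus_filtration s bA 2 G"
proof -
  obtain a \<sigma> where y: "y = x + step a \<sigma>" using edge_steps[OF assms(2)] .
  then have "{x, x + step a \<sigma>} \<in> edges" using assms(2) by simp
  then show ?thesis
  proof (rule edge_two_tiles)
    fix k1 d1 \<tau>1 k2 d2 \<tau>2
    assume t: "tile_corner k1 x a \<sigma> d1 \<tau>1" "tile_corner k2 x a \<sigma> d2 \<tau>2" "(d1, \<tau>1) \<noteq> (d2, \<tau>2)"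
      "\<And>k d \<tau>. tile_corner k x a \<sigma> d \<tau> \<Longrightarrow> (d, \<tau>) = (d1, \<tau>1) \<or> (d, \<tau>) = (d2, \<tau>2)"
    interpret edge_tiles s x y "x + step d1 \<tau>1" "y + step d1 \<tau>1" "x + step d2 \<tau>2" "y + step d2 \<tau>2"
      a d1 d2 k1 k2 \<sigma> \<tau>1 \<tau>2
      using assms(1) t y by unfold_locales (assumption | rule refl | blast)+
    let ?c = "\<lambda>u. carrier (cyclic_right_ideal (rauzy_algebra s) (path_class s u)) :: (qpath \<Rightarrow>\<^sub>0 'k) set set"
    let ?F = "\<lambda>w. [{\<zero>\<^bsub>rauzy_algebra s\<^esub>}, ?c [x, y, w], ?c [x, y]]"
    have "?F (y + step d2 \<tau>2) \<noteq> ?F (y + step d1 \<tau>1)" using filtrations_distinct by simp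
    moreover have "rhombus_filtration s bA 2 (?F (y + step d1 \<tau>1))"
      unfolding assms(3) by (rule filtration)
    moreover have "rhombus_filtration s bA 2 (?F (y + step d2 \<tau>2))"
      unfolding assms(3) by (rule edge_tiles.filtration[OF swapped])
    ultimately show ?thesis
      by (intro exI[of _ "?F (y + step d2 \<tau>2)"] exI[of _ "?F (y + step d1 \<tau>1)"] conjI)
  qed
qed

end
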